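(* Let $u_0\in GL_n(R)$, $\alpha\in\mathfrak{gl}_n(R)$, and let $\Delta\in\mathfrak{gl}_n(A)$ be arbitrary. Then: 1) There is a unique $u\in GL_n(R)$ with $\delta u=\Delta^{\alpha}(u)$ and $u\equiv u_0 \bmod p$. 2) If $\mathcal O$ is a complete valuation subring of $R$ and the entries of $\Delta$ lie in $\mathcal O[x,\det(x)^{-1}]^{\wedge}$ (the $p$-adic completion), $u_0\in GL_n(\mathcal O)$ and $\alpha\in\mathfrak{gl}_n(\mathcal O)$, then the solution $u$ of 1) has entries in $\mathcal O$. 3) If $u_0\in SL_n(R)$, $\alpha\in\mathfrak{sl}_{n,\delta}$ and $\Delta$ is of type $SL_n$, then $u\in SL_n(R)$. 4) If $u_0\in SO(q)$, $\alpha\in\mathfrak{so}(q)_{\delta}$ and $\Delta$ is of type $SO(q)$, then $u\in SO(q)$. 5) If $u_0$ and $\alpha$ have entries in a valuation $\delta$-subring $\mathcal O$ of $R$ with finite residue field and either $\Delta=0$ (type $GL_n$), or $\Delta$ is of type $SL_n$ and $u\in SL_n(R)$, then $u$ has entries in a $\delta$-subring of $R$ which is generically finite over $\mathcal O$.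
   Context: Let $p$ be an odd prime, $k$ an algebraic closure of $\mathbb F_p$, and $R$ the unique complete discrete valuation ring with maximal ideal $pR$ and residue field $k$ (so $R=W(k)$); $K$ is its fraction field. $\phi:R\to R$ is the unique ring homomorphism lifting the $p$-power Frobenius of $k$, and $\delta:R\to R$ is $\delta a=(\phi(a)-a^p)/p$. For a matrix $u=(u_{ij})$ with entries in a ring on which these operations make sense, $\phi(u)=(\phi(u_{ij}))$, $\delta u=(\delta u_{ij})$, $u^{(p)}=(u_{ij}^p)$. $\mathfrak{gl}_n(B)$ denotes $n\times n$ matrices over $B$. Let $x$ be an $n\times n$ matrix of indeterminates and $A=R[x,\det(x)^{-1}]^{\wedge}$ its $p$-adic completion. For $\Delta\in\mathfrak{gl}_n(A)$ let $\Phi(x)=x^{(p)}+p\Delta(x)$ and, for $\alpha\in\mathfrak{gl}_n(R)$, $\Delta^{\alpha}(x)=\alpha\Phi(x)+\Delta(x)$. Type $SL_n$: $p\nmid n$ and $\Delta(x)=\frac{\lambda(x)-1}{p}x^{(p)}$ with $\lambda(x)=\left(\det(x^{(p)})/\det(x)^p\right)^{-1/n}$, the power computed via the binomial series $(1+pt)^a=\sum_k\binom{a}{k}p^kt^k$, $a\in\mathbb Z_p$. Also $\mathfrak{sl}_{n,\delta}=\{\alpha\in\mathfrak{gl}_n(R):\det(1+p\alpha)=1\}$. Type $SO(q)$: $q$ is one of $\begin{pmatrix}0&1_r\\-1_r&0\end{pmatrix}$, $\begin{pmatrix}0&1_r\\1_r&0\end{pmatrix}$ ($n=2r$), or $\begin{pmatrix}1&0&0\\0&0&1_r\\0&1_r&0\end{pmatrix}$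 ($n=2r+1$); $SO(q)\subset SL_n$ is the identity component of the group $\{x: x^tqx=q\}$; $\Lambda(x)=\left(((x^{(p)})^tqx^{(p)})^{-1}(x^tqx)^{(p)}\right)^{1/2}$ computed via the binomial series for matrices $1+pT$, and $\Delta(x)=x^{(p)}\frac{\Lambda(x)-1}{p}$. Also $\mathfrak{so}(q)_\delta=\{\alpha\in\mathfrak{gl}_n(R):1+p\alpha\in SO(q)\}$. A $\delta$-subring of $R$ is a subring $\mathcal O$ with $\delta\mathcal O\subset\mathcal O$. A valuation subring of $R$ is the intersection of $R$ with a subfield of $K$. An extension of integral domains is generically finite if the induced extension of fraction fields is finite. *)

theory Defs
  imports "HOL-Computational_Algebra.Polynomial" "Jordan_Normal_Form.Determinant"
begin

text \<open>Conventions. K is modelled by a field type 'k of characteristic 0, R by a subset of it.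
  p is a natural number, used in K via of_nat. Matrices are Jordan_Normal_Form matrices;
  the n x n matrices with entries in a set S are mat_in n S.\<close>

definition subring_of :: "'k::field set \<Rightarrow> bool" where
  "subring_of S \<longleftrightarrow> 0 \<in> S \<and> 1 \<in> S \<and> (\<forall>a\<in>S. \<forall>b\<in>S. a + b \<in> S \<and> a * b \<in> S) \<and> (\<forall>a\<in>S. - a \<in> S)"

definition subfield_of :: "'k::field set \<Rightarrow> bool" where
  "subfield_of F \<longleftrightarrow> subring_of F \<and> (\<forall>a\<in>F. a \<noteq> 0 \<longrightarrow> inverse a \<in> F)"

definition pideal :: "'k::field set \<Rightarrow> nat \<Rightarrow> nat \<Rightarrow> 'k set" where
  "pideal R p k = {of_nat p ^ k * r | r. r \<in> R}"

definition padic_lim :: "'k::field set \<Rightarrow> nat \<Rightarrow> (nat \<Rightarrow> 'k) \<Rightarrow> 'k \<Rightarrow> bool" where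
  "padic_lim R p s L \<longleftrightarrow> (\<forall>k. \<exists>N. \<forall>m\<ge>N. s m - L \<in> pideal R p k)"

definition padic_cauchy :: "'k::field set \<Rightarrow> nat \<Rightarrow> (nat \<Rightarrow> 'k) \<Rightarrow> bool" where
  "padic_cauchy R p s \<longleftrightarrow> (\<forall>k. \<exists>N. \<forall>m\<ge>N. \<forall>m'\<ge>N. s m - s m' \<in> pideal R p k)"

definition padic_complete :: "'k::field set \<Rightarrow> nat \<Rightarrow> 'k set \<Rightarrow> bool" where
  "padic_complete R p Ov \<longleftrightarrow>
     (\<forall>s. (\<forall>m. s m \<in> Ov) \<and> padic_cauchy R p s \<longrightarrow> (\<exists>L\<in>Ov. padic_lim R p s L))"

text \<open>R is a complete discrete valuation ring with maximal ideal pR, fraction field K,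
  and residue field R/pR an algebraic closure of F_p (algebraically closed, and every
  element algebraic over F_p, i.e. fixed by some power of Frobenius). These properties
  characterize R = W(k) (k an algebraic closure of F_p) up to isomorphism.\<close>
definition witt_ring_alg_closure :: "'k::field_char_0 set \<Rightarrow> nat \<Rightarrow> bool" where
  "witt_ring_alg_closure R p \<longleftrightarrow>
     subring_of R \<and>
     inverse (of_nat p) \<notin> R \<and>
     (\<forall>x::'k. x \<noteq> 0 \<longrightarrow> (\<exists>m::int. \<exists>v\<in>R. inverse v \<in> R \<and> x = of_nat p powi m * v)) \<and>
     padic_complete R p R \<and>
     (\<forall>f. (\<forall>i. coeff f i \<in> R) \<and> degree f \<ge> 1 \<and> lead_coeff f = 1 \<longrightarrow>
          (\<exists>a\<in>R. poly f a \<in> pideal R p 1)) \<and>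
     (\<forall>a\<in>R. \<exists>m\<ge>1. a ^ (p ^ m) - a \<in> pideal R p 1)"

text \<open>phi is a ring endomorphism of R lifting the p-power Frobenius (such a phi is unique)\<close>
definition frob_lift :: "'k::field set \<Rightarrow> nat \<Rightarrow> ('k \<Rightarrow> 'k) \<Rightarrow> bool" where
  "frob_lift R p \<phi> \<longleftrightarrow> (\<forall>a\<in>R. \<phi> a \<in> R) \<and> \<phi> 1 = 1 \<and>
     (\<forall>a\<in>R. \<forall>b\<in>R. \<phi> (a + b) = \<phi> a + \<phi> b \<and> \<phi> (a * b) = \<phi> a * \<phi> b) \<and>
     (\<forall>a\<in>R. \<phi> a - a ^ p \<in> pideal R p 1)"

definition pdelta :: "nat \<Rightarrow> ('k::field \<Rightarrow> 'k) \<Rightarrow> 'k \<Rightarrow> 'k" where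
  "pdelta p \<phi> a = (\<phi> a - a ^ p) / of_nat p"

definition mat_in :: "nat \<Rightarrow> 'k::field set \<Rightarrow> 'k mat set" where
  "mat_in n S = {A \<in> carrier_mat n n. \<forall>i<n. \<forall>j<n. A $$ (i, j) \<in> S}"

definition GLm :: "nat \<Rightarrow> 'k::field set \<Rightarrow> 'k mat set" where
  "GLm n S = {A \<in> mat_in n S. det A \<noteq> 0 \<and> inverse (det A) \<in> S}"

definition SLm :: "nat \<Rightarrow> 'k::field set \<Rightarrow> 'k mat set" where
  "SLm n S = {A \<in> mat_in n S. det A = 1}"

definition frobp :: "nat \<Rightarrow> 'k::field mat \<Rightarrow> 'k mat" where
  "frobp p A = map_mat (\<lambda>a. a ^ p) A"

definition inv_m :: "'k::field mat \<Rightarrow> 'k mat" where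
  "inv_m B = inverse (det B) \<cdot>\<^sub>m adj_mat B"

definition mat_cong_p :: "'k::field set \<Rightarrow> nat \<Rightarrow> nat \<Rightarrow> 'k mat \<Rightarrow> 'k mat \<Rightarrow> bool" where
  "mat_cong_p R p n A B \<longleftrightarrow> (\<forall>i<n. \<forall>j<n. A $$ (i, j) - B $$ (i, j) \<in> pideal R p 1)"

inductive_set polyfun :: "nat \<Rightarrow> 'k::field set \<Rightarrow> ('k mat \<Rightarrow> 'k) set"
  for n :: nat and Ov :: "'k set" where
  pf_const: "c \<in> Ov \<Longrightarrow> (\<lambda>x. c) \<in> polyfun n Ov"
| pf_var: "i < n \<Longrightarrow> j < n \<Longrightarrow> (\<lambda>x. x $$ (i, j)) \<in> polyfun n Ov"
| pf_add: "f \<in> polyfun n Ov \<Longrightarrow> g \<in> polyfun n Ov \<Longrightarrow> (\<lambda>x. f x + g x) \<in> polyfun n Ov"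
| pf_mult: "f \<in> polyfun n Ov \<Longrightarrow> g \<in> polyfun n Ov \<Longrightarrow> (\<lambda>x. f x * g x) \<in> polyfun n Ov"

text \<open>Elements of the p-adic completion of Ov[x, det(x)^-1], viewed as functions on GL_n(R):
  p-adic (uniform) limits of functions F(x)/det(x)^m, F a polynomial over Ov.\<close>
definition Acompl :: "'k::field set \<Rightarrow> nat \<Rightarrow> nat \<Rightarrow> 'k set \<Rightarrow> ('k mat \<Rightarrow> 'k) set" where
  "Acompl R p n Ov = {f. \<forall>k. \<exists>F\<in>polyfun n Ov. \<exists>m::nat.
       \<forall>x\<in>GLm n R. f x - F x / det x ^ m \<in> pideal R p k}"

text \<open>An element Delta of gl_n(A) is given by its entries D i j; Delta(x) is:\<close>
definition Dmat :: "nat \<Rightarrow> (nat \<Rightarrow> nat \<Rightarrow> 'k mat \<Rightarrow> 'k) \<Rightarrow> 'k mat \<Rightarrow> 'k::field mat" where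
  "Dmat n D x = mat n n (\<lambda>(i, j). D i j x)"

definition PhiD :: "nat \<Rightarrow> nat \<Rightarrow> (nat \<Rightarrow> nat \<Rightarrow> 'k mat \<Rightarrow> 'k) \<Rightarrow> 'k mat \<Rightarrow> 'k::field mat" where
  "PhiD p n D x = frobp p x + of_nat p \<cdot>\<^sub>m Dmat n D x"

definition DeltaAlpha :: "nat \<Rightarrow> nat \<Rightarrow> (nat \<Rightarrow> nat \<Rightarrow> 'k mat \<Rightarrow> 'k) \<Rightarrow> 'k mat \<Rightarrow> 'k mat \<Rightarrow> 'k::field mat" where
  "DeltaAlpha p n D \<alpha> x = \<alpha> * PhiD p n D x + Dmat n D x"

definition is_solution ::
  "'k::field set \<Rightarrow> nat \<Rightarrow> ('k \<Rightarrow> 'k) \<Rightarrow> nat \<Rightarrow> (nat \<Rightarrow> nat \<Rightarrow> 'k mat \<Rightarrow> 'k) \<Rightarrow> 'k mat \<Rightarrow> 'k mat \<Rightarrow> 'k mat \<Rightarrow> bool" where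
  "is_solution R p \<phi> n D \<alpha> u0 u \<longleftrightarrow> u \<in> GLm n R \<and>
     map_mat (pdelta p \<phi>) u = DeltaAlpha p n D \<alpha> u \<and> mat_cong_p R p n u u0"

definition bin_series :: "'k::field_char_0 set \<Rightarrow> nat \<Rightarrow> 'k \<Rightarrow> 'k \<Rightarrow> 'k" where
  "bin_series R p a t = (THE L. padic_lim R p (\<lambda>m. \<Sum>k<m. (a gchoose k) * of_nat p ^ k * t ^ k) L)"

definition mat_bin_series :: "'k::field_char_0 set \<Rightarrow> nat \<Rightarrow> nat \<Rightarrow> 'k \<Rightarrow> 'k mat \<Rightarrow> 'k mat" where
  "mat_bin_series R p n a T = (THE L. L \<in> carrier_mat n n \<and> (\<forall>i<n. \<forall>j<n.
      padic_lim R p (\<lambda>m. \<Sum>k<m. (a gchoose k) * of_nat p ^ k * (T ^\<^sub>m k) $$ (i, j)) (L $$ (i, j))))"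

definition lambda_SL :: "'k::field_char_0 set \<Rightarrow> nat \<Rightarrow> nat \<Rightarrow> 'k mat \<Rightarrow> 'k" where
  "lambda_SL R p n x = bin_series R p (- (1 / of_nat n))
      ((det (frobp p x) / det x ^ p - 1) / of_nat p)"

definition Delta_SL :: "'k::field_char_0 set \<Rightarrow> nat \<Rightarrow> nat \<Rightarrow> 'k mat \<Rightarrow> 'k mat" where
  "Delta_SL R p n x = ((lambda_SL R p n x - 1) / of_nat p) \<cdot>\<^sub>m frobp p x"

definition type_SL :: "'k::field_char_0 set \<Rightarrow> nat \<Rightarrow> nat \<Rightarrow> (nat \<Rightarrow> nat \<Rightarrow> 'k mat \<Rightarrow> 'k) \<Rightarrow> bool" where
  "type_SL R p n D \<longleftrightarrow> \<not> p dvd n \<and> (\<forall>x\<in>GLm n R. Dmat n D x = Delta_SL R p n x)"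

definition sl_delta :: "'k::field set \<Rightarrow> nat \<Rightarrow> nat \<Rightarrow> 'k mat set" where
  "sl_delta R p n = {\<alpha> \<in> mat_in n R. det (1\<^sub>m n + of_nat p \<cdot>\<^sub>m \<alpha>) = 1}"

definition q_symp :: "nat \<Rightarrow> 'k::field mat" where
  "q_symp r = mat (2 * r) (2 * r) (\<lambda>(i, j).
     if i < r \<and> j = i + r then 1 else if r \<le> i \<and> j + r = i then -1 else 0)"

definition q_split :: "nat \<Rightarrow> 'k::field mat" where
  "q_split r = mat (2 * r) (2 * r) (\<lambda>(i, j).
     if i < r \<and> j = i + r then 1 else if r \<le> i \<and> j + r = i then 1 else 0)"

definition q_odd :: "nat \<Rightarrow> 'k::field mat" where
  "q_odd r = mat (2 * r + 1) (2 * r + 1) (\<lambda>(i, j).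
     if i = 0 \<and> j = 0 then 1
     else if 1 \<le> i \<and> i \<le> r \<and> j = i + r then 1
     else if r + 1 \<le> i \<and> j + r = i then 1 else 0)"

definition admissible_q :: "nat \<Rightarrow> 'k::field mat \<Rightarrow> bool" where
  "admissible_q n q \<longleftrightarrow> (\<exists>r. (n = 2 * r \<and> (q = q_symp r \<or> q = q_split r)) \<or>
                              (n = 2 * r + 1 \<and> q = q_odd r))"

text \<open>SO(q)(S): the identity component of {x. x^t q x = q}, i.e. its intersection with SL_n\<close>
definition SOq :: "nat \<Rightarrow> 'k::field set \<Rightarrow> 'k mat \<Rightarrow> 'k mat set" where
  "SOq n S q = {x \<in> SLm n S. transpose_mat x * q * x = q}"

definition so_delta :: "'k::field set \<Rightarrow> nat \<Rightarrow> nat \<Rightarrow> 'k mat \<Rightarrow> 'k mat set" where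
  "so_delta R p n q = {\<alpha> \<in> mat_in n R. 1\<^sub>m n + of_nat p \<cdot>\<^sub>m \<alpha> \<in> SOq n R q}"

definition Lambda_SO :: "'k::field_char_0 set \<Rightarrow> nat \<Rightarrow> nat \<Rightarrow> 'k mat \<Rightarrow> 'k mat \<Rightarrow> 'k mat" where
  "Lambda_SO R p n q x =
     (let M = inv_m (transpose_mat (frobp p x) * q * frobp p x) * frobp p (transpose_mat x * q * x);
          T = inverse (of_nat p) \<cdot>\<^sub>m (M - 1\<^sub>m n)
      in mat_bin_series R p n (1 / 2) T)"

definition Delta_SO :: "'k::field_char_0 set \<Rightarrow> nat \<Rightarrow> nat \<Rightarrow> 'k mat \<Rightarrow> 'k mat \<Rightarrow> 'k mat" where
  "Delta_SO R p n q x = frobp p x * (inverse (of_nat p) \<cdot>\<^sub>m (Lambda_SO R p n q x - 1\<^sub>m n))"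

definition type_SO :: "'k::field_char_0 set \<Rightarrow> nat \<Rightarrow> nat \<Rightarrow> 'k mat \<Rightarrow> (nat \<Rightarrow> nat \<Rightarrow> 'k mat \<Rightarrow> 'k) \<Rightarrow> bool" where
  "type_SO R p n q D \<longleftrightarrow> admissible_q n q \<and> (\<forall>x\<in>GLm n R. Dmat n D x = Delta_SO R p n q x)"

definition valuation_subring :: "'k::field set \<Rightarrow> 'k set \<Rightarrow> bool" where
  "valuation_subring R Ov \<longleftrightarrow> (\<exists>F. subfield_of F \<and> Ov = R \<inter> F)"

definition delta_subring :: "'k::field set \<Rightarrow> nat \<Rightarrow> ('k \<Rightarrow> 'k) \<Rightarrow> 'k set \<Rightarrow> bool" where
  "delta_subring R p \<phi> Ov \<longleftrightarrow> subring_of Ov \<and> Ov \<subseteq> R \<and> (\<forall>a\<in>Ov. pdelta p \<phi> a \<in> Ov)"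

definition nonunits_of :: "'k::field set \<Rightarrow> 'k set" where
  "nonunits_of Ov = {x \<in> Ov. x = 0 \<or> inverse x \<notin> Ov}"

definition finite_residue_field :: "'k::field set \<Rightarrow> bool" where
  "finite_residue_field Ov \<longleftrightarrow> finite ((\<lambda>x. {y \<in> Ov. x - y \<in> nonunits_of Ov}) ` Ov)"

definition frac_of :: "'k::field set \<Rightarrow> 'k set" where
  "frac_of Ov = {a / b | a b. a \<in> Ov \<and> b \<in> Ov \<and> b \<noteq> 0}"

definition generically_finite :: "'k::field set \<Rightarrow> 'k set \<Rightarrow> bool" where
  "generically_finite Ov Ov' \<longleftrightarrow> Ov \<subseteq> Ov' \<and>
     (\<exists>S. finite S \<and> frac_of Ov' \<subseteq> {\<Sum>s\<in>S. c s * s | c. \<forall>s\<in>S. c s \<in> frac_of Ov})"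

end

theory Submission
  imports Defs
    "HOL-Computational_Algebra.Formal_Power_Series"
    "HOL-Library.Multiset"
    "Jordan_Normal_Form.Char_Poly"
begin

text \<open>
  The equation reads \<open>\<phi>(u) = (1 + p\<alpha>) \<Phi>(u)\<close> with \<open>\<Phi>(u) \<equiv> u\<^sup>(\<^sup>p\<^sup>) mod p\<close>. Since \<open>\<Phi>\<close> gains a factor \<open>p\<close> on
  congruences and \<open>\<phi>\<close> is bijective, \<open>u \<mapsto> \<phi>\<inverse>((1 + p\<alpha>) \<Phi>(u))\<close> is a contraction of the residue class of \<open>u\<^sub>0\<close>;
  \<open>\<phi>\<inverse>\<close> preserves every complete valuation subring because such a ring contains the Teichmueller
  representatives of its elements.

  For the groups, the binomial series are chosen so that \<open>d = det u\<close>, respectively every entry \<open>d\<close> of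
  \<open>u\<^sup>t q u\<close>, satisfies \<open>\<phi>(d) = d\<^sup>p\<close>. A solution of this equation is determined by its residue class.

  If the residue field of \<open>\<O>\<close> is finite, some \<open>\<phi>\<^sup>m\<close> is the identity on \<open>\<O>\<close>, so by uniqueness it fixes \<open>u\<close>.
  For \<open>\<Delta> = 0\<close> the \<open>p\<close>-th powers of the finitely many entries of \<open>u, \<phi>(u), \<dots>, \<phi>\<^sup>m\<^sup>-\<^sup>1(u)\<close> are linear
  combinations of these entries, hence these generate a finite \<open>\<phi>\<close>-stable field extension. Type \<open>SL\<^sub>n\<close>
  reduces to this case by rescaling.
\<close>

section \<open>Matrices over subrings\<close>

text \<open>Bijectivity of \<phi> alone does not give a contraction: congruences must also be
  cancelled through it. This works because the lift, once extended from \<open>R\<close> to the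
  whole field, preserves exact divisibility by \<open>p\<close>. Nothing is gained from precision 0,
  so these inductions start at residue classes.

  In the last claim the obstacle is type \<open>SL\<close>: the scalar \<lambda>(u) is only known to
  lie in \<open>R\<close>, so the equation for \<open>u\<close> is not one over \<O>. The rescaling
  absorbs it into a factor \<mu>; because \<open>det u = 1\<close>, this factor is an n-th root of a
  determinant and stays algebraic. The extensions are built as algebras on finitely many generators.
  Finite linear span turns them into fields, and their intersections with \<open>R\<close> are
  stable under \<delta> because \<open>p\<close> is invertible in these fields.\<close>

lemma permutes_less: "q permutes {0..<n} \<Longrightarrow> i < n \<Longrightarrow> q i < (n::nat)"
  using permutes_in_image[of q "{0..<n}" i] by auto

text \<open>The closure conditions are spelled out because \<open>subring_of\<close> lives over a
  field type, while the lemma is also applied to polynomial matrices, to see that a characteristic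
  polynomial has its coefficients in a subfield.\<close>

lemma det_closed:
  fixes A :: "'a::comm_ring_1 mat"
  assumes A: "A \<in> carrier_mat n n" and ent: "\<And>i j. i < n \<Longrightarrow> j < n \<Longrightarrow> A $$ (i, j) \<in> S"
    and S: "0 \<in> S" "1 \<in> S" "\<And>a b. a \<in> S \<Longrightarrow> b \<in> S \<Longrightarrow> a + b \<in> S"
      "\<And>a b. a \<in> S \<Longrightarrow> b \<in> S \<Longrightarrow> a * b \<in> S" "\<And>a. a \<in> S \<Longrightarrow> - a \<in> S"
  shows "det A \<in> S"
proof -
  have prod: "(\<And>x. x \<in> X \<Longrightarrow> f x \<in> S) \<Longrightarrow> (\<Prod>x\<in>X. f x) \<in> S" for f and X :: "nat set"
    by (induction X rule: infinite_finite_induct) (use S in auto)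
  have sum: "(\<And>x. x \<in> X \<Longrightarrow> f x \<in> S) \<Longrightarrow> (\<Sum>x\<in>X. f x) \<in> S" for f and X :: "(nat \<Rightarrow> nat) set"
    by (induction X rule: infinite_finite_induct) (use S in auto)
  have sg: "signof q * x \<in> S" if "x \<in> S" for q x
    using that S(5) by (auto simp: sign_def)
  show ?thesis
    unfolding det_def'[OF A]
    by (intro sum sg prod ent) (auto simp: permutes_less)
qed

lemma subring_ofD:
  assumes "subring_of S"
  shows "0 \<in> S" "1 \<in> S" "\<And>a b. a \<in> S \<Longrightarrow> b \<in> S \<Longrightarrow> a + b \<in> S"
    "\<And>a b. a \<in> S \<Longrightarrow> b \<in> S \<Longrightarrow> a * b \<in> S" "\<And>a. a \<in> S \<Longrightarrow> - a \<in> S"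
    "\<And>a b. a \<in> S \<Longrightarrow> b \<in> S \<Longrightarrow> a - b \<in> S"
proof -
  show *: "0 \<in> S" "1 \<in> S" "\<And>a b. a \<in> S \<Longrightarrow> b \<in> S \<Longrightarrow> a + b \<in> S"
    "\<And>a b. a \<in> S \<Longrightarrow> b \<in> S \<Longrightarrow> a * b \<in> S" "\<And>a. a \<in> S \<Longrightarrow> - a \<in> S"
    using assms by (auto simp: subring_of_def)
  show "a - b \<in> S" if "a \<in> S" "b \<in> S" for a b
    using *(3)[OF that(1) *(5)[OF that(2)]] by simp
qed

lemma subring_of_sum:
  "subring_of S \<Longrightarrow> (\<And>x. x \<in> X \<Longrightarrow> f x \<in> S) \<Longrightarrow> (\<Sum>x\<in>X. f x) \<in> S"
  by (induction X rule: infinite_finite_induct) (auto dest: subring_ofD)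

lemma subring_of_prod:
  "subring_of S \<Longrightarrow> (\<And>x. x \<in> X \<Longrightarrow> f x \<in> S) \<Longrightarrow> (\<Prod>x\<in>X. f x) \<in> S"
  by (induction X rule: infinite_finite_induct) (auto dest: subring_ofD)

lemma subring_of_power: "subring_of S \<Longrightarrow> x \<in> S \<Longrightarrow> x ^ m \<in> S"
  by (induction m) (auto dest: subring_ofD)

lemma subring_of_of_nat: "subring_of S \<Longrightarrow> of_nat m \<in> S"
  by (induction m) (auto dest: subring_ofD)

lemma mat_inD:
  assumes "A \<in> mat_in n S"
  shows "A \<in> carrier_mat n n" "dim_row A = n" "dim_col A = n"
    "\<And>i j. i < n \<Longrightarrow> j < n \<Longrightarrow> A $$ (i, j) \<in> S"
  using assms by (auto simp: mat_in_def)

lemma mat_inI: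
  "A \<in> carrier_mat n n \<Longrightarrow> (\<And>i j. i < n \<Longrightarrow> j < n \<Longrightarrow> A $$ (i, j) \<in> S) \<Longrightarrow> A \<in> mat_in n S"
  by (auto simp: mat_in_def)

lemma mat_in_mono: "S \<subseteq> T \<Longrightarrow> A \<in> mat_in n S \<Longrightarrow> A \<in> mat_in n T"
  by (auto simp: mat_in_def)

lemma index_mult_mat_sum:
  "A \<in> carrier_mat n n \<Longrightarrow> B \<in> carrier_mat n n \<Longrightarrow> i < n \<Longrightarrow> j < n \<Longrightarrow>
    (A * B) $$ (i, j) = (\<Sum>l<n. A $$ (i, l) * B $$ (l, j))"
  by (auto simp: scalar_prod_def atLeast0LessThan)

lemma mat_in_det: "subring_of S \<Longrightarrow> A \<in> mat_in n S \<Longrightarrow> det A \<in> S"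
  by (rule det_closed[of A n]) (auto simp: mat_inD dest: subring_ofD)

lemma mat_in_mult: "subring_of S \<Longrightarrow> A \<in> mat_in n S \<Longrightarrow> B \<in> mat_in n S \<Longrightarrow> A * B \<in> mat_in n S"
  by (rule mat_inI) (auto simp: index_mult_mat_sum[OF mat_inD(1) mat_inD(1)] mat_inD
      simp del: index_mult_mat(1) intro!: subring_of_sum subring_ofD(4))

lemma mat_in_add: "subring_of S \<Longrightarrow> A \<in> mat_in n S \<Longrightarrow> B \<in> mat_in n S \<Longrightarrow> A + B \<in> mat_in n S"
  by (auto simp: mat_in_def intro!: subring_ofD(3))

lemma mat_in_smult: "subring_of S \<Longrightarrow> c \<in> S \<Longrightarrow> A \<in> mat_in n S \<Longrightarrow> c \<cdot>\<^sub>m A \<in> mat_in n S"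
  by (auto simp: mat_in_def intro!: subring_ofD(4))

lemma mat_in_one: "subring_of S \<Longrightarrow> 1\<^sub>m n \<in> mat_in n S"
  by (auto simp: mat_in_def one_mat_def subring_ofD(1,2))

lemma mat_in_transpose: "A \<in> mat_in n S \<Longrightarrow> transpose_mat A \<in> mat_in n S"
  by (auto simp: mat_in_def)

lemma mat_in_frobp: "subring_of S \<Longrightarrow> A \<in> mat_in n S \<Longrightarrow> frobp p A \<in> mat_in n S"
  by (auto simp: mat_in_def frobp_def subring_of_power)

lemma mat_in_pow: "subring_of S \<Longrightarrow> A \<in> mat_in n S \<Longrightarrow> A ^\<^sub>m k \<in> mat_in n S"
  by (induction k) (auto simp: mat_in_mult mat_in_one mat_inD)

lemma mat_in_adj: 
  assumes "subring_of S" "A \<in> mat_in n S"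
  shows "adj_mat A \<in> mat_in n S"
proof (rule mat_inI)
  show "adj_mat A \<in> carrier_mat n n" using adj_mat(1) assms mat_inD by blast
  fix i j assume ij: "i < n" "j < n"
  have "det (mat_delete A j i) \<in> S"
    by (rule mat_in_det[OF assms(1), of _ "n - 1"], rule mat_inI)
      (use ij in \<open>auto simp: mat_delete_def mat_inD(2,3)[OF assms(2)] intro!: mat_inD(4)[OF assms(2)]\<close>)
  then show "adj_mat A $$ (i, j) \<in> S"
    using ij assms(1) by (auto simp: adj_mat_def mat_inD[OF assms(2)] cofactor_def
        intro!: subring_ofD(4)[OF assms(1)] subring_of_power subring_ofD(2,5)[OF assms(1)])
qed

lemma mat_in_inv: 
  "subring_of S \<Longrightarrow> A \<in> mat_in n S \<Longrightarrow> inverse (det A) \<in> S \<Longrightarrow> inv_m A \<in> mat_in n S"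
  unfolding inv_m_def by (intro mat_in_smult mat_in_adj)

lemma inv_m_mult:
  fixes A :: "'a::field mat"
  assumes A: "A \<in> carrier_mat n n" and d: "det A \<noteq> 0"
  shows "inv_m A * A = 1\<^sub>m n" "A * inv_m A = 1\<^sub>m n" "inv_m A \<in> carrier_mat n n"
  using adj_mat[OF A] d A
  by (auto simp: inv_m_def mult_smult_assoc_mat[of _ n n _ n] mult_smult_distrib[of _ n n _ n])

section \<open>Congruences modulo powers of p\<close>

locale witt_ring =
  fixes R :: "'k::field_char_0 set" and p :: nat
  assumes prime_p: "prime p" and witt: "witt_ring_alg_closure R p"
begin

abbreviation "P k \<equiv> pideal R p k"
abbreviation "\<pi> \<equiv> (of_nat p :: 'k)"

lemma subring_R: "subring_of R"
  and inv_p_notin: "inverse \<pi> \<notin> R"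
  and R_complete: "padic_complete R p R"
  using witt by (auto simp: witt_ring_alg_closure_def)

lemmas R_0 = subring_ofD(1)[OF subring_R]
  and R_1 = subring_ofD(2)[OF subring_R]
  and R_add = subring_ofD(3)[OF subring_R]
  and R_mult = subring_ofD(4)[OF subring_R]
  and R_uminus = subring_ofD(5)[OF subring_R]
  and R_minus = subring_ofD(6)[OF subring_R]
  and R_sum = subring_of_sum[OF subring_R]
  and R_power = subring_of_power[OF subring_R]
  and R_of_nat = subring_of_of_nat[OF subring_R]

lemmas R_intros = R_0 R_1 R_add R_mult R_uminus R_minus R_sum R_power R_of_nat

lemma p_pos [simp]: "p \<noteq> 0" "p > 0"
  using prime_p by (auto simp: prime_gt_0_nat)

text \<open>Divisibility becomes integrality of a quotient, so the ring laws of \<open>R\<close>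
  carry over to its ideals without handling witnesses.\<close>

lemma P_iff: "a \<in> P k \<longleftrightarrow> a / \<pi> ^ k \<in> R"
proof
  assume "a / \<pi> ^ k \<in> R"
  then have "\<exists>r. a = \<pi> ^ k * r \<and> r \<in> R" by (intro exI[of _ "a / \<pi> ^ k"]) auto
  then show "a \<in> P k" by (auto simp: pideal_def)
qed (auto simp: pideal_def)

lemma P_I: "r \<in> R \<Longrightarrow> \<pi> ^ k * r \<in> P k"
  by (auto simp: pideal_def)

lemma P_0: "P 0 = R"
  by (auto simp: pideal_def)

lemma P_zero: "0 \<in> P k"
  and P_add: "a \<in> P k \<Longrightarrow> b \<in> P k \<Longrightarrow> a + b \<in> P k"
  and P_uminus: "a \<in> P k \<Longrightarrow> - a \<in> P k"
  and P_minus: "a \<in> P k \<Longrightarrow> b \<in> P k \<Longrightarrow> a - b \<in> P k"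
  and P_multR: "a \<in> P k \<Longrightarrow> r \<in> R \<Longrightarrow> a * r \<in> P k"
  and P_multR': "a \<in> P k \<Longrightarrow> r \<in> R \<Longrightarrow> r * a \<in> P k"
  using R_intros(4)[of "a / \<pi> ^ k" r] 
  by (auto simp: P_iff add_divide_distrib diff_divide_distrib R_intros mult.commute)

lemma P_sum: "(\<And>x. x \<in> X \<Longrightarrow> f x \<in> P k) \<Longrightarrow> (\<Sum>x\<in>X. f x) \<in> P k"
  by (induction X rule: infinite_finite_induct) (auto simp: P_zero P_add)

lemma P_mult: "a \<in> P j \<Longrightarrow> b \<in> P k \<Longrightarrow> a * b \<in> P (j + k)"
  using R_mult[of "a / \<pi> ^ j" "b / \<pi> ^ k"] by (simp add: P_iff power_add)

lemma P_mono: 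
  assumes "j \<le> k" "a \<in> P k" shows "a \<in> P j"
proof -
  have "a / \<pi> ^ j = a / \<pi> ^ k * \<pi> ^ (k - j)"
    using assms(1) by (simp add: field_simps flip: power_add)
  then show ?thesis using assms R_mult[of "a / \<pi> ^ k" "\<pi> ^ (k - j)"] R_intros(8,9) by (simp add: P_iff)
qed

lemma P_R: "a \<in> P k \<Longrightarrow> a \<in> R"
  using P_mono[of 0 k a] P_0 by auto

lemma P_sym: "a - b \<in> P k \<Longrightarrow> b - a \<in> P k"
  using P_uminus[of "a - b"] by simp

lemma P_trans: "a - b \<in> P k \<Longrightarrow> b - c \<in> P k \<Longrightarrow> a - c \<in> P k"
  using P_add[of "a - b" k "b - c"] by simp

lemma P_cong_R: "a - b \<in> P k \<Longrightarrow> b \<in> R \<Longrightarrow> a \<in> R"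
  using R_add[of "a - b" b] P_R by fastforce

lemma P_cong_mult:
  assumes "a - b \<in> P k" "c - d \<in> P k" "b \<in> R" "c \<in> R" shows "a * c - b * d \<in> P k"
proof -
  have "a * c - b * d = (a - b) * c + b * (c - d)" by (simp add: algebra_simps)
  then show ?thesis using assms P_add P_multR P_multR' by metis
qed

lemma P_cong_add: "a - b \<in> P k \<Longrightarrow> c - d \<in> P k \<Longrightarrow> a + c - (b + d) \<in> P k"
  using P_add[of "a - b" k "c - d"] by (simp add: algebra_simps)

lemma P_cong_power: "a - b \<in> P k \<Longrightarrow> a \<in> R \<Longrightarrow> b \<in> R \<Longrightarrow> a ^ m - b ^ m \<in> P k"
  by (induction m) (auto simp: P_zero intro!: P_cong_mult R_intros)

lemma P_cong_prod:
  "(\<And>x. x \<in> X \<Longrightarrow> f x - g x \<in> P k) \<Longrightarrow> (\<And>x. x \<in> X \<Longrightarrow> f x \<in> R) \<Longrightarrow> (\<And>x. x \<in> X \<Longrightarrow> g x \<in> R) \<Longrightarrow>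
    (\<Prod>x\<in>X. f x) - (\<Prod>x\<in>X. g x) \<in> P k"
  by (induction X rule: infinite_finite_induct)
    (auto simp: P_zero intro!: P_cong_mult subring_of_prod subring_R)

lemma P_pi: "\<pi> \<in> P 1"
  using P_I[of 1 1] R_1 by simp

text \<open>The cofactor of \<open>a - b\<close> in \<open>a ^ p - b ^ p\<close> is a sum of
  \<open>p\<close> terms, all congruent to \<open>b ^ (p - 1)\<close>, hence itself divisible by
  \<open>p\<close>. The contraction rests on this extra power.\<close>

lemma P_cong_power_p:
  assumes ab: "a - b \<in> P k" "a \<in> R" "b \<in> R" and k: "k \<ge> 1"
  shows "a ^ p - b ^ p \<in> P (Suc k)"
proof -
  have "b ^ (p - Suc i) * a ^ i - b ^ (p - 1) \<in> P 1" if "i < p" for i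
  proof -
    have "a ^ i - b ^ i \<in> P 1" using ab k P_mono P_cong_power by blast
    then have "b ^ (p - Suc i) * (a ^ i - b ^ i) \<in> P 1" using ab R_power P_multR' by blast
    moreover have "b ^ (p - 1) = b ^ (p - Suc i) * b ^ i" 
      using that by (simp flip: power_add)
    ultimately show ?thesis by (simp add: algebra_simps)
  qed
  then have "(\<Sum>i<p. b ^ (p - Suc i) * a ^ i - b ^ (p - 1)) \<in> P 1" by (intro P_sum) auto
  then have "(\<Sum>i<p. b ^ (p - Suc i) * a ^ i) - \<pi> * b ^ (p - 1) \<in> P 1"
    by (simp add: sum_subtractf)
  then have "(\<Sum>i<p. b ^ (p - Suc i) * a ^ i) \<in> P 1"
    using P_add[of _ 1 "\<pi> * b ^ (p - 1)"] P_multR[OF P_pi] ab R_power by fastforce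
  then show ?thesis
    unfolding power_diff_sumr2 using P_mult[OF ab(1)] by fastforce
qed

lemma P_cong_power_pp:
  "a - b \<in> P k \<Longrightarrow> a \<in> R \<Longrightarrow> b \<in> R \<Longrightarrow> k \<ge> 1 \<Longrightarrow> a ^ (p ^ j) - b ^ (p ^ j) \<in> P (k + j)"
proof (induction j)
  case (Suc j)
  then show ?case
    using P_cong_power_p[of "a ^ (p ^ j)" "b ^ (p ^ j)" "k + j"] R_power
    by (simp add: power_mult mult.commute[of p])
qed simp

lemma dvr_repr: obtains m :: int and v where "v \<in> R" "inverse v \<in> R" "x = \<pi> powi m * v" "v \<noteq> 0" | "x = 0"
proof (cases "x = 0")
  case False
  then obtain m :: int and v where "v \<in> R" "inverse v \<in> R" "x = \<pi> powi m * v" 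
    using witt unfolding witt_ring_alg_closure_def by metis
  then show ?thesis using that False by fastforce
qed

lemma ex_pi_power_mult: "\<exists>k. \<pi> ^ k * x \<in> R"
proof (cases x rule: dvr_repr)
  case (1 m v)
  have "\<pi> ^ nat (- m) * x = \<pi> ^ nat m * v"
    using 1 by (auto simp: power_int_def field_simps)
  then show ?thesis using 1 R_intros by metis
qed (use R_0 in auto)

text \<open>\<open>R\<close> is local: in the normal form of \<open>a\<close> a positive exponent
  would put \<open>a\<close> into \<open>P 1\<close>, and a negative one would make
  \<open>inverse \<pi>\<close> integral.\<close>

lemma unit_of_not_P:
  assumes a: "a \<in> R" "a \<notin> P 1" shows "a \<noteq> 0 \<and> inverse a \<in> R"
proof (cases a rule: dvr_repr)
  case (1 m v)
  consider "m = 0" | "m > 0" | "m < 0" by linarith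
  then show ?thesis
  proof cases
    case 2
    then have "a = \<pi> ^ nat m * v" using 1 by (simp add: power_int_def)
    then have "a \<in> P (nat m)" using 1 P_I by auto
    then have "a \<in> P 1" using 2 P_mono[of 1 "nat m" a] by linarith
    then show ?thesis using a by blast
  next
    case 3
    then have "\<pi> * \<pi> ^ (nat (- m) - 1) = \<pi> ^ nat (- m)"
      by (simp flip: power_Suc)
    then have "inverse \<pi> = a * inverse v * \<pi> ^ (nat (- m) - 1)"
      using 1 3 by (simp add: power_int_def field_simps)
    then show ?thesis using a 1 R_intros inv_p_notin by metis
  qed (use 1 in auto)
qed (use P_zero a in auto)

lemma unit_not_P:
  assumes "a \<noteq> 0" "inverse a \<in> R" shows "a \<notin> P 1"
proof
  assume "a \<in> P 1"
  then have "a / \<pi> \<in> R" by (simp add: P_iff)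
  then have "a / \<pi> * inverse a \<in> R" using assms(2) by (rule R_mult)
  moreover have "a / \<pi> * inverse a = inverse \<pi>" using assms by (simp add: field_simps)
  ultimately show False using inv_p_notin by simp
qed

lemma unit_cong:
  assumes "a \<noteq> 0" "inverse a \<in> R" "b - a \<in> P 1" "a \<in> R"
  shows "b \<noteq> 0" "inverse b \<in> R" "b \<in> R"
proof -
  show b: "b \<in> R" using assms P_cong_R by blast
  have "b \<notin> P 1" using unit_not_P[OF assms(1,2)] P_minus[of b 1 "b - a"] assms(3) by auto
  then show "b \<noteq> 0" "inverse b \<in> R" using unit_of_not_P b by auto
qed

lemma inverse_cong:
  assumes "a \<noteq> 0" "inverse a \<in> R" "b \<noteq> 0" "inverse b \<in> R" "a - b \<in> P k"
  shows "inverse a - inverse b \<in> P k"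
proof -
  have "inverse a - inverse b = inverse a * (b - a) * inverse b"
    using assms by (simp add: field_simps)
  then show ?thesis using assms P_multR P_multR' P_sym by metis
qed

text \<open>Divisibility by one power more than the exponent in the normal form of \<open>a\<close>
  would already make \<open>inverse \<pi>\<close> integral.\<close>

lemma P_all_zero:
  assumes "\<And>k. a \<in> P k" shows "a = 0"
proof (cases a rule: dvr_repr)
  case (1 m v)
  obtain r where r: "r \<in> R" "a = \<pi> ^ Suc (nat m) * r"
    using assms[of "Suc (nat m)"] by (auto simp: pideal_def)
  have "inverse \<pi> = r * inverse v * \<pi> ^ nat (- m)"
  proof -
    have "\<pi> ^ nat m * (\<pi> * r * \<pi> ^ nat (- m)) = a * \<pi> ^ nat (- m)" using r(2) by simp
    also have "\<dots> = \<pi> ^ nat m * v" using 1(3) by (cases "m \<ge> 0") (auto simp: power_int_def field_simps)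
    finally have "\<pi> * r * \<pi> ^ nat (- m) = v" by simp
    then show ?thesis using 1(4) by (auto simp: field_simps)
  qed
  then show ?thesis using 1 r R_intros inv_p_notin by metis
qed

lemma P_all_eq: "(\<And>k. a - b \<in> P k) \<Longrightarrow> a = b"
  using P_all_zero[of "a - b"] by simp

text \<open>Inductions on the precision start at 1, since p-th powers gain nothing from a congruence
  modulo \<open>P 0\<close>.\<close>

lemma P_all_Suc_eq: "(\<And>k. a - b \<in> P (Suc k)) \<Longrightarrow> a = b"
  by (rule P_all_eq, rule P_mono[OF le_SucI[OF order_refl]])

text \<open>Each \<open>P m\<close> is closed under limits, so the rate of the sequence is inherited
  by the limit. Later constructions work with this explicit error instead of bare
  convergence.\<close>

lemma complete_limit:
  assumes comp: "padic_complete R p V" and s: "\<And>m. s m \<in> V" "\<And>m. s (Suc m) - s m \<in> P m"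
  obtains L where "L \<in> V" "\<And>m. L - s m \<in> P m"
proof -
  have d: "s (m + j) - s m \<in> P m" for m j
  proof (induction j)
    case (Suc j)
    then show ?case using P_trans[OF P_mono[OF _ s(2)[of "m + j"]], of m "s m"] by simp
  qed (simp add: P_zero)
  have d': "s m' - s m \<in> P m" if "m \<le> m'" for m m'
    using d[of m "m' - m"] that by simp
  have "padic_cauchy R p s"
    unfolding padic_cauchy_def using d' P_trans P_sym by metis
  then obtain L where L: "L \<in> V" "padic_lim R p s L" using comp s(1) by (auto simp: padic_complete_def)
  have "L - s m \<in> P m" for m
  proof -
    obtain N where "\<forall>i\<ge>N. s i - L \<in> P m" using L(2) by (auto simp: padic_lim_def)
    then have "L - s (max N m) \<in> P m" using P_sym by auto
    then show ?thesis using P_trans d'[of m "max N m"] by auto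
  qed
  then show ?thesis using that L by blast
qed

lemma padic_limI: "(\<And>m. L - s m \<in> P m) \<Longrightarrow> padic_lim R p s L"
  unfolding padic_lim_def by (metis P_sym P_mono)

lemma padic_lim_unique: "padic_lim R p s L \<Longrightarrow> padic_lim R p s L' \<Longrightarrow> L = L'"
proof (rule P_all_eq)
  fix k assume "padic_lim R p s L" "padic_lim R p s L'"
  then obtain N N' where "\<forall>i\<ge>N. s i - L \<in> P k" "\<forall>i\<ge>N'. s i - L' \<in> P k"
    unfolding padic_lim_def by metis
  then have "s (max N N') - L \<in> P k" "s (max N N') - L' \<in> P k" by auto
  then show "L - L' \<in> P k" using P_trans P_sym by blast
qed

section \<open>Entrywise congruence of integral matrices\<close>

definition mcong :: "nat \<Rightarrow> nat \<Rightarrow> 'k mat \<Rightarrow> 'k mat \<Rightarrow> bool" where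
  "mcong n k A B \<longleftrightarrow> A \<in> mat_in n R \<and> B \<in> mat_in n R \<and>
     (\<forall>i<n. \<forall>j<n. A $$ (i, j) - B $$ (i, j) \<in> P k)"

lemma mcongD: "mcong n k A B \<Longrightarrow> A \<in> mat_in n R" "mcong n k A B \<Longrightarrow> B \<in> mat_in n R"
  "mcong n k A B \<Longrightarrow> i < n \<Longrightarrow> j < n \<Longrightarrow> A $$ (i, j) - B $$ (i, j) \<in> P k"
  by (auto simp: mcong_def)

lemma mcong_refl: "A \<in> mat_in n R \<Longrightarrow> mcong n k A A"
  by (auto simp: mcong_def P_zero)

lemma mcong_sym: "mcong n k A B \<Longrightarrow> mcong n k B A"
  by (auto simp: mcong_def P_sym)

lemma mcong_trans: "mcong n k A B \<Longrightarrow> mcong n k B C \<Longrightarrow> mcong n k A C"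
  unfolding mcong_def using P_trans by blast

lemma mcong_mono: "j \<le> k \<Longrightarrow> mcong n k A B \<Longrightarrow> mcong n j A B"
  by (auto simp: mcong_def intro: P_mono)

lemma mcong_mult: "mcong n k A B \<Longrightarrow> mcong n k C D \<Longrightarrow> mcong n k (A * C) (B * D)"
  unfolding mcong_def
  by (auto simp: mat_in_mult subring_R index_mult_mat_sum[OF mat_inD(1) mat_inD(1)] mat_inD
     simp del: index_mult_mat(1) simp flip: sum_subtractf intro!: P_sum P_cong_mult)

lemma mcong_add: "mcong n k A B \<Longrightarrow> mcong n k C D \<Longrightarrow> mcong n k (A + C) (B + D)"
  by (auto simp: mcong_def mat_in_add subring_R mat_inD intro!: P_cong_add)

lemma mcong_transpose: "mcong n k A B \<Longrightarrow> mcong n k (transpose_mat A) (transpose_mat B)"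
  by (auto simp: mcong_def mat_in_transpose mat_inD)

lemma mcong_frobp: "mcong n k A B \<Longrightarrow> k \<ge> 1 \<Longrightarrow> mcong n (Suc k) (frobp p A) (frobp p B)"
  by (auto simp: mcong_def mat_in_frobp subring_R mat_inD intro!: P_cong_power_p)
     (auto simp: frobp_def mat_inD intro!: P_cong_power_p)

lemma mcong_smult_pi: "mcong n k A B \<Longrightarrow> mcong n (Suc k) (\<pi> \<cdot>\<^sub>m A) (\<pi> \<cdot>\<^sub>m B)"
  using P_mult[OF P_pi] 
  by (force simp: mcong_def mat_in_smult subring_R mat_inD R_of_nat simp flip: right_diff_distrib)

lemma signof_R: "signof q \<in> R"
  by (auto simp: sign_def intro: R_intros)

lemma mcong_det:
  assumes "mcong n k A B" shows "det A - det B \<in> P k"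
  unfolding det_def'[OF mat_inD(1)[OF mcongD(1)[OF assms]]] det_def'[OF mat_inD(1)[OF mcongD(2)[OF assms]]]
    sum_subtractf[symmetric] right_diff_distrib[symmetric]
  by (intro P_sum P_multR' P_cong_prod signof_R)
    (auto intro!: mcongD(3)[OF assms] mat_inD(4)[OF mcongD(1)[OF assms]] mat_inD(4)[OF mcongD(2)[OF assms]]
      simp: permutes_less)

lemma mcong_all_eq:
  assumes "\<And>k. mcong n (Suc k) A B" shows "A = B"
proof (rule eq_matI)
  show "A $$ (i, j) = B $$ (i, j)" if "i < dim_row B" "j < dim_col B" for i j
    by (rule P_all_Suc_eq, rule mcongD(3)[OF assms]) (use that mat_inD[OF mcongD(2)[OF assms]] in auto)
qed (use mat_inD[OF mcongD(2)[OF assms]] mat_inD[OF mcongD(1)[OF assms]] in auto)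

lemma GLmD: "A \<in> GLm n S \<Longrightarrow> A \<in> mat_in n S" "A \<in> GLm n S \<Longrightarrow> det A \<noteq> 0"
  "A \<in> GLm n S \<Longrightarrow> inverse (det A) \<in> S"
  by (auto simp: GLm_def)

lemma GLm_cong: "A \<in> GLm n R \<Longrightarrow> mcong n 1 B A \<Longrightarrow> B \<in> GLm n R"
  using unit_cong[of "det A" "det B"] mcong_det[of n 1 B A] mat_in_det[OF subring_R, of A n]
  by (auto simp: GLm_def mcong_def)

section \<open>Values and continuity of elements of the completed coordinate ring\<close>

lemma polyfun_in: "F \<in> polyfun n V \<Longrightarrow> subring_of V \<Longrightarrow> x \<in> mat_in n V \<Longrightarrow> F x \<in> V"
  by (induction F rule: polyfun.induct) (auto simp: mat_inD intro: subring_ofD)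

lemma polyfun_mono: "F \<in> polyfun n V \<Longrightarrow> V \<subseteq> W \<Longrightarrow> F \<in> polyfun n W"
  by (induction F rule: polyfun.induct) (auto intro: polyfun.intros)

lemma polyfun_cong: "F \<in> polyfun n R \<Longrightarrow> mcong n k x y \<Longrightarrow> F x - F y \<in> P k"
proof (induction F rule: polyfun.induct)
  case (pf_mult f g)
  then show ?case using polyfun_in subring_R mcongD by (intro P_cong_mult) blast+
qed (auto simp: P_zero mcong_def intro!: P_cong_add)

text \<open>The approximating fractions take values in \<open>V\<close> at \<open>x\<close>;
  completeness keeps their limit there.\<close>

lemma Acompl_in:
  assumes f: "f \<in> Acompl R p n V" and V: "V \<subseteq> R" "subring_of V" "padic_complete R p V"
    and x: "x \<in> GLm n R" "x \<in> GLm n V"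
  shows "f x \<in> V"
proof -
  have "\<exists>y\<in>V. f x - y \<in> P k" for k
  proof -
    obtain F m where F: "F \<in> polyfun n V" "f x - F x / det x ^ m \<in> P k"
      using f x(1) unfolding Acompl_def by blast
    have "F x * inverse (det x) ^ m \<in> V"
      using V polyfun_in[OF F(1)] x(2) by (auto simp: GLm_def intro!: subring_ofD subring_of_power)
    then show ?thesis using F(2) by (auto simp: field_simps)
  qed
  then obtain y where y: "\<And>k. y k \<in> V" "\<And>k. f x - y k \<in> P k" by metis
  have "y (Suc k) - y k \<in> P k" for k
    using P_trans[OF P_sym[OF P_mono[OF _ y(2)]] y(2), of k "Suc k"] by auto
  then obtain L where "L \<in> V" "\<And>m. L - y m \<in> P m" using complete_limit[of V y, OF V(3) y(1)] by blast
  then show ?thesis using P_all_eq[of "f x" L] y(2) P_sym P_trans by metis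
qed

text \<open>Approximation in \<open>Acompl\<close> is uniform, so one fraction serves both points
  and the congruence is inherited from polynomials and powers of the determinant.\<close>

lemma Acompl_cong:
  assumes f: "f \<in> Acompl R p n R" and x: "x \<in> GLm n R" and y: "y \<in> GLm n R" and xy: "mcong n k x y"
  shows "f x - f y \<in> P k"
proof -
  obtain F m where F: "F \<in> polyfun n R" "f x - F x / det x ^ m \<in> P k" "f y - F y / det y ^ m \<in> P k"
    using f x y unfolding Acompl_def by blast
  have "F x * inverse (det x) ^ m - F y * inverse (det y) ^ m \<in> P k"
    using polyfun_cong[OF F(1) xy] polyfun_in[OF F(1) subring_R GLmD(1)] x y
    by (intro P_cong_mult P_cong_power inverse_cong mcong_det[OF xy] R_power) (auto simp: GLmD)
  then have "F x / det x ^ m - F y / det y ^ m \<in> P k" by (simp add: divide_inverse power_inverse)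
  from P_trans[OF P_trans[OF F(2) this] P_sym[OF F(3)]] show ?thesis .
qed

lemma Acompl_mono: "V \<subseteq> W \<Longrightarrow> f \<in> Acompl R p n V \<Longrightarrow> f \<in> Acompl R p n W"
  unfolding Acompl_def using polyfun_mono by blast

text \<open>The last two properties distinguish \<open>V\<close> from an arbitrary subring:
  inversion and division by \<open>p\<close> stay in \<open>V\<close> as soon as they stay in
  \<open>R\<close>. They allow expansions in powers of \<open>p\<close> inside
  \<open>V\<close>.\<close>

lemma valuation_subringD:
  assumes "valuation_subring R V"
  shows "V \<subseteq> R" "subring_of V" "\<And>a. a \<in> V \<Longrightarrow> inverse a \<in> R \<Longrightarrow> inverse a \<in> V"
    "\<And>a. a \<in> V \<Longrightarrow> a / \<pi> \<in> R \<Longrightarrow> a / \<pi> \<in> V"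
proof -
  obtain F where F: "subfield_of F" "V = R \<inter> F" using assms by (auto simp: valuation_subring_def)
  then have sF: "subring_of F" "\<And>a. a \<in> F \<Longrightarrow> inverse a \<in> F"
    by (auto simp: subfield_of_def)
  show "V \<subseteq> R" using F by auto
  show "subring_of V" using sF(1) subring_R F(2) by (auto simp: subring_of_def)
  show "inverse a \<in> V" if "a \<in> V" "inverse a \<in> R" for a using that sF F by auto
  have "\<pi> \<in> F" using subring_of_of_nat sF by blast
  then show "a / \<pi> \<in> V" if "a \<in> V" "a / \<pi> \<in> R" for a
    using that sF F subring_ofD(4)[OF sF(1), of a "inverse \<pi>"] by (auto simp: field_simps)
qed

lemma valuation_subring_self: "valuation_subring R R"
  unfolding valuation_subring_def by (intro exI[of _ UNIV]) (auto simp: subfield_of_def subring_of_def)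

lemma residue_periodic:
  assumes "a \<in> R" obtains m where "m \<ge> 1" "a ^ (p ^ m) - a \<in> P 1"
  using witt assms unfolding witt_ring_alg_closure_def by blast

end

section \<open>Binomial series\<close>

lemma pow_mat_add:
  "(A :: 'a::semiring_1 mat) \<in> carrier_mat n n \<Longrightarrow> A ^\<^sub>m (j + k) = A ^\<^sub>m j * A ^\<^sub>m k"
  by (induction k) (auto simp: assoc_mult_mat[of _ n n _ n _ n])

context witt_ring
begin

section \<open>Integrality of binomial coefficients with p-integral upper argument\<close>

lemma bezout_P:
  assumes "\<not> p dvd d"
  obtains u v where "of_int u * of_nat d + of_int v * \<pi> ^ N = (1 :: 'k)"
proof -
  have "coprime (int d) (int (p ^ N))"
    using assms prime_p by (metis coprime_commute coprime_int_iff coprime_power_left_iff prime_imp_coprime)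
  then obtain u v where "u * int d + v * int (p ^ N) = 1" using bezout_int[of "int d" "int (p ^ N)"] by auto
  then have "of_int (u * int d + v * int (p ^ N)) = (1 :: 'k)" by simp
  then show ?thesis using that[of u v] by simp
qed

lemma R_of_int: "of_int c \<in> R"
  by (cases c rule: int_cases) (auto intro!: R_intros simp del: of_nat_Suc)

lemma inverse_of_nat_R:
  assumes "\<not> p dvd d" shows "inverse (of_nat d) \<in> R"
proof -
  obtain u v where uv: "of_int u * of_nat d + of_int v * \<pi> ^ 1 = (1 :: 'k)" using bezout_P[OF assms] .
  have "(of_nat d :: 'k) \<notin> P 1"
  proof
    assume "of_nat d \<in> P 1"
    then have "(1 :: 'k) \<in> P 1"
      using uv P_add[OF P_multR' P_multR', OF _ R_of_int P_pi R_of_int, of "of_nat d" u v] by simp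
    then show False using unit_not_P[of 1] R_1 by simp
  qed
  then show ?thesis using unit_of_not_P R_of_nat by blast
qed

lemma ratio_approx:
  assumes "\<not> p dvd d" shows "\<exists>b. of_int c / of_nat d - of_nat b \<in> P N"
proof -
  obtain u v where uv: "of_int u * of_nat d + of_int v * \<pi> ^ N = (1 :: 'k)" using bezout_P[OF assms] .
  \<comment> \<open>Modulo \<open>p ^ N\<close> the integer \<open>u\<close> inverts
    \<open>d\<close>, so \<open>c * u\<close> approximates the quotient; the added multiple of
    \<open>p ^ N\<close> makes it nonnegative.\<close>
  define b where "b = nat (c * u + \<bar>c * u\<bar> * int p ^ N)"
  have 1: "1 \<le> int p ^ N" by (rule one_le_power) (use p_pos(2) in linarith)
  have "0 \<le> c * u + \<bar>c * u\<bar> * 1" by simp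
  also have "\<dots> \<le> c * u + \<bar>c * u\<bar> * int p ^ N"
    using p_pos(2) by (intro add_left_mono mult_left_mono) (use 1 in simp_all)
  finally have "int b = c * u + \<bar>c * u\<bar> * int p ^ N" by (simp add: b_def)
  then have "of_int (int b) = (of_int (c * u + \<bar>c * u\<bar> * int p ^ N) :: 'k)" by simp
  then have b: "of_nat b = of_int (c * u) + of_int \<bar>c * u\<bar> * \<pi> ^ N" by simp
  have "of_nat d \<noteq> (0 :: 'k)" using assms by (intro notI) auto
  then have "of_int c / of_nat d - of_nat b =
      \<pi> ^ N * (of_int (c * v) * inverse (of_nat d) - of_int \<bar>c * u\<bar>)"
    using uv unfolding b by (simp add: field_simps) (metis mult.assoc mult.commute distrib_left mult_1_right)
  also have "\<dots> \<in> P N" by (intro P_I R_minus R_mult R_of_int inverse_of_nat_R assms)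
  finally show ?thesis by blast
qed

text \<open>Density argument: at a natural number \<open>b\<close> close to the upper argument the
  value is an ordinary binomial coefficient. The precision \<open>N\<close> is chosen to absorb the
  denominator \<open>fact k\<close>.\<close>

lemma gbinomial_ratio_R:
  assumes d: "\<not> p dvd d" shows "((of_int c / of_nat d :: 'k) gchoose k) \<in> R"
proof -
  define a where "a = (of_int c / of_nat d :: 'k)"
  have aR: "a \<in> R" using R_mult[OF R_of_int inverse_of_nat_R[OF d]] by (simp add: a_def divide_inverse)
  obtain N where N: "\<pi> ^ N * inverse (fact k) \<in> R" using ex_pi_power_mult by blast
  obtain b where b: "a - of_nat b \<in> P N" using ratio_approx[OF d] unfolding a_def by blast
  have "(\<Prod>i=0..<k. a - of_nat i) - (\<Prod>i=0..<k. of_nat b - of_nat i) \<in> P N"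
    using b aR by (intro P_cong_prod) (auto intro: R_intros)
  then obtain r where r: "r \<in> R" "(\<Prod>i=0..<k. a - of_nat i) - (\<Prod>i=0..<k. of_nat b - of_nat i) = \<pi> ^ N * r"
    by (auto simp: pideal_def)
  have "(a gchoose k) - (of_nat b gchoose k) = \<pi> ^ N * inverse (fact k) * r"
    using r(2) unfolding gbinomial_prod_rev by (simp add: diff_divide_distrib[symmetric] field_simps)
  then have "(a gchoose k) = \<pi> ^ N * inverse (fact k) * r + of_nat (b choose k)"
    by (simp add: binomial_gbinomial field_simps)
  then show ?thesis using R_add[OF R_mult[OF N r(1)] R_of_nat] by (simp add: a_def)
qed

text \<open>The square and the triangle of indices differ only by pairs with
  \<open>m \<le> i + j\<close>, whose terms vanish to precision \<open>m\<close>.\<close>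

lemma Cauchy_product_mod:
  assumes F: "\<And>i j. F i j \<in> P (i + j)"
  shows "(\<Sum>i<m. \<Sum>j<m. F i j) - (\<Sum>k<m. \<Sum>i\<le>k. F i (k - i)) \<in> P m"
proof -
  let ?T = "{(i, j). i + j < m}" and ?S = "{..<m} \<times> {..<m}"
  have "(\<Sum>i<m. \<Sum>j<m. F i j) - (\<Sum>k<m. \<Sum>i\<le>k. F i (k - i)) = sum (\<lambda>(i, j). F i j) ?S - sum (\<lambda>(i, j). F i j) ?T"
    by (simp add: sum.cartesian_product sum.triangle_reindex)
  also have "\<dots> = sum (\<lambda>(i, j). F i j) (?S - ?T)"
    by (rule sum_diff[symmetric]) auto
  also have "\<dots> \<in> P m"
  proof (rule P_sum)
    fix x assume "x \<in> ?S - ?T"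
    then obtain i j where "x = (i, j)" "m \<le> i + j" by auto
    then show "(case x of (i, j) \<Rightarrow> F i j) \<in> P m" using P_mono F by auto
  qed
  finally show ?thesis .
qed

section \<open>Evaluation of integral power series at \<open>p\<close> times a matrix\<close>

abbreviation partial :: "'k fps \<Rightarrow> 'k mat \<Rightarrow> nat \<Rightarrow> nat \<Rightarrow> nat \<Rightarrow> 'k" where
  "partial f T i j m \<equiv> (\<Sum>k<m. fps_nth f k * \<pi> ^ k * (T ^\<^sub>m k) $$ (i, j))"

text \<open>\<open>L = f(pT)\<close>. The rate of convergence is built in, so that products need no separate estimate.\<close>
definition fps_value :: "nat \<Rightarrow> 'k fps \<Rightarrow> 'k mat \<Rightarrow> 'k mat \<Rightarrow> bool" where
  "fps_value n f T L \<longleftrightarrow> L \<in> mat_in n R \<and>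
     (\<forall>i<n. \<forall>j<n. \<forall>m. L $$ (i, j) - partial f T i j m \<in> P m)"

lemma fps_valueD:
  "fps_value n f T L \<Longrightarrow> L \<in> mat_in n R"
  "fps_value n f T L \<Longrightarrow> i < n \<Longrightarrow> j < n \<Longrightarrow> L $$ (i, j) - partial f T i j m \<in> P m"
  by (auto simp: fps_value_def)

lemma fps_power_R: "\<forall>k. fps_nth f k \<in> R \<Longrightarrow> \<forall>k. fps_nth (f ^ m) k \<in> R"
  by (induction m) (auto simp: fps_mult_nth intro!: R_intros)

context
  fixes n :: nat and T :: "'k mat"
  assumes T: "T \<in> mat_in n R"
begin

lemma pow_R: "i < n \<Longrightarrow> j < n \<Longrightarrow> (T ^\<^sub>m k) $$ (i, j) \<in> R"
  using mat_in_pow[OF subring_R T] by (rule mat_inD(4))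

lemma partial_R: "\<forall>k. fps_nth f k \<in> R \<Longrightarrow> i < n \<Longrightarrow> j < n \<Longrightarrow> partial f T i j m \<in> R"
  by (intro R_sum R_mult R_power R_of_nat pow_R) auto

lemma fps_value_ex:
  assumes f: "\<forall>k. fps_nth f k \<in> R" shows "\<exists>L. fps_value n f T L"
proof -
  have "\<exists>L. L \<in> R \<and> (\<forall>m. L - partial f T i j m \<in> P m)" if "i < n" "j < n" for i j
  proof -
    have "partial f T i j (Suc m) - partial f T i j m \<in> P m" for m
      using P_I[OF R_mult[OF f[rule_format, of m] pow_R[OF that, of m]], of m] by (simp add: mult_ac)
    then show ?thesis
      using complete_limit[of R "partial f T i j", OF R_complete partial_R[OF f that]] by blast
  qed
  then obtain L where L: "\<And>i j. i < n \<Longrightarrow> j < n \<Longrightarrow> L i j \<in> R \<and> (\<forall>m. L i j - partial f T i j m \<in> P m)"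
    by metis
  then have "fps_value n f T (mat n n (\<lambda>(i, j). L i j))" by (auto simp: fps_value_def mat_in_def)
  then show ?thesis by blast
qed

lemma fps_value_unique:
  assumes "fps_value n f T L" "fps_value n f T L'" shows "L = L'"
proof (rule mcong_all_eq[of n])
  show "mcong n (Suc k) L L'" for k
    unfolding mcong_def by (intro conjI allI impI fps_valueD(1)[OF assms(1)] fps_valueD(1)[OF assms(2)]
      P_trans[OF fps_valueD(2)[OF assms(1)] P_sym[OF fps_valueD(2)[OF assms(2)]]])
qed

text \<open>Through this lemma identities between formal power series become identities between
  matrices, so the roots need no further analytic argument.\<close>

lemma fps_value_mult:
  assumes f: "\<forall>k. fps_nth f k \<in> R" "fps_value n f T L" and g: "\<forall>k. fps_nth g k \<in> R" "fps_value n g T M"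
  shows "fps_value n (f * g) T (L * M)"
  unfolding fps_value_def
proof (intro conjI allI impI)
  note L = fps_valueD(1)[OF f(2)] and M = fps_valueD(1)[OF g(2)]
  show "L * M \<in> mat_in n R" using L M by (intro mat_in_mult subring_R)
  fix i j m assume ij: "i < n" "j < n"
  note Tc = mat_inD(1)[OF mat_in_pow[OF subring_R T]]
  have 1: "(L * M) $$ (i, j) - (\<Sum>l<n. partial f T i l m * partial g T l j m) \<in> P m"
    unfolding index_mult_mat_sum[OF mat_inD(1)[OF L] mat_inD(1)[OF M] ij] sum_subtractf[symmetric]
    using ij f g by (intro P_sum P_cong_mult fps_valueD(2) partial_R mat_inD(4)[OF M]) auto
  let ?F = "\<lambda>a b l. fps_nth f a * fps_nth g b * \<pi> ^ (a + b) * ((T ^\<^sub>m a) $$ (i, l) * (T ^\<^sub>m b) $$ (l, j))"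
  have "(\<Sum>l<n. partial f T i l m * partial g T l j m) = (\<Sum>l<n. \<Sum>a<m. \<Sum>b<m. ?F a b l)"
    by (simp add: sum_product power_add mult_ac)
  also have "\<dots> = (\<Sum>a<m. \<Sum>l<n. \<Sum>b<m. ?F a b l)" by (rule sum.swap)
  also have "\<dots> = (\<Sum>a<m. \<Sum>b<m. \<Sum>l<n. ?F a b l)" by (intro sum.cong refl sum.swap)
  also have "\<dots> = (\<Sum>a<m. \<Sum>b<m. fps_nth f a * fps_nth g b * \<pi> ^ (a + b) * (T ^\<^sub>m (a + b)) $$ (i, j))"
    by (simp add: sum_distrib_left[symmetric] index_mult_mat_sum[OF Tc Tc ij, symmetric]
        pow_mat_add[OF mat_inD(1)[OF T]])
  finally have 2: "(\<Sum>l<n. partial f T i l m * partial g T l j m) = \<dots>" .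
  have 3: "(\<Sum>a<m. \<Sum>b<m. fps_nth f a * fps_nth g b * \<pi> ^ (a + b) * (T ^\<^sub>m (a + b)) $$ (i, j)) -
      (\<Sum>k<m. \<Sum>a\<le>k. fps_nth f a * fps_nth g (k - a) * \<pi> ^ (a + (k - a)) * (T ^\<^sub>m (a + (k - a))) $$ (i, j)) \<in> P m"
  proof (rule Cauchy_product_mod)
    fix a b
    show "fps_nth f a * fps_nth g b * \<pi> ^ (a + b) * (T ^\<^sub>m (a + b)) $$ (i, j) \<in> P (a + b)"
      using P_I[OF R_mult[OF R_mult[OF f(1)[rule_format, of a] g(1)[rule_format, of b]] pow_R[OF ij]], of "a + b" "a + b"]
      by (simp add: mult_ac)
  qed
  have "(\<Sum>k<m. \<Sum>a\<le>k. fps_nth f a * fps_nth g (k - a) * \<pi> ^ (a + (k - a)) * (T ^\<^sub>m (a + (k - a))) $$ (i, j)) =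
      partial (f * g) T i j m"
    by (auto simp: fps_mult_nth atLeast0AtMost sum_distrib_right intro!: sum.cong)
  note 3[unfolded this]
  then show "(L * M) $$ (i, j) - partial (f * g) T i j m \<in> P m"
    by (rule P_trans[OF 1[unfolded 2]])
qed

lemma fps_value_affine: "fps_value n (1 + fps_X) T (1\<^sub>m n + \<pi> \<cdot>\<^sub>m T)"
  unfolding fps_value_def
proof (intro conjI allI impI)
  note Tc = mat_inD[OF T]
  show *: "1\<^sub>m n + \<pi> \<cdot>\<^sub>m T \<in> mat_in n R"
    by (intro mat_in_add mat_in_one mat_in_smult subring_R R_of_nat T)
  fix i j m assume ij: "i < n" "j < n"
  \<comment> \<open>Truncation below 2 drops terms of the affine series, but the error then still
    lies in \<open>P m\<close>; from 2 on the partial sum is exact.\<close>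
  consider "m = 0" | "m = 1" | m' where "m = Suc (Suc m')"
    by (metis One_nat_def not0_implies_Suc)
  then show "(1\<^sub>m n + \<pi> \<cdot>\<^sub>m T) $$ (i, j) - partial (1 + fps_X) T i j m \<in> P m"
  proof cases
    case 1
    then show ?thesis using mat_inD(4)[OF * ij] by (simp add: P_0)
  next
    case 2
    then show ?thesis using ij Tc P_I[of "T $$ (i, j)" 1] by simp
  next
    case 3
    then show ?thesis using ij Tc 
      by (simp add: sum.lessThan_Suc_shift P_zero del: sum.lessThan_Suc)
  qed
qed

lemma fps_value_one: "fps_value n 1 T (1\<^sub>m n)"
  unfolding fps_value_def
proof (intro conjI allI impI)
  show "1\<^sub>m n \<in> mat_in n R" by (intro mat_in_one subring_R)
  fix i j m assume ij: "i < n" "j < n"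
  show "1\<^sub>m n $$ (i, j) - partial 1 T i j m \<in> P m"
    using ij mat_inD[OF T] R_0 R_1 
    by (cases m) (simp_all add: sum.lessThan_Suc_shift P_zero P_0 del: sum.lessThan_Suc)
qed

lemma fps_value_power:
  assumes "\<forall>k. fps_nth f k \<in> R" "fps_value n f T L" shows "fps_value n (f ^ m) T (L ^\<^sub>m m)"
proof (induction m)
  case (Suc m)
  then show ?case
    using fps_value_mult[OF fps_power_R[OF assms(1)] Suc assms] by (simp add: mult.commute)
qed (use fps_value_one mat_inD(2)[OF fps_valueD(1)[OF assms(2)]] in simp)

text \<open>Uniqueness of p-adic limits resolves the definite description; the value with controlled
  rate is in particular a limit.\<close>

lemma mat_bin_series_eq:
  assumes L: "fps_value n (fps_binomial a) T L" shows "mat_bin_series R p n a T = L"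
  unfolding mat_bin_series_def
proof (rule the_equality)
  have *: "padic_lim R p (\<lambda>m. \<Sum>k<m. (a gchoose k) * \<pi> ^ k * (T ^\<^sub>m k) $$ (i, j)) (L $$ (i, j))"
    if "i < n" "j < n" for i j
    using fps_valueD(2)[OF L that] by (intro padic_limI) simp
  then show "L \<in> carrier_mat n n \<and> (\<forall>i<n. \<forall>j<n.
      padic_lim R p (\<lambda>m. \<Sum>k<m. (a gchoose k) * \<pi> ^ k * (T ^\<^sub>m k) $$ (i, j)) (L $$ (i, j)))"
    using mat_inD[OF fps_valueD(1)[OF L]] by auto
  fix L' assume "L' \<in> carrier_mat n n \<and> (\<forall>i<n. \<forall>j<n.
      padic_lim R p (\<lambda>m. \<Sum>k<m. (a gchoose k) * \<pi> ^ k * (T ^\<^sub>m k) $$ (i, j)) (L' $$ (i, j)))"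
  then show "L' = L"
    using mat_inD(2,3)[OF fps_valueD(1)[OF L]] padic_lim_unique[OF _ *] by (intro eq_matI) auto
qed

text \<open>If \<open>T\<close> is self-adjoint for the bilinear form \<open>B\<close>, so are its
  powers, and hence so is any value of a series in \<open>T\<close>.\<close>

lemma fps_value_commute:
  assumes f: "fps_value n f T L" and B: "B \<in> mat_in n R"
    and TB: "transpose_mat T * B = B * T"
  shows "transpose_mat L * B = B * L"
proof (rule mcong_all_eq[of n])
  fix m
  note Tc = mat_inD(1)[OF T] and Bc = mat_inD(1)[OF B] and L = fps_valueD(1)[OF f]
  note Tk = pow_carrier_mat[OF Tc]
  have pw: "transpose_mat (T ^\<^sub>m k) * B = B * T ^\<^sub>m k" for k
  proof (induction k)
    case (Suc k)
    have "transpose_mat (T ^\<^sub>m Suc k) * B = transpose_mat T * (transpose_mat (T ^\<^sub>m k) * B)"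
      using Tc Tk[of k] Bc by (simp add: transpose_mult[of _ n n _ n] assoc_mult_mat[of _ n n _ n _ n])
    also have "\<dots> = B * T * T ^\<^sub>m k"
      unfolding Suc TB[symmetric] using Tc Tk[of k] Bc by (simp add: assoc_mult_mat[of _ n n _ n _ n])
    also have "\<dots> = B * T ^\<^sub>m Suc k"
      using Tc Tk[of k] Bc pow_mat_add[OF Tc, of 1 k] by (simp add: assoc_mult_mat[of _ n n _ n _ n])
    finally show ?case .
  qed (use Tc Bc in simp)
  show "mcong n (Suc m) (transpose_mat L * B) (B * L)"
    unfolding mcong_def
  proof (intro conjI allI impI)
    show "transpose_mat L * B \<in> mat_in n R" "B * L \<in> mat_in n R"
      by (intro mat_in_mult subring_R mat_in_transpose L B)+
    fix i j assume ij: "i < n" "j < n"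
    let ?S = "\<lambda>i j. partial f T i j (Suc m)"
    have 1: "(transpose_mat L * B) $$ (i, j) - (\<Sum>l<n. ?S l i * B $$ (l, j)) \<in> P (Suc m)"
      unfolding index_mult_mat_sum[OF mat_inD(1)[OF mat_in_transpose[OF L]] Bc ij] sum_subtractf[symmetric]
      using ij mat_inD[OF L] by (auto simp flip: left_diff_distrib
          intro!: P_sum P_multR fps_valueD(2)[OF f] mat_inD(4)[OF B] simp del: sum.lessThan_Suc)
    have 2: "(B * L) $$ (i, j) - (\<Sum>l<n. B $$ (i, l) * ?S l j) \<in> P (Suc m)"
      unfolding index_mult_mat_sum[OF Bc mat_inD(1)[OF L] ij] sum_subtractf[symmetric]
      using ij by (auto simp flip: right_diff_distrib
          intro!: P_sum P_multR' fps_valueD(2)[OF f] mat_inD(4)[OF B] simp del: sum.lessThan_Suc)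
    have "(\<Sum>l<n. ?S l i * B $$ (l, j)) = (\<Sum>k<Suc m. fps_nth f k * \<pi> ^ k * (transpose_mat (T ^\<^sub>m k) * B) $$ (i, j))"
    proof -
      have "(\<Sum>l<n. ?S l i * B $$ (l, j)) =
          (\<Sum>l<n. \<Sum>k<Suc m. fps_nth f k * \<pi> ^ k * ((T ^\<^sub>m k) $$ (l, i) * B $$ (l, j)))"
        by (simp only: sum_distrib_right mult.assoc)
      also have "\<dots> = (\<Sum>k<Suc m. \<Sum>l<n. fps_nth f k * \<pi> ^ k * ((T ^\<^sub>m k) $$ (l, i) * B $$ (l, j)))"
        by (rule sum.swap)
      also have "\<dots> = (\<Sum>k<Suc m. fps_nth f k * \<pi> ^ k * (transpose_mat (T ^\<^sub>m k) * B) $$ (i, j))"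
        using ij by (auto simp: index_mult_mat_sum[OF iffD2[OF transpose_carrier_mat Tk] Bc ij]
          sum_distrib_left carrier_matD[OF Tc] intro!: sum.cong simp del: sum.lessThan_Suc index_mult_mat(1))
      finally show ?thesis .
    qed
    also have "\<dots> = (\<Sum>k<Suc m. fps_nth f k * \<pi> ^ k * (B * T ^\<^sub>m k) $$ (i, j))"
      by (simp only: pw)
    also have "\<dots> = (\<Sum>l<n. B $$ (i, l) * ?S l j)"
    proof -
      have "(\<Sum>k<Suc m. fps_nth f k * \<pi> ^ k * (B * T ^\<^sub>m k) $$ (i, j)) =
          (\<Sum>k<Suc m. \<Sum>l<n. fps_nth f k * \<pi> ^ k * (B $$ (i, l) * (T ^\<^sub>m k) $$ (l, j)))"
        by (simp add: index_mult_mat_sum[OF Bc Tk ij] sum_distrib_left del: sum.lessThan_Suc index_mult_mat(1))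
      also have "\<dots> = (\<Sum>l<n. \<Sum>k<Suc m. fps_nth f k * \<pi> ^ k * (B $$ (i, l) * (T ^\<^sub>m k) $$ (l, j)))"
        by (rule sum.swap)
      also have "\<dots> = (\<Sum>l<n. B $$ (i, l) * ?S l j)"
        by (simp only: sum_distrib_left mult_ac)
      finally show ?thesis .
    qed
    finally have eq: "(\<Sum>l<n. ?S l i * B $$ (l, j)) = (\<Sum>l<n. B $$ (i, l) * ?S l j)" .
    show "(transpose_mat L * B) $$ (i, j) - (B * L) $$ (i, j) \<in> P (Suc m)"
      by (rule P_trans[OF 1[unfolded eq] P_sym[OF 2]])
  qed
qed

end

lemma mat_sqrt:
  assumes p: "odd p" and T: "T \<in> mat_in n R"
  defines "L \<equiv> mat_bin_series R p n (1 / 2) T"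
  shows "L \<in> mat_in n R" "L * L = 1\<^sub>m n + \<pi> \<cdot>\<^sub>m T"
    "\<And>B. B \<in> mat_in n R \<Longrightarrow> transpose_mat T * B = B * T \<Longrightarrow> transpose_mat L * B = B * L"
proof -
  let ?f = "fps_binomial (1 / 2) :: 'k fps"
  have "\<not> p dvd 2" using p prime_p
    by (metis dvd_refl even_numeral prime_nat_iff two_is_prime_nat primes_dvd_imp_eq)
  then have f: "\<forall>k. fps_nth ?f k \<in> R" using gbinomial_ratio_R[of 2 1] by simp
  then obtain L' where L': "fps_value n ?f T L'" using fps_value_ex[OF T] by blast
  then have L: "fps_value n ?f T L" using mat_bin_series_eq[OF T] by (simp add: L_def)
  show "L \<in> mat_in n R" using fps_valueD(1)[OF L] .
  have "?f * ?f = 1 + fps_X" by (simp add: fps_binomial_1 flip: fps_binomial_add_mult)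
  then show "L * L = 1\<^sub>m n + \<pi> \<cdot>\<^sub>m T"
    using fps_value_unique[OF T] fps_value_affine[OF T] fps_value_mult[OF T f L f L] by simp
  show "transpose_mat L * B = B * L" if "B \<in> mat_in n R" "transpose_mat T * B = B * T" for B
    using fps_value_commute[OF T L that] .
qed

lemma scalar_root:
  assumes n: "\<not> p dvd n" and t: "t \<in> R"
  defines "L \<equiv> bin_series R p (- (1 / of_nat n)) t"
  shows "L \<in> R" "L - 1 \<in> P 1" "L ^ n * (1 + \<pi> * t) = 1"
proof -
  let ?f = "fps_binomial (- (1 / of_nat n)) :: 'k fps"
  \<comment> \<open>The scalar series is treated as the matrix series of a 1 x 1 matrix.\<close>
  define T where "T = mat 1 1 (\<lambda>_. t)"
  have T: "T \<in> mat_in 1 R" using t by (auto simp: mat_in_def T_def)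
  have f: "\<forall>k. fps_nth ?f k \<in> R" using gbinomial_ratio_R[of n "- 1"] n by simp
  then obtain M where M: "fps_value 1 ?f T M" using fps_value_ex[OF T] by blast
  have pow: "(A ^\<^sub>m k) $$ (0, 0) = (A $$ (0, 0)) ^ k" if "A \<in> carrier_mat 1 1" for A :: "'k mat" and k
    using that by (induction k) (auto simp: scalar_prod_def)
  have T00: "(T ^\<^sub>m k) $$ (0, 0) = t ^ k" for k
    using pow[of T k] by (simp add: T_def)
  have lim: "padic_lim R p (\<lambda>m. \<Sum>k<m. ((- (1 / of_nat n)) gchoose k) * \<pi> ^ k * t ^ k) (M $$ (0, 0))"
    using fps_valueD(2)[OF M, of 0 0] by (intro padic_limI) (simp add: T00)
  then have L: "L = M $$ (0, 0)"
    unfolding L_def bin_series_def using padic_lim_unique by blast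
  show "L \<in> R" using fps_valueD(1)[OF M] by (simp add: L mat_in_def)
  show "L - 1 \<in> P 1" using fps_valueD(2)[OF M, of 0 0 1] by (simp add: L T_def)
  have "of_nat n \<noteq> (0 :: 'k)" using n by (intro notI) auto
  \<comment> \<open>Exponents of formal binomial series add: \<open>n\<close> copies of
    \<open>- (1 / n)\<close> and a single 1 sum to 0.\<close>
  then have "?f ^ n * (1 + fps_X) = 1"
    by (simp add: fps_binomial_power flip: fps_binomial_1 fps_binomial_add_mult)
  moreover have "\<forall>k. fps_nth (1 + fps_X :: 'k fps) k \<in> R" by (auto simp: fps_X_def fps_one_def intro: R_intros)
  ultimately have "M ^\<^sub>m n * (1\<^sub>m 1 + \<pi> \<cdot>\<^sub>m T) = 1\<^sub>m 1"
    using fps_value_mult[OF T fps_power_R[OF f] fps_value_power[OF T f M] _ fps_value_affine[OF T]]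
      fps_value_one[OF T] fps_value_unique[OF T] by metis
  then have "(M ^\<^sub>m n * (1\<^sub>m 1 + \<pi> \<cdot>\<^sub>m T)) $$ (0, 0) = 1" by simp
  then show "L ^ n * (1 + \<pi> * t) = 1"
    using mat_inD[OF T] mat_inD[OF fps_valueD(1)[OF M]]
    by (subst (asm) index_mult_mat_sum[of _ 1]) (auto simp: pow L T_def intro!: pow_carrier_mat)
qed

end

section \<open>The Frobenius lift and existence of solutions\<close>

text \<open>Here \<phi> is a homomorphism of the whole field, so that it commutes with determinants
  and inverses and passes through division by \<open>p\<close>. A \<open>frob_lift\<close> is
  constrained only on \<open>R\<close>; \<open>frob_lift_extends\<close> supplies the
  passage.\<close>

locale witt_frobenius = witt_ring R p + field_hom \<phi>
  for R :: "'k::field_char_0 set" and p :: nat and \<phi> :: "'k \<Rightarrow> 'k" +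
  assumes phi_R: "a \<in> R \<Longrightarrow> \<phi> a \<in> R"
    and phi_cong: "a \<in> R \<Longrightarrow> \<phi> a - a ^ p \<in> pideal R p 1"
begin

lemma phi_P: "a \<in> P k \<Longrightarrow> \<phi> a \<in> P k"
  using phi_R[of "a / \<pi> ^ k"] by (simp add: P_iff hom_distribs)

text \<open>If \<open>a\<close> is not integral then \<open>inverse a\<close> lies in
  \<open>P 1\<close>, and so does its image; an integral \<open>\<phi> a\<close> would then put 1
  into \<open>P 1\<close>. Consequently congruences can be cancelled through \<phi>.\<close>

lemma phi_R_iff: "\<phi> a \<in> R \<longleftrightarrow> a \<in> R"
proof
  assume *: "\<phi> a \<in> R"
  show "a \<in> R"
  proof (rule ccontr)
    assume a: "a \<notin> R"
    then have nz: "a \<noteq> 0" using R_0 by auto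
    have "inverse a \<in> P 1"
    proof (rule ccontr)
      assume nP: "inverse a \<notin> P 1"
      have "inverse a \<in> R"
      proof (cases a rule: dvr_repr)
        case (1 m v)
        have "m < 0" 
        proof (rule ccontr)
          assume "\<not> m < 0"
          then have "a = \<pi> ^ nat m * v" using 1 by (simp add: power_int_def)
          then show False using a 1 R_intros by metis
        qed
        then have "inverse a = \<pi> ^ nat (- m) * inverse v" using 1 by (simp add: power_int_def power_inverse)
        then show ?thesis using 1 R_intros by metis
      qed (use nz in simp)
      then show False using unit_of_not_P[OF _ nP] a by simp
    qed
    then have "\<phi> (inverse a) * \<phi> a \<in> P 1" using phi_P * P_multR by blast
    then have "1 \<in> P 1" using nz by (simp flip: hom_mult)
    then show False using unit_not_P[of 1] R_1 by simp
  qed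
qed (rule phi_R)

lemma phi_P_iff: "\<phi> a \<in> P k \<longleftrightarrow> a \<in> P k"
  using phi_R_iff[of "a / \<pi> ^ k"] by (simp add: P_iff hom_distribs)

text \<open>Applying \<phi> leaves the precision of \<open>a - b\<close> unchanged, whereas passing
  to p-th powers raises it.\<close>

lemma phi_fixed_unique:
  assumes a: "a \<in> R" "\<phi> a = a ^ p" and b: "b \<in> R" "\<phi> b = b ^ p" and ab: "a - b \<in> P 1"
  shows "a = b"
proof (rule P_all_Suc_eq)
  show "a - b \<in> P (Suc k)" for k
  proof (induction k)
    case (Suc k)
    then have "\<phi> (a - b) \<in> P (Suc (Suc k))"
      using P_cong_power_p[OF Suc a(1) b(1)] a b by (simp add: hom_distribs)
    then show ?case by (simp add: phi_P_iff)
  qed (use ab in simp)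
qed

text \<open>A Teichmueller representative \<open>t\<close> of \<open>c\<close> is a limit of powers of \<open>c\<close>, hence lies in \<open>V\<close> although
  \<open>V\<close> is not assumed to be stable under \<open>\<phi>\<close>; moreover \<open>\<phi>\<close> permutes the powers of \<open>t\<close>.\<close>
lemma residue_phi_surj:
  assumes V: "valuation_subring R V" "padic_complete R p V" and c: "c \<in> V"
  shows "\<exists>s\<in>V. \<phi> s \<in> V \<and> c - \<phi> s \<in> P 1"
proof -
  note VD = valuation_subringD[OF V(1)]
  have cR: "c \<in> R" using c VD(1) by auto
  obtain m where m: "m \<ge> 1" "c ^ (p ^ m) - c \<in> P 1" using residue_periodic[OF cR] .
  \<comment> \<open>Since \<open>m\<close> is a period of the residue class, all these powers stay
    in the class of \<open>c\<close>. Raising the congruence of \<open>c ^ (p ^ m)\<close> and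
    \<open>c\<close> to the power \<open>p ^ (m * j)\<close> makes the sequence Cauchy.\<close>
  define s where "s j = c ^ (p ^ (m * j))" for j
  have sV: "s j \<in> V" for j unfolding s_def using c VD(2) by (rule subring_of_power[rotated])
  then have sR: "s j \<in> R" for j using VD(1) by auto
  have s_Suc: "s (Suc j) = s j ^ (p ^ m)" for j
    by (simp add: s_def power_add mult.commute flip: power_mult)
  have le: "j \<le> 1 + m * j" for j using m(1) by (metis le_add2 le_trans mult_le_mono1 nat_mult_1)
  have d: "s (Suc j) - s j \<in> P j" for j
  proof -
    have "(c ^ (p ^ m)) ^ (p ^ (m * j)) - c ^ (p ^ (m * j)) \<in> P (1 + m * j)"
      using cR m(2) by (intro P_cong_power_pp R_power) auto
    then have "s (Suc j) - s j \<in> P (1 + m * j)"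
      by (simp add: s_def power_add mult.commute flip: power_mult)
    then show ?thesis using P_mono le by blast
  qed
  obtain t where t: "t \<in> V" "\<And>j. t - s j \<in> P j" using complete_limit[of V s, OF V(2) sV d] by blast
  have tR: "t \<in> R" using t VD(1) by auto
  have "\<phi> t = t ^ p"
  proof (rule P_all_eq)
    fix j
    have "\<phi> t - \<phi> (s j) \<in> P j" using phi_P[OF t(2)[of j]] by (simp add: hom_distribs)
    moreover have "\<phi> (s j) - s j ^ p \<in> P j"
    proof -
      have "\<phi> c ^ (p ^ (m * j)) - (c ^ p) ^ (p ^ (m * j)) \<in> P (1 + m * j)"
        using cR phi_cong[OF cR] by (intro P_cong_power_pp R_power phi_R) auto
      then have "\<phi> (s j) - s j ^ p \<in> P (1 + m * j)"
        by (simp add: s_def hom_distribs mult.commute flip: power_mult)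
      then show ?thesis using P_mono le by blast
    qed
    moreover have "s j ^ p - t ^ p \<in> P j" using P_cong_power[OF P_sym[OF t(2)] sR tR] .
    ultimately show "\<phi> t - t ^ p \<in> P j" by (blast intro: P_trans)
  qed
  have "t ^ (p ^ m) = t"
  proof (rule P_all_eq)
    fix j
    have "t ^ (p ^ m) - s (Suc j) \<in> P j" unfolding s_Suc using P_cong_power[OF t(2) tR sR] .
    moreover have "s (Suc j) - t \<in> P j" using P_mono[OF _ P_sym[OF t(2)], of j "Suc j"] by simp
    ultimately show "t ^ (p ^ m) - t \<in> P j" by (rule P_trans)
  qed
  then have "\<phi> (t ^ (p ^ (m - 1))) = t"
    using m(1) by (simp add: hom_distribs \<open>\<phi> t = t ^ p\<close> flip: power_mult power_Suc)
  moreover have "c - t \<in> P 1"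
    using P_sym[OF m(2)] P_sym[OF t(2)[of 1]] P_trans[of c "s 1" 1 t] by (simp add: s_def)
  moreover have "t ^ (p ^ (m - 1)) \<in> V" using t(1) VD(2) by (rule subring_of_power[rotated])
  ultimately show ?thesis using t(1) by metis
qed

text \<open>Successive approximation: \<open>\<phi> (s x)\<close> matches \<open>x\<close> modulo
  \<open>p\<close>, and the difference divided by \<open>p\<close> is the next remainder. It stays
  in \<open>V\<close> because \<open>\<phi> (s x)\<close> does, which is why
  \<open>residue_phi_surj\<close> records that membership. The preimages add up to a series
  converging in \<open>V\<close>.\<close>

lemma phi_surj:
  assumes V: "valuation_subring R V" "padic_complete R p V" and c: "c \<in> V"
  shows "\<exists>b\<in>V. \<phi> b = c"
proof -
  note VD = valuation_subringD[OF V(1)]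
  obtain s where s: "\<And>c. c \<in> V \<Longrightarrow> s c \<in> V \<and> \<phi> (s c) \<in> V \<and> c - \<phi> (s c) \<in> P 1"
    using residue_phi_surj[OF V] by metis
  define r where "r x = (x - \<phi> (s x)) / \<pi>" for x
  have rV: "r x \<in> V" if "x \<in> V" for x
    unfolding r_def using s[OF that] subring_ofD(6)[OF VD(2) that] by (intro VD(4)) (auto simp: P_iff)
  define x where "x i = (r ^^ i) c" for i
  have xV: "x i \<in> V" for i by (induction i) (auto simp: x_def c rV)
  have x_Suc: "x i - \<phi> (s (x i)) = \<pi> * x (Suc i)" for i by (simp add: x_def r_def)
  define b where "b N = (\<Sum>i<N. \<pi> ^ i * s (x i))" for N
  have bV: "b N \<in> V" for N
    unfolding b_def using s xV by (intro subring_of_sum subring_ofD(4) subring_of_power subring_of_of_nat VD(2)) auto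
  have cb: "c - \<phi> (b N) = \<pi> ^ N * x N" for N
  proof (induction N)
    case (Suc N)
    have "c - \<phi> (b (Suc N)) = \<pi> ^ N * (x N - \<phi> (s (x N)))"
      using Suc by (simp add: b_def hom_distribs algebra_simps)
    then show ?case by (simp add: x_Suc)
  qed (simp add: b_def x_def)
  have "b (Suc N) - b N \<in> P N" for N using s[OF xV] VD(1) P_I by (auto simp: b_def)
  then obtain L where L: "L \<in> V" "\<And>N. L - b N \<in> P N"
    using complete_limit[of V b, OF V(2) bV] by blast
  have "\<phi> L = c"
  proof (rule P_all_eq)
    fix N
    have "\<phi> L - \<phi> (b N) \<in> P N" using phi_P[OF L(2)] by (simp add: hom_distribs)
    moreover have "\<phi> (b N) - c \<in> P N" using P_sym[of c "\<phi> (b N)" N] P_I[of "x N" N] xV[of N] VD(1) unfolding cb by blast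
    ultimately show "\<phi> L - c \<in> P N" by (rule P_trans)
  qed
  then show ?thesis using L by blast
qed

text \<open>By injectivity one global inverse function serves all complete valuation subrings at
  once.\<close>

lemma inv_phi:
  assumes "valuation_subring R V" "padic_complete R p V" "c \<in> V"
  shows "inv_into UNIV \<phi> c \<in> V" "\<phi> (inv_into UNIV \<phi> c) = c"
  using phi_surj[OF assms] inv_f_f by auto

lemma mat_phi_R: "A \<in> mat_in n R \<Longrightarrow> map_mat \<phi> A \<in> mat_in n R"
  by (auto simp: mat_in_def phi_R)

lemma mcong_phi: "mcong n k A B \<Longrightarrow> mcong n k (map_mat \<phi> A) (map_mat \<phi> B)"
  using phi_P by (auto simp: mcong_def mat_phi_R mat_inD hom_minus[symmetric])

lemma mcong_phi_rev:
  "A \<in> mat_in n R \<Longrightarrow> B \<in> mat_in n R \<Longrightarrow> mcong n k (map_mat \<phi> A) (map_mat \<phi> B) \<Longrightarrow> mcong n k A B"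
  by (auto simp: mcong_def mat_inD hom_minus[symmetric] phi_P_iff)

lemma mcong_phi_frobp: "A \<in> mat_in n R \<Longrightarrow> mcong n 1 (map_mat \<phi> A) (frobp p A)"
  unfolding mcong_def using phi_cong mat_in_frobp[OF subring_R] 
  by (auto simp: mat_phi_R mat_inD frobp_def)

section \<open>Delta and Phi on integral invertible matrices\<close>

lemma Dmat_in:
  assumes V: "valuation_subring R V" "padic_complete R p V"
    and D: "\<forall>i<n. \<forall>j<n. D i j \<in> Acompl R p n V" and x: "x \<in> GLm n R" "x \<in> GLm n V"
  shows "Dmat n D x \<in> mat_in n V"
  using Acompl_in[OF _ valuation_subringD(1,2)[OF V(1)] V(2) x] D by (auto simp: Dmat_def mat_in_def)

lemma PhiD_in:
  assumes V: "valuation_subring R V" "padic_complete R p V"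
    and D: "\<forall>i<n. \<forall>j<n. D i j \<in> Acompl R p n V" and x: "x \<in> GLm n R" "x \<in> GLm n V"
  shows "PhiD p n D x \<in> mat_in n V"
  unfolding PhiD_def using Dmat_in[OF V D x] GLmD(1)[OF x(2)]
  by (intro mat_in_add mat_in_smult mat_in_frobp subring_of_of_nat valuation_subringD(2)[OF V(1)])

text \<open>Both summands gain a power of \<open>p\<close>: the entrywise p-th powers by
  \<open>P_cong_power_p\<close>, the other one through its explicit factor. Continuity of Delta is
  enough, so Delta may be arbitrary.\<close>

lemma PhiD_cong:
  assumes D: "\<forall>i<n. \<forall>j<n. D i j \<in> Acompl R p n R" and x: "x \<in> GLm n R" "y \<in> GLm n R"
    and xy: "mcong n k x y" and k: "k \<ge> 1"
  shows "mcong n (Suc k) (PhiD p n D x) (PhiD p n D y)"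
proof -
  have "mcong n k (Dmat n D x) (Dmat n D y)"
    unfolding mcong_def
    using Dmat_in[OF valuation_subring_self R_complete D] x Acompl_cong[OF _ x xy] D by (auto simp: Dmat_def)
  then show ?thesis unfolding PhiD_def by (intro mcong_add mcong_smult_pi mcong_frobp xy k)
qed

lemma one_plus_pi:
  assumes "\<alpha> \<in> mat_in n R"
  shows "1\<^sub>m n + \<pi> \<cdot>\<^sub>m \<alpha> \<in> mat_in n R" "mcong n 1 (1\<^sub>m n + \<pi> \<cdot>\<^sub>m \<alpha>) (1\<^sub>m n)"
proof -
  show *: "1\<^sub>m n + \<pi> \<cdot>\<^sub>m \<alpha> \<in> mat_in n R"
    by (intro mat_in_add mat_in_one mat_in_smult subring_R R_of_nat assms)
  show "mcong n 1 (1\<^sub>m n + \<pi> \<cdot>\<^sub>m \<alpha>) (1\<^sub>m n)"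
    unfolding mcong_def using * assms P_multR[OF P_pi] by (auto simp: mat_in_one subring_R mat_inD)
qed

lemma mcong_rhs_frobp:
  assumes D: "\<forall>i<n. \<forall>j<n. D i j \<in> Acompl R p n R" and x: "x \<in> GLm n R" and \<alpha>: "\<alpha> \<in> mat_in n R"
  shows "mcong n 1 ((1\<^sub>m n + \<pi> \<cdot>\<^sub>m \<alpha>) * PhiD p n D x) (frobp p x)"
proof -
  note Din = Dmat_in[OF valuation_subring_self R_complete D x x]
  note Fin = mat_in_frobp[OF subring_R GLmD(1)[OF x], of p]
  have "mcong n 1 (PhiD p n D x) (frobp p x)"
    unfolding mcong_def PhiD_def using Din Fin P_multR[OF P_pi]
    by (auto simp: mat_inD intro!: mat_in_add mat_in_smult subring_R R_of_nat)
  from mcong_mult[OF one_plus_pi(2)[OF \<alpha>] this] show ?thesis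
    using mat_inD(1)[OF Fin] by simp
qed

text \<open>The iteration is run inside \<open>V\<close>. With \<open>V = R\<close> this is
  existence; for general \<open>V\<close>, uniqueness over \<open>R\<close> identifies the result
  with the given solution, although \<open>V\<close> need not be stable under \<phi>.\<close>

theorem solution_exists:
  assumes V: "valuation_subring R V" "padic_complete R p V"
    and D: "\<forall>i<n. \<forall>j<n. D i j \<in> Acompl R p n V"
    and u0: "u0 \<in> GLm n V" and \<alpha>: "\<alpha> \<in> mat_in n V"
  shows "\<exists>u. u \<in> GLm n R \<and> u \<in> mat_in n V \<and>
    map_mat \<phi> u = (1\<^sub>m n + \<pi> \<cdot>\<^sub>m \<alpha>) * PhiD p n D u \<and> mcong n 1 u u0"
proof -
  note VD = valuation_subringD[OF V(1)]
  have DR: "\<forall>i<n. \<forall>j<n. D i j \<in> Acompl R p n R" using D Acompl_mono[OF VD(1)] by blast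
  have \<alpha>R: "\<alpha> \<in> mat_in n R" using mat_in_mono[OF VD(1) \<alpha>] .
  have GLR: "x \<in> GLm n V \<Longrightarrow> x \<in> GLm n R" for x using VD(1) mat_in_mono[OF VD(1)] by (auto simp: GLm_def)
  define \<beta> where "\<beta> = 1\<^sub>m n + \<pi> \<cdot>\<^sub>m \<alpha>"
  have \<beta>V: "\<beta> \<in> mat_in n V"
    unfolding \<beta>_def by (intro mat_in_add mat_in_one mat_in_smult subring_of_of_nat VD(2) \<alpha>)
  have \<beta>R: "\<beta> \<in> mat_in n R" using mat_in_mono[OF VD(1) \<beta>V] .
  define G where "G x = map_mat (inv_into UNIV \<phi>) (\<beta> * PhiD p n D x)" for x
  have rhsV: "\<beta> * PhiD p n D x \<in> mat_in n V" if "x \<in> GLm n V" for x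
    using PhiD_in[OF V D GLR[OF that] that] \<beta>V by (intro mat_in_mult VD(2))
  have GV: "G x \<in> mat_in n V" and phiG: "map_mat \<phi> (G x) = \<beta> * PhiD p n D x" if "x \<in> GLm n V" for x
  proof -
    show "G x \<in> mat_in n V" unfolding G_def using inv_phi(1)[OF V] rhsV[OF that] mat_inD[OF rhsV[OF that]]
      by (intro mat_inI) auto
    show "map_mat \<phi> (G x) = \<beta> * PhiD p n D x"
      unfolding G_def using inv_phi(2)[OF V mat_inD(4)[OF rhsV[OF that]]] mat_inD(2,3)[OF rhsV[OF that]]
      by (intro eq_matI) auto
  qed
  \<comment> \<open>Both \<open>\<phi> (G x)\<close> and \<open>\<phi> x\<close> are congruent to
    \<open>frobp p x\<close>, so \<open>G\<close> preserves residue classes, and with them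
    invertibility.\<close>
  have Gx: "mcong n 1 (G x) x" if "x \<in> GLm n V" for x
  proof (rule mcong_phi_rev)
    show "G x \<in> mat_in n R" "x \<in> mat_in n R" using GV[OF that] that mat_in_mono[OF VD(1)] by (auto simp: GLm_def)
    show "mcong n 1 (map_mat \<phi> (G x)) (map_mat \<phi> x)"
      unfolding phiG[OF that] \<beta>_def
      using mcong_rhs_frobp[OF DR GLR[OF that] \<alpha>R] mcong_phi_frobp[OF GLmD(1)[OF GLR[OF that]]]
      by (blast intro: mcong_trans mcong_sym)
  qed
  have GLV: "G x \<in> GLm n V" if "x \<in> GLm n V" for x
    using GLm_cong[OF GLR[OF that] Gx[OF that]] GV[OF that] VD(3)[OF mat_in_det[OF VD(2)]]
    by (auto simp: GLm_def)
  define X where "X i = (G ^^ i) u0" for i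
  have X_Suc: "X (Suc i) = G (X i)" for i by (simp add: X_def)
  have XV: "X i \<in> GLm n V" for i by (induction i) (auto simp: X_def u0 GLV)
  have phiX: "map_mat \<phi> (X (Suc i)) = \<beta> * PhiD p n D (X i)" for i
    unfolding X_Suc by (rule phiG[OF XV])
  have XR: "X i \<in> GLm n R" for i using GLR[OF XV] .
  have XinV: "X i \<in> mat_in n V" for i using GLmD(1)[OF XV] .
  have XinR: "X i \<in> mat_in n R" for i using GLmD(1)[OF XR] .
  have rhs_cong: "mcong n (Suc k) (\<beta> * PhiD p n D x) (\<beta> * PhiD p n D y)"
    if "mcong n k x y" "k \<ge> 1" "x \<in> GLm n R" "y \<in> GLm n R" for k x y
    by (intro mcong_mult mcong_refl \<beta>R PhiD_cong DR that)
  have X0: "mcong n 1 (X i) u0" for i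
  proof (induction i)
    case 0
    then show ?case using XinR[of 0] by (simp add: X_def mcong_refl)
  next
    case (Suc i)
    then show ?case using Gx[OF XV, of i] unfolding X_Suc by (blast intro: mcong_trans)
  qed
  have step: "mcong n (Suc i) (X (Suc i)) (X i)" for i
  proof (induction i)
    case 0
    then show ?case using Gx[OF XV, of 0] by (simp add: X_Suc)
  next
    case (Suc i)
    have "mcong n (Suc (Suc i)) (map_mat \<phi> (X (Suc (Suc i)))) (map_mat \<phi> (X (Suc i)))"
      unfolding phiX by (rule rhs_cong[OF Suc _ XR XR]) simp
    then show ?case by (rule mcong_phi_rev[OF XinR XinR])
  qed
  have "\<exists>L. L \<in> V \<and> (\<forall>m. L - X m $$ (i, j) \<in> P m)" if ij: "i < n" "j < n" for i j
  proof -
    have d: "X (Suc m) $$ (i, j) - X m $$ (i, j) \<in> P m" for m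
      using mcongD(3)[OF step ij] P_mono[of m "Suc m"] by simp
    obtain L where "L \<in> V" "\<And>m. L - X m $$ (i, j) \<in> P m"
      by (rule complete_limit[of V "\<lambda>m. X m $$ (i, j)", OF V(2) mat_inD(4)[OF XinV ij] d], rule that)
    then show ?thesis by auto
  qed
  then obtain L where L: "\<And>i j. i < n \<Longrightarrow> j < n \<Longrightarrow> L i j \<in> V \<and> (\<forall>m. L i j - X m $$ (i, j) \<in> P m)"
    by metis
  define u where "u = mat n n (\<lambda>(i, j). L i j)"
  have uV: "u \<in> mat_in n V" using L by (auto simp: mat_in_def u_def)
  have uR: "u \<in> mat_in n R" using mat_in_mono[OF VD(1) uV] .
  have uX: "mcong n m u (X m)" for m
    unfolding mcong_def using L uR XinR by (auto simp: u_def)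
  have uGL: "u \<in> GLm n R" using GLm_cong[OF XR uX] .
  have "map_mat \<phi> u = \<beta> * PhiD p n D u"
  proof (rule mcong_all_eq)
    fix k
    have "mcong n (Suc k) (map_mat \<phi> u) (map_mat \<phi> (X (Suc (Suc k))))"
      using mcong_phi[OF uX[of "Suc (Suc k)"]] by (rule mcong_mono[rotated]) simp
    moreover have "mcong n (Suc k) (map_mat \<phi> (X (Suc (Suc k)))) (\<beta> * PhiD p n D u)"
      unfolding phiX by (rule mcong_mono[OF _ rhs_cong[OF mcong_sym[OF uX[of "Suc k"]]]]) (auto intro: XR uGL)
    ultimately show "mcong n (Suc k) (map_mat \<phi> u) (\<beta> * PhiD p n D u)" by (rule mcong_trans)
  qed
  moreover have "mcong n 1 u u0" using mcong_trans[OF uX X0] .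
  ultimately show ?thesis using uGL uV by (auto simp: \<beta>_def)
qed

lemma solution_unique:
  assumes D: "\<forall>i<n. \<forall>j<n. D i j \<in> Acompl R p n R" and \<beta>: "\<beta> \<in> mat_in n R"
    and u: "u \<in> GLm n R" "map_mat \<phi> u = \<beta> * PhiD p n D u"
    and v: "v \<in> GLm n R" "map_mat \<phi> v = \<beta> * PhiD p n D v"
    and uv: "mcong n 1 u v"
  shows "u = v"
proof (rule mcong_all_eq)
  show "mcong n (Suc k) u v" for k
  proof (induction k)
    case (Suc k)
    then have "mcong n (Suc (Suc k)) (map_mat \<phi> u) (map_mat \<phi> v)"
      unfolding u(2) v(2) by (intro mcong_mult mcong_refl \<beta> PhiD_cong D u v) auto
    then show ?case by (rule mcong_phi_rev[OF GLmD(1)[OF u(1)] GLmD(1)[OF v(1)]])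
  qed (use uv in simp)
qed

section \<open>The equation with Delta equal to zero\<close>

lemma zero_in_Acompl: "(\<lambda>_. 0) \<in> Acompl R p n R"
proof -
  have "(\<lambda>_. 0) \<in> polyfun n R" using R_0 by (rule polyfun.pf_const)
  then show ?thesis unfolding Acompl_def by (force simp: P_zero)
qed

lemma PhiD_zero:
  fixes x :: "'k mat"
  assumes "\<forall>i<n. \<forall>j<n. D i j x = 0" "x \<in> carrier_mat n n"
  shows "PhiD p n D x = frobp p x"
  using assms by (intro eq_matI) (auto simp: PhiD_def Dmat_def frobp_def)

lemma frobp_solution_unique:
  assumes \<beta>: "\<beta> \<in> mat_in n R"
    and u: "u \<in> GLm n R" "map_mat \<phi> u = \<beta> * frobp p u"
    and v: "v \<in> GLm n R" "map_mat \<phi> v = \<beta> * frobp p v"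
    and uv: "mcong n 1 u v"
  shows "u = v"
  by (rule solution_unique[where D = "\<lambda>_ _ _. 0", OF _ \<beta> u(1) _ v(1) _ uv])
    (use u v PhiD_zero[of n "\<lambda>_ _ _. 0"] mat_inD(1)[OF GLmD(1)[OF u(1)]]
      mat_inD(1)[OF GLmD(1)[OF v(1)]] zero_in_Acompl in auto)

text \<open>With \<open>c = 1 + p * a\<close> this is the 1 x 1 case of
  \<open>solution_exists\<close> for Delta equal to zero.\<close>

lemma scalar_solution_exists:
  assumes c: "c \<in> R" "c - 1 \<in> P 1"
  shows "\<exists>\<mu>\<in>R. \<mu> - 1 \<in> P 1 \<and> \<phi> \<mu> = c * \<mu> ^ p"
proof -
  define a where "a = (c - 1) / \<pi>"
  define \<alpha> where "\<alpha> = mat 1 1 (\<lambda>_. a)"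
  have "a \<in> R" using c(2) by (simp add: a_def P_iff)
  then have \<alpha>: "\<alpha> \<in> mat_in 1 R" by (auto simp: \<alpha>_def mat_in_def)
  have one: "1\<^sub>m 1 \<in> GLm 1 R" using R_1 by (auto simp: GLm_def mat_in_one subring_R)
  obtain u where u: "u \<in> GLm 1 R" "map_mat \<phi> u = (1\<^sub>m 1 + \<pi> \<cdot>\<^sub>m \<alpha>) * PhiD p 1 (\<lambda>_ _ _. 0) u" "mcong 1 1 u (1\<^sub>m 1)"
    using solution_exists[OF valuation_subring_self R_complete _ one \<alpha>, of "\<lambda>_ _ _. 0"] zero_in_Acompl by blast
  note uD = mat_inD[OF GLmD(1)[OF u(1)]]
  have "map_mat \<phi> u $$ (0, 0) = ((1\<^sub>m 1 + \<pi> \<cdot>\<^sub>m \<alpha>) * frobp p u) $$ (0, 0)"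
    using u(2) PhiD_zero[of 1 "\<lambda>_ _ _. 0" u] uD by simp
  then have "\<phi> (u $$ (0, 0)) = c * (u $$ (0, 0)) ^ p"
    using uD by (subst (asm) index_mult_mat_sum[of _ 1]) (auto simp: frobp_def \<alpha>_def a_def)
  then show ?thesis using uD(4)[of 0 0] mcongD(3)[OF u(3), of 0 0] by (intro bexI[of _ "u $$ (0, 0)"]) auto
qed

end

section \<open>Types SL and SO\<close>

lemma transpose_smult: "transpose_mat (a \<cdot>\<^sub>m A) = a \<cdot>\<^sub>m transpose_mat A"
  by (intro eq_matI) auto

lemma one_smult_mat: "(1 :: 'a::semiring_1) \<cdot>\<^sub>m A = A"
  by (intro eq_matI) auto

lemma smult_smult_mat: "a \<cdot>\<^sub>m (b \<cdot>\<^sub>m A) = (a * b :: 'a::semiring_1) \<cdot>\<^sub>m A"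
  by (intro eq_matI) (auto simp: mult.assoc)

lemma det_mult3:
  fixes A :: "'a::idom mat"
  assumes "A \<in> carrier_mat n n" "B \<in> carrier_mat n n" "C \<in> carrier_mat n n"
  shows "det (A * B * C) = det A * det B * det C"
  using det_mult[OF mult_carrier_mat[OF assms(1,2)] assms(3)] det_mult[OF assms(1,2)] by simp

text \<open>A common description of the three forms as signed permutation matrices of an involution
  \<open>f\<close>; the sign \<open>e\<close> is 1 in the symmetric and -1 in the symplectic
  case.\<close>

definition signed_involution :: "nat \<Rightarrow> 'a::field \<Rightarrow> 'a mat \<Rightarrow> bool" where
  "signed_involution n e q \<longleftrightarrow> (e = 1 \<or> e = - 1) \<and> (\<exists>f s. (\<forall>i<n. f i < n \<and> f (f i) = i \<and>
     (s i = 1 \<or> s i = - 1) \<and> s (f i) = e * s i) \<and>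
     q = mat n n (\<lambda>(i, j). if j = f i then s i else 0))"

lemma admissible_signed_involution:
  assumes "admissible_q n q" shows "\<exists>e. signed_involution n e q"
proof -
  from assms obtain r where "(n = 2 * r \<and> (q = q_symp r \<or> q = q_split r)) \<or> (n = 2 * r + 1 \<and> q = q_odd r)"
    by (auto simp: admissible_q_def)
  then consider "n = 2 * r" "q = q_symp r" | "n = 2 * r" "q = q_split r" | "n = 2 * r + 1" "q = q_odd r"
    by blast
  then show ?thesis
  proof cases
    case 1
    have "signed_involution n (- 1) q"
      unfolding signed_involution_def 1 q_symp_def
      by (intro conjI disjI2 refl exI[of _ "\<lambda>i. if i < r then i + r else i - r"]
            exI[of _ "\<lambda>i. if i < r then 1 else - 1"] eq_matI) auto
    then show ?thesis by blast
  next
    case 2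
    have "signed_involution n 1 q"
      unfolding signed_involution_def 2 q_split_def
      by (intro conjI disjI1 refl exI[of _ "\<lambda>i. if i < r then i + r else i - r"]
            exI[of _ "\<lambda>i. 1"] eq_matI) auto
    then show ?thesis by blast
  next
    case 3
    have "signed_involution n 1 q"
      unfolding signed_involution_def 3 q_odd_def
      by (intro conjI disjI1 refl exI[of _ "\<lambda>i. if i = 0 then 0 else if i \<le> r then i + r else i - r"]
            exI[of _ "\<lambda>i. 1"] eq_matI) auto
    then show ?thesis by blast
  qed
qed

lemma signed_involutionD:
  fixes q :: "'a::field mat"
  assumes q: "signed_involution n e q"
  shows "e * e = 1" "q \<in> carrier_mat n n" "transpose_mat q = e \<cdot>\<^sub>m q" "q * q = e \<cdot>\<^sub>m 1\<^sub>m n"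
    "odd p \<Longrightarrow> frobp p q = q" "odd p \<Longrightarrow> e ^ p = e"
    "\<And>i j. i < n \<Longrightarrow> j < n \<Longrightarrow> q $$ (i, j) \<in> {0, 1, - 1}"
proof -
  from q obtain f s where e: "e = 1 \<or> e = - 1"
    and f: "\<And>i. i < n \<Longrightarrow> f i < n" "\<And>i. i < n \<Longrightarrow> f (f i) = i"
    and s: "\<And>i. i < n \<Longrightarrow> s i = 1 \<or> s i = - 1" "\<And>i. i < n \<Longrightarrow> s (f i) = e * s i"
    and qf: "q = mat n n (\<lambda>(i, j). if j = f i then s i else 0)"
    unfolding signed_involution_def by blast
  show ee: "e * e = 1" using e by auto
  show ep: "e ^ p = e" if "odd p" using e that by auto
  show qc: "q \<in> carrier_mat n n" by (simp add: qf)
  show ent: "q $$ (i, j) \<in> {0, 1, - 1}" if "i < n" "j < n" for i j using s(1)[OF that(1)] that by (auto simp: qf)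
  show "transpose_mat q = e \<cdot>\<^sub>m q"
  proof (rule eq_matI)
    fix i j assume "i < dim_row (e \<cdot>\<^sub>m q)" "j < dim_col (e \<cdot>\<^sub>m q)"
    then have ij: "i < n" "j < n" using qc by auto
    have "i = f j \<longleftrightarrow> j = f i" using f ij by metis
    then show "transpose_mat q $$ (i, j) = (e \<cdot>\<^sub>m q) $$ (i, j)" using ij s(2)[OF ij(1)] by (simp add: qf)
  qed (use qc in auto)
  show "q * q = e \<cdot>\<^sub>m 1\<^sub>m n"
  proof (rule eq_matI)
    fix i j assume "i < dim_row (e \<cdot>\<^sub>m 1\<^sub>m n)" "j < dim_col (e \<cdot>\<^sub>m 1\<^sub>m n)"
    then have ij: "i < n" "j < n" by auto
    have "(q * q) $$ (i, j) = (\<Sum>l<n. if l = f i then s i * q $$ (l, j) else 0)"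
      unfolding index_mult_mat_sum[OF qc qc ij] using ij by (intro sum.cong) (auto simp: qf)
    also have "\<dots> = s i * q $$ (f i, j)" using f(1)[OF ij(1)] by simp
    also have "\<dots> = (e \<cdot>\<^sub>m 1\<^sub>m n) $$ (i, j)" using ij f[OF ij(1)] s[OF ij(1)] by (auto simp: qf)
    finally show "(q * q) $$ (i, j) = (e \<cdot>\<^sub>m 1\<^sub>m n) $$ (i, j)" .
  qed (use qc in auto)
  show "frobp p q = q" if "odd p"
  proof (rule eq_matI)
    fix i j assume "i < dim_row q" "j < dim_col q"
    then have ij: "i < n" "j < n" using qc by auto
    moreover have "p > 0" using that odd_pos by blast
    ultimately show "frobp p q $$ (i, j) = q $$ (i, j)" using ent[OF ij] qc that by (auto simp: frobp_def)
  qed (auto simp: frobp_def)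
qed

context witt_frobenius
begin

lemma mat_phi_conj:
  assumes "A \<in> carrier_mat n n" "q \<in> carrier_mat n n"
  shows "map_mat \<phi> (transpose_mat A * q * A) = transpose_mat (map_mat \<phi> A) * map_mat \<phi> q * map_mat \<phi> A"
  using mat_hom_mult[OF mult_carrier_mat[OF iffD2[OF transpose_carrier_mat assms(1)] assms(2)] assms(1)]
    mat_hom_mult[OF iffD2[OF transpose_carrier_mat assms(1)] assms(2)]
  by (simp add: map_mat_transpose)

lemma frobp_GLm: "x \<in> GLm n R \<Longrightarrow> frobp p x \<in> GLm n R"
proof -
  assume x: "x \<in> GLm n R"
  have "map_mat \<phi> x \<in> GLm n R"
    using x phi_R[of "inverse (det x)"] phi_P_iff[of "det x"] by (auto simp: GLm_def mat_phi_R hom_inverse)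
  then show ?thesis using GLm_cong mcong_sym[OF mcong_phi_frobp[OF GLmD(1)[OF x]]] by blast
qed

text \<open>Entrywise powers do not commute with determinants, but \<phi> does: both sides are
  compared with \<open>\<phi> (det x)\<close>.\<close>

lemma det_frobp_cong:
  assumes x: "x \<in> mat_in n R" shows "det (frobp p x) - det x ^ p \<in> P 1"
proof -
  have "det (frobp p x) - \<phi> (det x) \<in> P 1"
    using mcong_det[OF mcong_sym[OF mcong_phi_frobp[OF x]]] by simp
  then show ?thesis using phi_cong[OF mat_in_det[OF subring_R x]] by (rule P_trans)
qed

text \<open>Scaling an n x n matrix by \<lambda> multiplies its determinant by the n-th power of
  \<lambda>; the last identity therefore says that \<lambda> times \<open>frobp p x\<close> has
  determinant \<open>det x ^ p\<close>.\<close>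

lemma lambda_SL:
  assumes n: "\<not> p dvd n" and x: "x \<in> GLm n R"
  shows "lambda_SL R p n x \<in> R" "lambda_SL R p n x - 1 \<in> P 1"
    "lambda_SL R p n x ^ n * det (frobp p x) = det x ^ p"
proof -
  define t where "t = (det (frobp p x) / det x ^ p - 1) / \<pi>"
  note xD = GLmD[OF x]
  have "det (frobp p x) / det x ^ p - 1 = (det (frobp p x) - det x ^ p) * inverse (det x) ^ p"
    using xD(2) by (simp add: field_simps)
  also have "\<dots> \<in> P 1" using det_frobp_cong[OF xD(1)] xD(3) by (intro P_multR R_power)
  finally have t: "t \<in> R" by (simp add: t_def P_iff)
  have t1: "1 + \<pi> * t = det (frobp p x) / det x ^ p" by (simp add: t_def)
  have l: "lambda_SL R p n x = bin_series R p (- (1 / of_nat n)) t" by (simp add: lambda_SL_def t_def)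
  show "lambda_SL R p n x \<in> R" "lambda_SL R p n x - 1 \<in> P 1"
    unfolding l using scalar_root(1,2)[OF n t] .
  show "lambda_SL R p n x ^ n * det (frobp p x) = det x ^ p"
    using scalar_root(3)[OF n t] xD(2) unfolding l t1 by (simp add: field_simps)
qed

lemma PhiD_SL:
  assumes D: "type_SL R p n D" and x: "x \<in> GLm n R"
  shows "PhiD p n D x = lambda_SL R p n x \<cdot>\<^sub>m frobp p x"
proof -
  have "Dmat n D x = Delta_SL R p n x" using D x by (auto simp: type_SL_def)
  then show ?thesis by (intro eq_matI) (auto simp: PhiD_def Delta_SL_def frobp_def field_simps)
qed

lemma SL_solution:
  assumes D: "type_SL R p n D" and \<beta>: "\<beta> \<in> mat_in n R" "det \<beta> = 1"
    and u: "u \<in> GLm n R" "map_mat \<phi> u = \<beta> * PhiD p n D u"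
    and u0: "mcong n 1 u u0" "det u0 = 1"
  shows "det u = 1"
proof (rule phi_fixed_unique)
  note uD = GLmD[OF u(1)]
  have Fc: "frobp p u \<in> carrier_mat n n" using mat_inD(1)[OF uD(1)] by (simp add: frobp_def)
  have n: "\<not> p dvd n" using D by (simp add: type_SL_def)
  have "\<phi> (det u) = det (\<beta> * (lambda_SL R p n u \<cdot>\<^sub>m frobp p u))"
    using u(2) by (simp add: PhiD_SL[OF D u(1)] flip: hom_det)
  also have "\<dots> = lambda_SL R p n u ^ n * det (frobp p u)"
    using Fc \<beta> by (simp add: det_mult[of _ n] mat_inD(1))
  also have "\<dots> = det u ^ p" by (rule lambda_SL(3)[OF n u(1)])
  finally show "\<phi> (det u) = det u ^ p" .
  show "det u - 1 \<in> P 1" using mcong_det[OF u0(1)] u0(2) by simp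
  show "det u \<in> R" using mat_in_det[OF subring_R uD(1)] .
qed (use R_1 in auto)

text \<open>With \<open>B = X^t q X\<close> the matrix \<open>L\<close> is the square root of
  \<open>M = B^-1 C\<close>. Both \<open>B\<close> and \<open>C\<close> are symmetric up to the same
  sign \<open>e\<close>, so \<open>M\<close> is self-adjoint for \<open>B\<close>; hence so is
  \<open>L\<close>, and \<open>L^t B L = B L L = B M = C\<close>.\<close>

lemma SO_form:
  assumes odd: "odd p" and q: "signed_involution n e q" and u: "u \<in> GLm n R"
  defines "X \<equiv> frobp p u"
  defines "C \<equiv> frobp p (transpose_mat u * q * u)"
    and "L \<equiv> Lambda_SO R p n q u"
  shows "L \<in> mat_in n R" "transpose_mat (X * L) * q * (X * L) = C"
proof -
  note uD = GLmD[OF u]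
  note qD = signed_involutionD[OF q]
  have qR: "q \<in> mat_in n R" using qD(2,7) R_0 R_1 R_uminus[OF R_1] by (intro mat_inI) force+
  have phiq: "map_mat \<phi> q = q"
    using qD(2,7) by (intro eq_matI) (force simp: hom_distribs)+
  have XG: "X \<in> GLm n R" unfolding X_def by (rule frobp_GLm[OF u])
  have XR: "X \<in> mat_in n R" using GLmD(1)[OF XG] .
  define w where "w = transpose_mat u * q * u"
  have wR: "w \<in> mat_in n R" unfolding w_def by (intro mat_in_mult mat_in_transpose subring_R uD(1) qR)
  define B where "B = transpose_mat X * q * X"
  have BR: "B \<in> mat_in n R" unfolding B_def by (intro mat_in_mult mat_in_transpose subring_R XR qR)
  have CR: "C \<in> mat_in n R" unfolding C_def w_def[symmetric] by (rule mat_in_frobp[OF subring_R wR])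
  note [simp] = mult_carrier_mat[of _ n n _ n] left_mult_one_mat[of _ n n] right_mult_one_mat[of _ n n]
    qD(2) mat_inD(1)[OF XR] mat_inD(1)[OF BR] mat_inD(1)[OF CR] mat_inD(1)[OF wR] mat_inD(1)[OF uD(1)]
  have dq: "det q * det q = e ^ n" 
    using arg_cong[OF qD(4), of det] det_mult[OF qD(2) qD(2)] by simp
  have een: "e ^ n * e ^ n = 1" using qD(1) by (simp flip: power_mult_distrib)
  have qG: "det q \<noteq> 0" "inverse (det q) \<in> R"
  proof -
    have 1: "det q * (det q * e ^ n) = 1" using dq een by (simp flip: mult.assoc)
    then show "det q \<noteq> 0" by auto
    \<comment> \<open>The square of \<open>det q\<close> is a sign, so its fourth power is 1 and its
      cube is its inverse.\<close>
    have "inverse (det q) = det q * (det q * det q)" using 1 dq by (intro inverse_unique) simp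
    then show "inverse (det q) \<in> R" using mat_in_det[OF subring_R qR] R_mult by auto
  qed
  have detB: "det B = det X * det q * det X"
    unfolding B_def by (simp add: det_mult3[of _ n] det_transpose[of _ n])
  have BG: "det B \<noteq> 0" "inverse (det B) \<in> R"
    using qG GLmD(2,3)[OF XG] unfolding detB by (auto intro!: R_mult simp: inverse_mult_distrib)
  \<comment> \<open>The comparison goes through \<open>map_mat \<phi> w\<close>: the entrywise power
    \<open>C\<close> is congruent to it, and \<phi> turns the product \<open>w\<close> into a
    product congruent to \<open>B\<close> factor by factor.\<close>
  have BC: "mcong n 1 C B"
  proof -
    have "mcong n 1 C (map_mat \<phi> w)" unfolding C_def w_def[symmetric] by (rule mcong_sym[OF mcong_phi_frobp[OF wR]])
    moreover have "map_mat \<phi> w = transpose_mat (map_mat \<phi> u) * q * map_mat \<phi> u"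
      unfolding w_def by (simp add: mat_phi_conj[of _ n] phiq)
    moreover have "mcong n 1 (transpose_mat (map_mat \<phi> u) * q * map_mat \<phi> u) B"
      unfolding B_def X_def by (intro mcong_mult mcong_transpose mcong_refl qR mcong_phi_frobp uD(1))
    ultimately show ?thesis by (auto intro: mcong_trans)
  qed
  define M where "M = inv_m B * C"
  note invB = inv_m_mult[OF mat_inD(1)[OF BR] BG(1)]
  note [simp] = invB(3)
  have MR: "M \<in> mat_in n R" unfolding M_def by (intro mat_in_mult mat_in_inv subring_R BR BG CR)
  note [simp] = mat_inD(1)[OF MR]
  have M1: "mcong n 1 M (1\<^sub>m n)"
    using mcong_mult[OF mcong_refl BC, of "inv_m B"] mat_in_inv[OF subring_R BR BG(2)] invB(1)
    by (simp add: M_def)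
  define T where "T = inverse \<pi> \<cdot>\<^sub>m (M - 1\<^sub>m n)"
  have T: "T \<in> mat_in n R"
    using mcongD(3)[OF M1] mat_inD(2,3)[OF MR] by (intro mat_inI) (auto simp: T_def P_iff field_simps)
  note [simp] = mat_inD(1)[OF T]
  have MT: "1\<^sub>m n + \<pi> \<cdot>\<^sub>m T = M" by (intro eq_matI) (auto simp: T_def mat_inD(2,3)[OF MR] simp flip: mult.assoc)
  have BM: "B * M = C"
    unfolding M_def by (simp add: invB(2) flip: assoc_mult_mat[of _ n n _ n _ n])
  have Bt: "transpose_mat B = e \<cdot>\<^sub>m B"
    unfolding B_def by (simp add: transpose_mult[of _ n n _ n] qD(3) assoc_mult_mat[of _ n n _ n _ n]
        mult_smult_assoc_mat[of _ n n _ n] mult_smult_distrib[of _ n n _ n])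
  have wt: "transpose_mat w = e \<cdot>\<^sub>m w"
    unfolding w_def by (simp add: transpose_mult[of _ n n _ n] qD(3) assoc_mult_mat[of _ n n _ n _ n]
        mult_smult_assoc_mat[of _ n n _ n] mult_smult_distrib[of _ n n _ n])
  \<comment> \<open>Entrywise p-th powers turn the sign \<open>e\<close> into \<open>e ^ p\<close>,
    which is \<open>e\<close> again because \<open>p\<close> is odd.\<close>
  have Ct: "transpose_mat C = e \<cdot>\<^sub>m C"
  proof -
    have "transpose_mat C = frobp p (transpose_mat w)"
      unfolding C_def w_def[symmetric] frobp_def by (simp add: map_mat_transpose)
    also have "\<dots> = e \<cdot>\<^sub>m C"
      unfolding wt C_def w_def[symmetric] using qD(6)[OF odd]
      by (intro eq_matI) (auto simp: frobp_def power_mult_distrib)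
    finally show ?thesis .
  qed
  have MB: "transpose_mat M * B = B * M"
  proof -
    have "transpose_mat M * B = transpose_mat (transpose_mat B * M)"
      by (simp add: transpose_mult[of _ n n _ n])
    also have "\<dots> = C"
      unfolding Bt by (simp add: mult_smult_assoc_mat[of _ n n _ n] BM transpose_smult Ct smult_smult_mat qD(1) one_smult_mat)
    finally show ?thesis by (simp add: BM)
  qed
  have "transpose_mat T = inverse \<pi> \<cdot>\<^sub>m (transpose_mat M - 1\<^sub>m n)"
    unfolding T_def by (simp add: transpose_smult transpose_minus[of _ n n])
  then have "transpose_mat T * B = inverse \<pi> \<cdot>\<^sub>m ((transpose_mat M - 1\<^sub>m n) * B)"
    using mult_smult_assoc_mat[of "transpose_mat M - 1\<^sub>m n" n n B n "inverse \<pi>"] by (simp add: minus_carrier_mat)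
  also have "(transpose_mat M - 1\<^sub>m n) * B = transpose_mat M * B - B"
    using minus_mult_distrib_mat[of "transpose_mat M" n n "1\<^sub>m n" B n] by simp
  also have "transpose_mat M * B - B = B * (M - 1\<^sub>m n)"
    using mult_minus_distrib_mat[of B n n M n "1\<^sub>m n"] by (simp add: MB)
  also have "inverse \<pi> \<cdot>\<^sub>m \<dots> = B * T"
    unfolding T_def using mult_smult_distrib[of B n n "M - 1\<^sub>m n" n "inverse \<pi>"] by (simp add: minus_carrier_mat)
  finally have TB: "transpose_mat T * B = B * T" .
  have Leq: "L = mat_bin_series R p n (1 / 2) T"
    unfolding L_def Lambda_SO_def Let_def T_def M_def B_def C_def X_def ..
  note L = mat_sqrt[OF odd T, folded Leq]
  show LR: "L \<in> mat_in n R" by (rule L(1))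
  note [simp] = mat_inD(1)[OF LR]
  have "transpose_mat (X * L) * q * (X * L) = transpose_mat L * B * L"
    unfolding B_def by (simp add: transpose_mult[of _ n n _ n] assoc_mult_mat[of _ n n _ n _ n])
  also have "\<dots> = B * (L * L)" unfolding L(3)[OF BR TB] by (simp add: assoc_mult_mat[of _ n n _ n _ n])
  also have "\<dots> = C" by (simp add: L(2) MT BM)
  finally show "transpose_mat (X * L) * q * (X * L) = C" .
qed

text \<open>Since \<beta> preserves \<open>q\<close>, it drops out of the form evaluated at
  \<open>map_mat \<phi> u\<close>. The entries of \<open>q\<close> are 0, 1 and -1, so
  \<open>q\<close> satisfies the same entrywise equation as \<open>w\<close>.\<close>

lemma SO_solution:
  assumes odd: "odd p" and D: "type_SO R p n q D" and \<beta>: "\<beta> \<in> mat_in n R" "transpose_mat \<beta> * q * \<beta> = q"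
    and u: "u \<in> GLm n R" "map_mat \<phi> u = \<beta> * PhiD p n D u"
    and u0: "mcong n 1 u u0" "u0 \<in> SOq n R q"
  shows "u \<in> SOq n R q"
proof -
  obtain e where q: "signed_involution n e q"
    using D admissible_signed_involution unfolding type_SO_def by blast
  note uD = GLmD[OF u(1)]
  note qD = signed_involutionD[OF q]
  have qR: "q \<in> mat_in n R" using qD(2,7) R_0 R_1 R_uminus[OF R_1] by (intro mat_inI) force+
  have phiq: "map_mat \<phi> q = q"
    using qD(2,7) by (intro eq_matI) (force simp: hom_distribs)+
  define L where "L = Lambda_SO R p n q u"
  define X where "X = frobp p u"
  note S = SO_form[OF odd q u(1), folded L_def X_def]
  have XR: "X \<in> mat_in n R" unfolding X_def by (rule mat_in_frobp[OF subring_R uD(1)])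
  note [simp] = mult_carrier_mat[of _ n n _ n] left_mult_one_mat[of _ n n] right_mult_one_mat[of _ n n]
    qD(2) mat_inD(1)[OF XR] mat_inD(1)[OF S(1)] mat_inD(1)[OF uD(1)] mat_inD(1)[OF \<beta>(1)]
  have "Dmat n D u = Delta_SO R p n q u" using D u(1) by (auto simp: type_SO_def)
  then have "Dmat n D u = X * (inverse \<pi> \<cdot>\<^sub>m (L - 1\<^sub>m n))"
    unfolding Delta_SO_def L_def X_def .
  also have "\<dots> = inverse \<pi> \<cdot>\<^sub>m (X * (L - 1\<^sub>m n))"
    by (rule mult_smult_distrib[of _ n n _ n]) auto
  also have "X * (L - 1\<^sub>m n) = X * L - X"
    using mult_minus_distrib_mat[of X n n L n "1\<^sub>m n"] by (simp add: right_mult_one_mat[of X n n])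
  finally have Dm: "Dmat n D u = inverse \<pi> \<cdot>\<^sub>m (X * L - X)" .
  have "X * L \<in> carrier_mat n n" by simp
  then have Phi: "PhiD p n D u = X * L"
    unfolding PhiD_def Dm X_def[symmetric]
    by (intro eq_matI) (auto simp: mat_inD(2,3)[OF XR] mat_inD(2,3)[OF S(1)] simp del: index_mult_mat(1)
      simp flip: mult.assoc)
  define w where "w = transpose_mat u * q * u"
  have wR: "w \<in> mat_in n R" unfolding w_def by (intro mat_in_mult mat_in_transpose subring_R uD(1) qR)
  have "map_mat \<phi> w = transpose_mat (map_mat \<phi> u) * q * map_mat \<phi> u"
    unfolding w_def by (simp add: mat_phi_conj[of _ n] phiq)
  also have "\<dots> = transpose_mat (X * L) * (transpose_mat \<beta> * q * \<beta>) * (X * L)"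
    unfolding u(2) Phi by (simp add: transpose_mult[of _ n n _ n] assoc_mult_mat[of _ n n _ n _ n])
  finally have phiw: "map_mat \<phi> w = frobp p w" unfolding \<beta>(2) S(2) w_def .
  have wq: "mcong n 1 w q"
  proof -
    have "mcong n 1 w (transpose_mat u0 * q * u0)"
      unfolding w_def by (intro mcong_mult mcong_transpose mcong_refl qR u0(1))
    then show ?thesis using u0(2) by (simp add: SOq_def)
  qed
  have "w = q"
  proof (rule eq_matI)
    fix i j assume "i < dim_row q" "j < dim_col q"
    then have ij: "i < n" "j < n" using qD(2) by auto
    show "w $$ (i, j) = q $$ (i, j)"
    proof (rule phi_fixed_unique[OF mat_inD(4)[OF wR ij] _ mat_inD(4)[OF qR ij] _ mcongD(3)[OF wq ij]])
      show "\<phi> (w $$ (i, j)) = (w $$ (i, j)) ^ p"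
        using arg_cong[OF phiw, of "\<lambda>A. A $$ (i, j)"] ij mat_inD(2,3)[OF wR] by (simp add: frobp_def)
      show "\<phi> (q $$ (i, j)) = (q $$ (i, j)) ^ p"
        using arg_cong[OF phiq, of "\<lambda>A. A $$ (i, j)"] arg_cong[OF qD(5)[OF odd], of "\<lambda>A. A $$ (i, j)"] ij
          carrier_matD[OF qD(2)] by (simp add: frobp_def)
    qed
  qed (use mat_inD[OF wR] carrier_matD[OF qD(2)] in auto)
  \<comment> \<open>The form determines \<open>det u\<close> only up to sign. The residue class of
    \<open>u0\<close> selects 1, since 1 and -1 are incongruent modulo an odd prime.\<close>
  have "det q * det q = e ^ n" 
    using arg_cong[OF qD(4), of det] det_mult[OF qD(2) qD(2)] by simp
  then have dq: "det q \<noteq> 0" using qD(1) by auto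
  have "det u * det q * det u = det q"
    using arg_cong[OF \<open>w = q\<close>, of det] unfolding w_def by (simp add: det_mult3[of _ n] det_transpose[of _ n])
  then have "(det u - 1) * (det u + 1) = 0" using dq by (simp add: algebra_simps)
  moreover have du: "det u - 1 \<in> P 1" using mcong_det[OF u0(1)] u0(2) by (simp add: SOq_def SLm_def)
  moreover have "det u \<noteq> - 1"
  proof
    assume "det u = - 1"
    then have "- (1 + 1) \<in> P 1" using du by (simp add: algebra_simps)
    then have 2: "(of_nat 2 :: 'k) \<in> P 1" using P_uminus[of "- (1 + 1)" 1] by simp
    have "\<not> p dvd 2" using odd prime_p
      by (metis dvd_refl even_numeral prime_nat_iff two_is_prime_nat primes_dvd_imp_eq)
    then show False using unit_not_P[OF _ inverse_of_nat_R, of 2] 2 by simp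
  qed
  ultimately have "det u = 1" by (auto simp: add_eq_0_iff2)
  then show ?thesis using \<open>w = q\<close> uD(1) by (simp add: SOq_def SLm_def w_def)
qed

end

section \<open>Finite-dimensional algebras over a subfield\<close>

definition lin_span :: "'k::field set \<Rightarrow> 'k set \<Rightarrow> 'k set" where
  "lin_span F S = {\<Sum>s\<in>S. c s * s | c. \<forall>s\<in>S. c s \<in> F}"

definition finitely_spanned :: "'k::field set \<Rightarrow> 'k set \<Rightarrow> bool" where
  "finitely_spanned F E \<longleftrightarrow> (\<exists>S. finite S \<and> S \<subseteq> E \<and> E \<subseteq> lin_span F S)"

text \<open>The algebra \<open>F[Z]\<close>. Negatives come from the constant -1 and inverses will
  come from finiteness of the span, so neither has a rule.\<close>

inductive_set alg_gen :: "'k::field set \<Rightarrow> 'k set \<Rightarrow> 'k set" for F Z where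
  alg_const: "c \<in> F \<Longrightarrow> c \<in> alg_gen F Z"
| alg_var: "z \<in> Z \<Longrightarrow> z \<in> alg_gen F Z"
| alg_add: "a \<in> alg_gen F Z \<Longrightarrow> b \<in> alg_gen F Z \<Longrightarrow> a + b \<in> alg_gen F Z"
| alg_mult: "a \<in> alg_gen F Z \<Longrightarrow> b \<in> alg_gen F Z \<Longrightarrow> a * b \<in> alg_gen F Z"

lemma subfield_ofD:
  assumes "subfield_of F" shows "subring_of F" "\<And>a. a \<in> F \<Longrightarrow> inverse a \<in> F"
proof -
  show *: "subring_of F" using assms by (simp add: subfield_of_def)
  show "inverse a \<in> F" if "a \<in> F" for a
    using assms that subring_ofD(1)[OF *] by (cases "a = 0") (auto simp: subfield_of_def)
qed

lemma lin_span_0: "subring_of F \<Longrightarrow> 0 \<in> lin_span F S"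
  unfolding lin_span_def using subring_ofD(1)[of F] by (intro CollectI exI[of _ "\<lambda>_. 0"]) auto

lemma lin_span_add: 
  assumes F: "subring_of F" and "a \<in> lin_span F S" "b \<in> lin_span F S" shows "a + b \<in> lin_span F S"
proof -
  obtain c d where "a = (\<Sum>s\<in>S. c s * s)" "b = (\<Sum>s\<in>S. d s * s)" "\<forall>s\<in>S. c s \<in> F" "\<forall>s\<in>S. d s \<in> F"
    using assms by (auto simp: lin_span_def)
  then show ?thesis
    unfolding lin_span_def using subring_ofD(3)[OF F]
    by (intro CollectI exI[of _ "\<lambda>s. c s + d s"]) (auto simp: sum.distrib distrib_right)
qed

lemma lin_span_scale:
  assumes F: "subring_of F" and x: "x \<in> F" and "a \<in> lin_span F S" shows "x * a \<in> lin_span F S"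
proof -
  obtain c where "a = (\<Sum>s\<in>S. c s * s)" "\<forall>s\<in>S. c s \<in> F" using assms by (auto simp: lin_span_def)
  then show ?thesis
    unfolding lin_span_def using subring_ofD(4)[OF F x]
    by (intro CollectI exI[of _ "\<lambda>s. x * c s"]) (auto simp: sum_distrib_left mult.assoc)
qed

lemma lin_span_sum:
  "subring_of F \<Longrightarrow> (\<And>x. x \<in> X \<Longrightarrow> f x \<in> lin_span F S) \<Longrightarrow> (\<Sum>x\<in>X. f x) \<in> lin_span F S"
  by (induction X rule: infinite_finite_induct) (auto intro: lin_span_0 lin_span_add)

lemma lin_span_base:
  assumes F: "subring_of F" and S: "finite S" "s \<in> S" shows "s \<in> lin_span F S"
proof -
  have "(\<Sum>t\<in>S. (if t = s then 1 else 0) * t) = (\<Sum>t\<in>S. if t = s then t else 0)"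
    by (intro sum.cong) auto
  then have "s = (\<Sum>t\<in>S. (if t = s then 1 else 0) * t)" using S by simp
  then show ?thesis
    unfolding lin_span_def using subring_ofD(1,2)[OF F]
    by (intro CollectI exI[of _ "\<lambda>t. if t = s then 1 else 0"]) auto
qed

lemma lin_span_mult:
  assumes F: "subring_of F" and a: "a \<in> lin_span F S" and b: "b \<in> lin_span F T"
    and ST: "\<And>s t. s \<in> S \<Longrightarrow> t \<in> T \<Longrightarrow> s * t \<in> lin_span F U"
  shows "a * b \<in> lin_span F U"
proof -
  obtain c d where a: "a = (\<Sum>s\<in>S. c s * s)" "\<forall>s\<in>S. c s \<in> F" and b: "b = (\<Sum>s\<in>T. d s * s)" "\<forall>s\<in>T. d s \<in> F"
    using a b by (auto simp: lin_span_def)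
  have "a * b = (\<Sum>s\<in>S. \<Sum>t\<in>T. c s * (d t * (s * t)))"
    unfolding a b sum_product by (intro sum.cong) (auto simp: mult_ac)
  moreover have "c s * (d t * (s * t)) \<in> lin_span F U" if "s \<in> S" "t \<in> T" for s t
    using a(2) b(2) that by (intro lin_span_scale[OF F _ lin_span_scale[OF F _ ST]]) auto
  ultimately show ?thesis by (auto intro!: lin_span_sum F)
qed

lemma subring_alg_gen:
  assumes F: "subring_of F" shows "subring_of (alg_gen F Z)"
proof -
  have "- 1 * a \<in> alg_gen F Z" if "a \<in> alg_gen F Z" for a
    using subring_ofD(2,5)[OF F] by (intro alg_mult[OF alg_const that]) auto
  then show ?thesis
    using subring_ofD(1,2)[OF F] by (auto simp: subring_of_def intro: alg_gen.intros)
qed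

lemma alg_gen_mono: "a \<in> alg_gen F Z \<Longrightarrow> Z \<subseteq> Y \<Longrightarrow> a \<in> alg_gen F Y"
  by (induction rule: alg_gen.induct) (auto intro: alg_gen.intros)

lemma size_multiset_le:
  assumes "finite Z" "set_mset M \<subseteq> Z" "\<And>z. z \<in> Z \<Longrightarrow> count M z \<le> b"
  shows "size M \<le> card Z * b"
proof -
  have "size M = (\<Sum>z\<in>Z. count M z)"
    unfolding size_multiset_overloaded_eq using assms(1,2)
    by (intro sum.mono_neutral_left) (auto simp: count_eq_zero_iff)
  also have "\<dots> \<le> (\<Sum>z\<in>Z. b)" using assms(3) by (rule sum_mono)
  finally show ?thesis by simp
qed

lemma prod_mset_repeat: "prod_mset (replicate_mset k z + N) = z ^ k * prod_mset N"
  by simp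

text \<open>A monomial with an exponent \<open>\<ge> e\<close> is a combination of monomials of smaller degree, so the
  monomials of bounded degree span.\<close>
lemma alg_gen_finite_span:
  assumes F: "subring_of F" and Z: "finite Z" and e: "e \<ge> 2"
    and red: "\<And>z. z \<in> Z \<Longrightarrow> z ^ e \<in> lin_span F Z"
  shows "finitely_spanned F (alg_gen F Z)"
proof -
  \<comment> \<open>A monomial with more than \<open>card Z * e\<close> factors contains some
    generator more than \<open>e\<close> times. Rewriting \<open>z ^ e\<close> replaces
    \<open>e\<close> factors by one, a strict drop because \<open>e \<ge> 2\<close>.\<close>
  define B where "B = card Z * e"
  define S where "S = (\<lambda>xs. prod_mset (mset xs)) ` {xs. set xs \<subseteq> Z \<and> length xs \<le> B}"
  have S: "finite S" unfolding S_def using finite_lists_length_le[OF Z] by auto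
  have mono: "set_mset M \<subseteq> Z \<Longrightarrow> prod_mset M \<in> lin_span F S" for M
  proof (induction "size M" arbitrary: M rule: less_induct)
    case less
    show ?case
    proof (cases "size M \<le> B")
      case True
      obtain xs where "mset xs = M" using ex_mset by blast
      then have "prod_mset M \<in> S" using True less(2) unfolding S_def
        by (auto intro!: image_eqI[of _ _ xs])
      then show ?thesis by (rule lin_span_base[OF F S])
    next
      case False
      then obtain z where z: "z \<in> Z" "count M z > e"
        using size_multiset_le[OF Z less(2), of e] unfolding B_def by (meson not_le)
      define N where "N = M - replicate_mset e z"
      have M: "M = replicate_mset e z + N"
        unfolding N_def using z(2) by (intro multiset_eqI) auto
      have NZ: "set_mset N \<subseteq> Z" using less(2) M by auto
      have "z ^ e * prod_mset N \<in> lin_span F S"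
      proof -
        obtain c where c: "z ^ e = (\<Sum>y\<in>Z. c y * y)" "\<forall>y\<in>Z. c y \<in> F"
          using red[OF z(1)] by (auto simp: lin_span_def)
        have "z ^ e * prod_mset N = (\<Sum>y\<in>Z. c y * prod_mset (add_mset y N))"
          unfolding c(1) sum_distrib_right by (intro sum.cong) (auto simp: mult.assoc)
        also have "\<dots> \<in> lin_span F S"
          using c(2) NZ e by (intro lin_span_sum lin_span_scale F less(1)) (auto simp: M)
        finally show ?thesis .
      qed
      then show ?thesis unfolding M prod_mset_repeat .
    qed
  qed
  have "a \<in> lin_span F S" if "a \<in> alg_gen F Z" for a
    using that
  proof (induction rule: alg_gen.induct)
    case (alg_const c)
    then show ?case using lin_span_scale[OF F alg_const mono[of "{#}"]] by simp
  next
    case (alg_var z)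
    then show ?case using mono[of "{#z#}"] by simp
  next
    case (alg_mult a b)
    show ?case
    proof (rule lin_span_mult[OF F alg_mult(3,4)])
      fix s t assume "s \<in> S" "t \<in> S"
      then obtain xs ys where "s = prod_mset (mset xs)" "t = prod_mset (mset ys)" "set xs \<subseteq> Z" "set ys \<subseteq> Z"
        by (auto simp: S_def)
      then show "s * t \<in> lin_span F S" using mono[of "mset xs + mset ys"] by simp
    qed
  qed (rule lin_span_add[OF F])
  moreover have "prod_mset M \<in> alg_gen F Z" if "set_mset M \<subseteq> Z" for M
    using that by (induction M) (auto intro: alg_gen.intros subring_ofD(2)[OF F])
  then have "S \<subseteq> alg_gen F Z" by (auto simp: S_def)
  ultimately show ?thesis using S unfolding finitely_spanned_def by blast
qed

text \<open>Elements are polynomials in \<open>y\<close> over \<open>F[Z]\<close>, and exponents of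
  \<open>y\<close> reduce modulo \<open>n\<close>. So a spanning set of \<open>F[Z]\<close>
  multiplied by the powers \<open>y ^ i\<close> with \<open>i < n\<close> suffices.\<close>

lemma alg_gen_insert_root:
  assumes F: "subring_of F" and fin: "finitely_spanned F (alg_gen F Z)"
    and y: "y ^ n \<in> alg_gen F Z" "n \<ge> 1"
  shows "finitely_spanned F (alg_gen F (insert y Z))"
proof -
  obtain S where S: "finite S" "S \<subseteq> alg_gen F Z" "alg_gen F Z \<subseteq> lin_span F S"
    using fin unfolding finitely_spanned_def by blast
  define T where "T = (\<lambda>(s, i). s * y ^ i) ` (S \<times> {..<n})"
  have T: "finite T" using S(1) by (simp add: T_def)
  have E: "subring_of (alg_gen F Z)" by (rule subring_alg_gen[OF F])
  have pw: "e * y ^ i \<in> lin_span F T" if "e \<in> alg_gen F Z" for e i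
  proof -
    have e': "e * (y ^ n) ^ (i div n) \<in> alg_gen F Z"
      by (rule subring_ofD(4)[OF E that subring_of_power[OF E y(1)]])
    have "e * y ^ i = e * (y ^ n) ^ (i div n) * y ^ (i mod n)"
      by (simp flip: power_mult power_add add: mult.assoc)
    also have "\<dots> \<in> lin_span F T"
    proof -
      obtain c where c: "e * (y ^ n) ^ (i div n) = (\<Sum>s\<in>S. c s * s)" "\<forall>s\<in>S. c s \<in> F"
        using e' S(3) by (auto simp: lin_span_def)
      have "s * y ^ (i mod n) \<in> T" if "s \<in> S" for s
        using that y(2) unfolding T_def by (intro image_eqI[of _ _ "(s, i mod n)"]) auto
      then show ?thesis
        unfolding c(1) sum_distrib_right mult.assoc using c(2)
        by (intro lin_span_sum lin_span_scale lin_span_base F T) auto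
    qed
    finally show ?thesis .
  qed
  have "\<exists>I f. finite I \<and> (\<forall>i\<in>I. f i \<in> alg_gen F Z) \<and> a = (\<Sum>i\<in>I. f i * y ^ i)" if "a \<in> alg_gen F (insert y Z)" for a
  proof -
    have "\<exists>q. (\<forall>i. coeff q i \<in> alg_gen F Z) \<and> a = poly q y" using that
    proof (induction rule: alg_gen.induct)
      case (alg_const c)
      then show ?case using subring_ofD(1)[OF E] 
        by (intro exI[of _ "[:c:]"]) (auto simp: coeff_pCons split: nat.split intro: alg_gen.intros)
    next
      case (alg_var z)
      then consider "z = y" | "z \<in> Z" by auto
      then show ?case
      proof cases
        case 1
        then show ?thesis using subring_ofD(1,2)[OF E]
          by (intro exI[of _ "[:0, 1:]"]) (auto simp: coeff_pCons split: nat.split)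
      next
        case 2
        then show ?thesis using subring_ofD(1)[OF E] 
          by (intro exI[of _ "[:z:]"]) (auto simp: coeff_pCons split: nat.split intro: alg_gen.intros)
      qed
    next
      case (alg_add a b)
      then obtain q r where "\<forall>i. coeff q i \<in> alg_gen F Z" "a = poly q y" "\<forall>i. coeff r i \<in> alg_gen F Z" "b = poly r y"
        by blast
      then show ?case by (intro exI[of _ "q + r"]) (auto intro: alg_gen.intros)
    next
      case (alg_mult a b)
      then obtain q r where "\<forall>i. coeff q i \<in> alg_gen F Z" "a = poly q y" "\<forall>i. coeff r i \<in> alg_gen F Z" "b = poly r y"
        by blast
      then show ?case 
        by (intro exI[of _ "q * r"]) (auto simp: coeff_mult intro!: subring_of_sum[OF E] alg_gen.alg_mult)
    qed
    then show ?thesis unfolding poly_altdef by blast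
  qed
  then have "a \<in> lin_span F T" if "a \<in> alg_gen F (insert y Z)" for a
    using that pw by (metis (no_types, lifting) lin_span_sum[OF F])
  moreover have "T \<subseteq> alg_gen F (insert y Z)"
    using S(2) unfolding T_def
    by (auto intro!: alg_gen.alg_mult subring_of_power[OF subring_alg_gen[OF F]] intro: alg_gen.intros alg_gen_mono)
  ultimately show ?thesis using T unfolding finitely_spanned_def by blast
qed

lemma alg_gen_union_roots:
  assumes F: "subring_of F" and fin: "finitely_spanned F (alg_gen F Z)" and Y: "finite Y"
    and y: "\<And>y. y \<in> Y \<Longrightarrow> y ^ n \<in> alg_gen F Z" "n \<ge> 1"
  shows "finitely_spanned F (alg_gen F (Y \<union> Z))"
  using Y y(1)
proof (induction Y rule: finite_induct)
  case (insert y Y)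
  have "y ^ n \<in> alg_gen F (Y \<union> Z)" using insert(4) by (auto intro: alg_gen_mono)
  then show ?case using insert alg_gen_insert_root[OF F _ _ y(2), of "Y \<union> Z" y] by simp
qed (use fin in auto)

text \<open>A relation \<open>a + b * q(b) = 0\<close> with \<open>a \<noteq> 0\<close> exhibits the
  inverse of \<open>b\<close> as \<open>- q(b) / a\<close>. If \<open>a = 0\<close>, a factor
  \<open>b\<close> cancels and the induction continues with \<open>q\<close>.\<close>

lemma inverse_from_root:
  assumes E: "subring_of E" and F: "subfield_of F" "F \<subseteq> E" and b: "b \<in> E" "b \<noteq> 0"
  shows "q \<noteq> 0 \<Longrightarrow> \<forall>i. coeff q i \<in> F \<Longrightarrow> poly q b = 0 \<Longrightarrow> inverse b \<in> E"
proof (induction q rule: pCons_induct)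
  case (pCons a q)
  have q: "coeff q i \<in> F" for i using pCons(4)[rule_format, of "Suc i"] by simp
  have a: "a \<in> F" using pCons(4)[rule_format, of 0] by simp
  show ?case
  proof (cases "a = 0")
    case True
    then show ?thesis using pCons q b by auto
  next
    case False
    have "poly q b \<in> E"
      unfolding poly_altdef using q F(2) b
      by (intro subring_of_sum subring_ofD(4)[OF E] subring_of_power E) auto
    moreover have "inverse a \<in> E" using subfield_ofD(2)[OF F(1) a] F(2) by auto
    ultimately have "- (inverse a * poly q b) \<in> E" using subring_ofD(4,5)[OF E] by blast
    moreover have "- (inverse a * poly q b) = inverse b"
      using pCons(5) False b(2) by (simp add: field_simps add_eq_0_iff2)
    ultimately show ?thesis by simp
  qed
qed simp

text \<open>Cayley-Hamilton: multiplication by \<open>b\<close> on a finite spanning set gives a monic equation for \<open>b\<close>.\<close>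
lemma inverse_in_finite_span:
  assumes E: "subring_of E" and F: "subfield_of F" "F \<subseteq> E" and fin: "finitely_spanned F E"
    and b: "b \<in> E" "b \<noteq> 0"
  shows "inverse b \<in> E"
proof -
  have sF: "subring_of F" by (rule subfield_ofD(1)[OF F(1)])
  obtain S where S: "finite S" "S \<subseteq> E" "E \<subseteq> lin_span F S" using fin unfolding finitely_spanned_def by blast
  define N where "N = card S"
  obtain g where g: "bij_betw g {..<N} S"
    using ex_bij_betw_nat_finite[OF S(1)] unfolding N_def atLeast0LessThan by blast
  have gS: "g i \<in> S" if "i < N" for i using bij_betwE[OF g] that by auto
  have "\<exists>c. (\<forall>s\<in>S. c s \<in> F) \<and> b * g i = (\<Sum>s\<in>S. c s * s)" if "i < N" for i
  proof -
    have "b * g i \<in> lin_span F S" using subring_ofD(4)[OF E b(1), of "g i"] gS[OF that] S(2,3) by blast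
    then show ?thesis unfolding lin_span_def by blast
  qed
  then obtain c where c: "\<And>i s. i < N \<Longrightarrow> s \<in> S \<Longrightarrow> c i s \<in> F" "\<And>i. i < N \<Longrightarrow> b * g i = (\<Sum>s\<in>S. c i s * s)"
    by metis
  define C where "C = mat N N (\<lambda>(i, j). c i (g j))"
  have C: "C \<in> carrier_mat N N" by (simp add: C_def)
  define v where "v = vec N g"
  have "C *\<^sub>v v = b \<cdot>\<^sub>v v"
  proof (rule eq_vecI)
    fix i assume "i < dim_vec (b \<cdot>\<^sub>v v)"
    then have i: "i < N" by (simp add: v_def)
    have "(C *\<^sub>v v) $ i = (\<Sum>j<N. c i (g j) * g j)"
      using i by (auto simp: C_def v_def scalar_prod_def atLeast0LessThan)
    also have "\<dots> = b * g i" unfolding c(2)[OF i] by (rule sum.reindex_bij_betw[OF g])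
    finally show "(C *\<^sub>v v) $ i = (b \<cdot>\<^sub>v v) $ i" using i by (simp add: v_def)
  qed (simp add: C_def v_def)
  \<comment> \<open>The spanning set may be linearly dependent; for an eigenvector it is enough that
    not all of its members vanish, and otherwise 1 would not be spanned.\<close>
  moreover have "v \<noteq> 0\<^sub>v N"
  proof
    assume v0: "v = 0\<^sub>v N"
    have "s = 0" if "s \<in> S" for s
    proof -
      have "s \<in> g ` {..<N}" using that bij_betw_imp_surj_on[OF g] by simp
      then obtain i where "i < N" "s = g i" by blast
      then show ?thesis using arg_cong[OF v0, of "\<lambda>x. x $ i"] by (simp add: v_def)
    qed
    then have "(\<Sum>s\<in>S. c s * s) = 0" for c by (intro sum.neutral) auto
    moreover have "1 \<in> lin_span F S" using S(3) subring_ofD(2)[OF E] by auto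
    ultimately show False by (auto simp: lin_span_def)
  qed
  ultimately have "eigenvector C v b" using C by (simp add: eigenvector_def v_def)
  then have root: "poly (char_poly C) b = 0"
    using eigenvalue_root_char_poly[OF C] by (auto simp: eigenvalue_def)
  have "char_poly C \<in> {q. \<forall>i. coeff q i \<in> F}"
    unfolding char_poly_def
  proof (rule det_closed[OF char_poly_matrix_closed[OF C]])
    fix i j assume "i < N" "j < N"
    then show "char_poly_matrix C $$ (i, j) \<in> {q. \<forall>i. coeff q i \<in> F}"
      using c(1)[OF _ gS] C subring_ofD(1,2,5)[OF sF] subring_ofD(6)[OF sF]
      by (auto simp: char_poly_matrix_def C_def coeff_pCons split: nat.split)
  qed (use subring_ofD[OF sF] in \<open>auto simp: coeff_mult coeff_1 intro!: subring_of_sum[OF sF]\<close>)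
  moreover have "char_poly C \<noteq> 0" using degree_monic_char_poly[OF C] by auto
  ultimately show ?thesis using inverse_from_root[OF E F b] root by blast
qed

section \<open>Finite residue fields\<close>

lemma field_hom_funpow:
  fixes h :: "'a::field \<Rightarrow> 'a"
  assumes "field_hom h" shows "field_hom (h ^^ i)"
proof (induction i)
  case 0
  show ?case by unfold_locales auto
next
  case (Suc i)
  interpret field_hom h by (rule assms)
  interpret i: field_hom "h ^^ i" by (rule Suc)
  show ?case by unfold_locales (auto simp: hom_add hom_mult i.hom_add i.hom_mult)
qed

context witt_frobenius
begin

lemma phi_funpow_R: "a \<in> R \<Longrightarrow> (\<phi> ^^ i) a \<in> R"
  by (induction i) (auto simp: phi_R)

lemma phi_funpow_P: "a \<in> P k \<Longrightarrow> (\<phi> ^^ i) a \<in> P k"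
  by (induction i) (auto simp: phi_P)

lemma phi_funpow_cong: "a \<in> R \<Longrightarrow> (\<phi> ^^ i) a - a ^ (p ^ i) \<in> P 1"
proof (induction i)
  case (Suc i)
  have "\<phi> ((\<phi> ^^ i) a) - ((\<phi> ^^ i) a) ^ p \<in> P 1" by (rule phi_cong[OF phi_funpow_R[OF Suc(2)]])
  moreover have "((\<phi> ^^ i) a) ^ p - (a ^ (p ^ i)) ^ p \<in> P 1"
    using Suc by (intro P_cong_power phi_funpow_R R_power) auto
  ultimately show ?case using P_trans by (simp add: mult.commute flip: power_mult)
qed (simp add: P_zero)

text \<open>Each residue class has its own Frobenius period because the residue field of
  \<open>R\<close> is algebraic over its prime field. Finitely many classes have the product of
  these periods in common.\<close>

lemma finite_residue_field_period:
  assumes V: "valuation_subring R V" and fin: "finite_residue_field V"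
  obtains m where "m \<ge> 1" "\<And>a. a \<in> V \<Longrightarrow> a ^ (p ^ m) - a \<in> P 1"
proof -
  note VD = valuation_subringD[OF V]
  \<comment> \<open>The maximal ideal of \<open>V\<close> is cut out by \<open>P 1\<close>, since an
    inverse lying in \<open>R\<close> of an element of \<open>V\<close> belongs to
    \<open>V\<close>.\<close>
  have nu: "x \<in> nonunits_of V \<longleftrightarrow> x \<in> V \<and> x \<in> P 1" for x
    using unit_of_not_P[of x] VD(1,3) unit_not_P[of x] P_zero unfolding nonunits_of_def by blast
  define cls where "cls x = {y \<in> V. x - y \<in> nonunits_of V}" for x
  have "finite (cls ` V)" using fin by (simp add: finite_residue_field_def cls_def)
  then obtain C where C: "C \<subseteq> V" "finite C" "cls ` V = cls ` C" using finite_subset_image[of "cls ` V" cls V] by blast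
  have "\<exists>m. m \<ge> 1 \<and> c ^ (p ^ m) - c \<in> P 1" if "c \<in> R" for c
    using residue_periodic[OF that] by metis
  then obtain h where h: "\<And>c. c \<in> R \<Longrightarrow> h c \<ge> 1 \<and> c ^ (p ^ h c) - c \<in> P 1" by metis
  define m where "m = (\<Prod>c\<in>C. h c)"
  have "m \<ge> 1" unfolding m_def using h C(1) VD(1) by (intro prod_ge_1) auto
  moreover have "a ^ (p ^ m) - a \<in> P 1" if a: "a \<in> V" for a
  proof -
    have aR: "a \<in> R" using a VD(1) by auto
    have "a \<in> cls a" using a subring_ofD(1)[OF VD(2)] by (simp add: cls_def nu P_zero)
    moreover obtain c where c: "c \<in> C" "cls a = cls c" using a C(3) by blast
    ultimately have "a \<in> cls c" by blast
    then have ca: "c - a \<in> P 1" by (simp add: cls_def nu)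
    have cR: "c \<in> R" using c C(1) VD(1) by auto
    have pw: "c ^ (p ^ (h c * k)) - c \<in> P 1" for k
    proof (induction k)
      case (Suc k)
      have "(c ^ (p ^ (h c * k))) ^ (p ^ h c) - c ^ (p ^ h c) \<in> P 1"
        using Suc cR by (intro P_cong_power R_power)
      moreover have "(c ^ (p ^ (h c * k))) ^ (p ^ h c) = c ^ (p ^ (h c * Suc k))"
        by (simp add: power_add mult.commute flip: power_mult)
      ultimately show ?case using h[OF cR] P_trans by metis
    qed (simp add: P_zero)
    have "m = h c * (\<Prod>c\<in>C - {c}. h c)" unfolding m_def by (rule prod.remove[OF C(2) c(1)])
    then have "c ^ (p ^ m) - c \<in> P 1" using pw by simp
    moreover have "a ^ (p ^ m) - c ^ (p ^ m) \<in> P 1" using P_cong_power[OF P_sym[OF ca] aR cR] .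
    ultimately show ?thesis using ca by (blast intro: P_trans)
  qed
  ultimately show ?thesis by (rule that)
qed

text \<open>Write \<open>a = c + p a'\<close> with \<open>c\<close> a high power of \<open>a\<close>: then \<open>\<phi>\<^sup>m c \<equiv> c\<close> to high order, and \<open>a'\<close> is
  handled by the induction hypothesis.\<close>
lemma phi_funpow_period_id:
  assumes V: "valuation_subring R V" and m: "m \<ge> 1" "\<And>a. a \<in> V \<Longrightarrow> a ^ (p ^ m) - a \<in> P 1" and a: "a \<in> V"
  shows "(\<phi> ^^ m) a = a"
proof -
  interpret pm: field_hom "\<phi> ^^ m" by (rule field_hom_funpow[OF field_hom_axioms])
  note VD = valuation_subringD[OF V]
  have base: "(\<phi> ^^ m) a - a \<in> P 1" if "a \<in> V" for a
    using phi_funpow_cong m(2)[OF that] that VD(1) by (blast intro: P_trans)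
  have pw: "a ^ (p ^ (m * j)) - a \<in> P 1" if "a \<in> V" for a j
  proof (induction j)
    case (Suc j)
    have "(a ^ (p ^ (m * j))) ^ (p ^ m) - a ^ (p ^ (m * j)) \<in> P 1"
      by (rule m(2)[OF subring_of_power[OF VD(2) that]])
    moreover have "(a ^ (p ^ (m * j))) ^ (p ^ m) = a ^ (p ^ (m * Suc j))"
      by (simp add: power_add mult.commute flip: power_mult)
    ultimately show ?case using Suc P_trans by metis
  qed (simp add: P_zero)
  have "\<forall>a\<in>V. (\<phi> ^^ m) a - a \<in> P (Suc k)" for k
  proof (induction k)
    case (Suc k)
    show ?case
    proof
      fix a assume a: "a \<in> V"
      have aR: "a \<in> R" using a VD(1) by auto
      \<comment> \<open>The exponent is a power of \<open>p ^ m\<close>, which keeps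
        \<open>c\<close> in the residue class of \<open>a\<close>, and it raises the known
        congruence to precision \<open>1 + m * Suc k\<close>.\<close>
      define c where "c = a ^ (p ^ (m * Suc k))"
      define a' where "a' = (a - c) / \<pi>"
      have cV: "c \<in> V" unfolding c_def by (rule subring_of_power[OF VD(2) a])
      have "a - c \<in> P 1" unfolding c_def using pw[OF a] P_sym by blast
      then have a'V: "a' \<in> V" unfolding a'_def using subring_ofD(6)[OF VD(2) a cV] by (intro VD(4)) (auto simp: P_iff)
      have "((\<phi> ^^ m) a) ^ (p ^ (m * Suc k)) - a ^ (p ^ (m * Suc k)) \<in> P (1 + m * Suc k)"
        by (intro P_cong_power_pp base a aR phi_funpow_R) simp
      then have "(\<phi> ^^ m) c - c \<in> P (1 + m * Suc k)" by (simp only: c_def pm.hom_power)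
      moreover have "Suc (Suc k) \<le> 1 + m * Suc k" using m(1) mult_le_mono1[of 1 m "Suc k"] by simp
      ultimately have 1: "(\<phi> ^^ m) c - c \<in> P (Suc (Suc k))" using P_mono by blast
      have 2: "\<pi> * ((\<phi> ^^ m) a' - a') \<in> P (Suc (Suc k))" using P_mult[OF P_pi] Suc a'V by fastforce
      have "a = c + \<pi> * a'" by (simp add: a'_def)
      then have "(\<phi> ^^ m) a = (\<phi> ^^ m) c + \<pi> * (\<phi> ^^ m) a'" 
        by (metis pm.hom_add pm.hom_mult pm.hom_of_nat)
      then have "(\<phi> ^^ m) a - a = ((\<phi> ^^ m) c - c) + \<pi> * ((\<phi> ^^ m) a' - a')"
        using \<open>a = c + \<pi> * a'\<close> by (simp add: algebra_simps)
      then show "(\<phi> ^^ m) a - a \<in> P (Suc (Suc k))" using P_add[OF 1 2] by simp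
    qed
  qed (use base in simp)
  then show ?thesis using a P_all_Suc_eq by blast
qed

lemma frobp_solution_period:
  assumes V: "valuation_subring R V" and m: "m \<ge> 1" "\<And>a. a \<in> V \<Longrightarrow> a ^ (p ^ m) - a \<in> P 1"
    and \<beta>: "\<beta> \<in> mat_in n V" and w: "w \<in> GLm n R" "map_mat \<phi> w = \<beta> * frobp p w"
    and u0: "u0 \<in> mat_in n V" "mcong n 1 w u0"
  shows "map_mat (\<phi> ^^ m) w = w"
proof (rule frobp_solution_unique)
  interpret pm: field_hom "\<phi> ^^ m" by (rule field_hom_funpow[OF field_hom_axioms])
  note VD = valuation_subringD[OF V] and wD = GLmD[OF w(1)]
  note id = phi_funpow_period_id[OF V m]
  let ?v = "map_mat (\<phi> ^^ m) w"
  show \<beta>R: "\<beta> \<in> mat_in n R" using mat_in_mono[OF VD(1) \<beta>] .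
  have Fc: "frobp p w \<in> carrier_mat n n" using mat_inD(1)[OF wD(1)] by (simp add: frobp_def)
  show v: "?v \<in> GLm n R"
  proof -
    have "inverse (det ?v) = (\<phi> ^^ m) (inverse (det w))" by (simp add: pm.hom_inverse)
    then have "inverse (det ?v) \<in> R" using phi_funpow_R[OF wD(3)] by simp
    moreover have "det ?v \<noteq> 0" using wD(2) by simp
    ultimately show ?thesis using wD(1) phi_funpow_R by (auto simp: GLm_def mat_in_def)
  qed
  have "map_mat \<phi> ?v = map_mat (\<phi> ^^ m) (map_mat \<phi> w)"
    by (intro eq_matI) (auto simp: funpow_swap1)
  also have "\<dots> = map_mat (\<phi> ^^ m) \<beta> * map_mat (\<phi> ^^ m) (frobp p w)"
    unfolding w(2) by (rule pm.mat_hom_mult[OF mat_inD(1)[OF \<beta>] Fc])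
  also have "map_mat (\<phi> ^^ m) \<beta> = \<beta>"
    by (intro eq_matI) (auto intro!: id mat_inD(4)[OF \<beta>] simp: mat_inD(2,3)[OF \<beta>])
  also have "map_mat (\<phi> ^^ m) (frobp p w) = frobp p ?v"
    by (intro eq_matI) (auto simp: frobp_def pm.hom_power)
  finally show "map_mat \<phi> ?v = \<beta> * frobp p ?v" .
  have "mcong n 1 ?v (map_mat (\<phi> ^^ m) u0)"
    using u0(2) phi_funpow_R phi_funpow_P by (auto simp: mcong_def mat_in_def pm.hom_minus[symmetric])
  also have "map_mat (\<phi> ^^ m) u0 = u0"
    by (intro eq_matI) (auto intro!: id mat_inD(4)[OF u0(1)] simp: mat_inD(2,3)[OF u0(1)])
  finally show "mcong n 1 ?v w" using u0(2) by (blast intro: mcong_trans mcong_sym)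
qed (use w in auto)

lemma alg_gen_phi:
  assumes "\<And>c. c \<in> F \<Longrightarrow> \<phi> c \<in> F" "\<And>z. z \<in> Z \<Longrightarrow> \<phi> z \<in> Z" "a \<in> alg_gen F Z"
  shows "\<phi> a \<in> alg_gen F Z"
  using assms(3) by (induction rule: alg_gen.induct) (auto simp: hom_distribs assms(1,2) intro: alg_gen.intros)

text \<open>A power of \<open>p\<close> clears all denominators, and it lies in
  \<open>F\<close>.\<close>

lemma subfield_frac:
  assumes F: "subfield_of F" "V = R \<inter> F" shows "F \<subseteq> frac_of V"
proof
  fix c assume c: "c \<in> F"
  note sF = subfield_ofD(1)[OF F(1)]
  obtain k where k: "\<pi> ^ k * c \<in> R" using ex_pi_power_mult by blast
  have pF: "\<pi> ^ k \<in> F" by (intro subring_of_power subring_of_of_nat sF)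
  have "c = (\<pi> ^ k * c) / \<pi> ^ k" by simp
  moreover have "\<pi> ^ k * c \<in> V" using k c F(2) subring_ofD(4)[OF sF pF] by blast
  moreover have "\<pi> ^ k \<in> V" using F(2) pF by (auto intro: R_power R_of_nat)
  ultimately show "c \<in> frac_of V" unfolding frac_of_def by fastforce
qed

lemma delta_subring_phi_subfield:
  assumes F: "subfield_of F" "V = R \<inter> F" and \<delta>: "delta_subring R p \<phi> V" and c: "c \<in> F"
  shows "\<phi> c \<in> F"
proof -
  have V: "\<phi> a \<in> F" if "a \<in> V" for a
  proof -
    have sV: "subring_of V" using \<delta> by (simp add: delta_subring_def)
    have "\<phi> a = \<pi> * pdelta p \<phi> a + a ^ p" by (simp add: pdelta_def)
    also have "\<dots> \<in> V"
      using \<delta> that by (intro subring_ofD(3,4) subring_of_power subring_of_of_nat sV) (auto simp: delta_subring_def)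
    finally show ?thesis using F(2) by simp
  qed
  obtain a b where "c = a / b" "a \<in> V" "b \<in> V" using subfield_frac[OF F] c by (auto simp: frac_of_def)
  then have "\<phi> c = \<phi> a * inverse (\<phi> b)" by (simp add: divide_inverse hom_distribs)
  then show ?thesis
    using V subfield_ofD[OF F(1)] \<open>a \<in> V\<close> \<open>b \<in> V\<close> by (auto intro: subring_ofD(4))
qed

text \<open>The division by \<open>p\<close> in \<delta> is harmless twice over: it stays in
  \<open>R\<close> by the Frobenius congruence, and in \<open>F[G]\<close> because a finitely
  spanned algebra inside a field contains the inverses of its nonzero elements. The latter also
  places the fraction field of \<open>V'\<close> inside \<open>F[G]\<close>.\<close>

lemma finite_delta_extension:
  assumes F: "subfield_of F" "V = R \<inter> F" "\<And>c. c \<in> F \<Longrightarrow> \<phi> c \<in> F"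
    and fin: "finitely_spanned F (alg_gen F G)" and G: "\<And>z. z \<in> G \<Longrightarrow> \<phi> z \<in> G"
  defines "V' \<equiv> R \<inter> alg_gen F G"
  shows "delta_subring R p \<phi> V'" "generically_finite V V'" 
proof -
  let ?E = "alg_gen F G"
  note sF = subfield_ofD(1)[OF F(1)]
  have E: "subring_of ?E" by (rule subring_alg_gen[OF sF])
  have FE: "F \<subseteq> ?E" by (auto intro: alg_gen.intros)
  have inv: "inverse b \<in> ?E" if "b \<in> ?E" for b
    using inverse_in_finite_span[OF E F(1) FE fin that] that by (cases "b = 0") auto
  have "pdelta p \<phi> a \<in> V'" if a: "a \<in> V'" for a
  proof -
    have "(\<phi> a - a ^ p) / \<pi> \<in> R" using phi_cong[of a] a by (simp add: V'_def P_iff)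
    moreover have "(\<phi> a - a ^ p) * inverse \<pi> \<in> ?E"
      using a alg_gen_phi[OF F(3) G] unfolding V'_def
      by (intro subring_ofD(4,6) subring_of_power inv subring_of_of_nat E) auto
    ultimately show ?thesis by (simp add: pdelta_def V'_def divide_inverse)
  qed
  then show "delta_subring R p \<phi> V'"
    using E subring_R by (auto simp: delta_subring_def V'_def subring_of_def)
  obtain S where S: "finite S" "?E \<subseteq> lin_span F S" using fin by (auto simp: finitely_spanned_def)
  have "frac_of V' \<subseteq> ?E"
    using inv subring_ofD(4)[OF E] by (auto simp: frac_of_def V'_def divide_inverse)
  also have "\<dots> \<subseteq> lin_span (frac_of V) S"
    using S(2) subfield_frac[OF F(1,2)] unfolding lin_span_def by blast
  finally show "generically_finite V V'"
    using S(1) FE F(2) unfolding generically_finite_def lin_span_def V'_def by blast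
qed

text \<open>For \<open>a\<close> and \<open>b\<close> congruent to 1 the cofactor of
  \<open>a - b\<close> in \<open>a ^ n - b ^ n\<close> is congruent to \<open>n\<close>, a
  unit.\<close>

lemma nth_root_unique:
  assumes n: "\<not> p dvd n" and a: "a \<in> R" "a - 1 \<in> P 1" and b: "b \<in> R" "b - 1 \<in> P 1" and eq: "a ^ n = b ^ n"
  shows "a = b"
proof -
  have "(\<Sum>i<n. b ^ (n - Suc i) * a ^ i - 1 ^ (n - Suc i) * 1 ^ i) \<in> P 1"
    using a b by (intro P_sum P_cong_mult P_cong_power R_intros) auto
  then have s: "(\<Sum>i<n. b ^ (n - Suc i) * a ^ i) - of_nat n \<in> P 1" by (simp add: sum_subtractf)
  have "of_nat n \<noteq> (0 :: 'k)" using n by (intro notI) auto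
  then have "(\<Sum>i<n. b ^ (n - Suc i) * a ^ i) \<noteq> 0"
    using unit_cong(1)[OF _ inverse_of_nat_R[OF n] s R_of_nat] by blast
  then show ?thesis using power_diff_sumr2[of a n b] eq by simp
qed

text \<open>The entries \<open>z\<close> of the finitely many matrices \<open>\<phi>\<^sup>i w\<close> satisfy \<open>z\<^sup>p = linear form in the z's\<close> over \<open>F\<close>.\<close>
lemma frobp_solution_finite:
  assumes F: "subfield_of F" "V = R \<inter> F" "\<And>c. c \<in> F \<Longrightarrow> \<phi> c \<in> F"
    and m: "m \<ge> 1" "map_mat (\<phi> ^^ m) w = w"
    and \<beta>: "\<beta> \<in> mat_in n V" "det \<beta> \<noteq> 0" and w: "w \<in> mat_in n R" "map_mat \<phi> w = \<beta> * frobp p w"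
  obtains Z where "finitely_spanned F (alg_gen F Z)" "\<And>z. z \<in> Z \<Longrightarrow> \<phi> z \<in> Z" "w \<in> mat_in n Z"
proof -
  note sF = subfield_ofD(1)[OF F(1)]
  define z where "z i a b = (\<phi> ^^ i) (w $$ (a, b))" for i a b
  define Z where "Z = (\<lambda>(i, a, b). z i a b) ` ({..<m} \<times> {..<n} \<times> {..<n})"
  have finZ: "finite Z" by (simp add: Z_def)
  have zZ: "z i a b \<in> Z" if "i < m" "a < n" "b < n" for i a b
    unfolding Z_def using that by (intro image_eqI[of _ _ "(i, a, b)"]) auto
  \<comment> \<open>Past the last index the period leads back to index 0, which makes the finite set
    \<open>Z\<close> stable under \<phi>.\<close>
  have z_Suc: "z (Suc i) a b \<in> Z" if "i < m" "a < n" "b < n" for i a b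
  proof (cases "Suc i = m")
    case True
    then have "z (Suc i) a b = map_mat (\<phi> ^^ m) w $$ (a, b)"
      using that mat_inD(2,3)[OF w(1)] by (simp add: z_def)
    also have "\<dots> = z 0 a b" unfolding m(2) by (simp add: z_def)
    finally show ?thesis using zZ that m(1) by simp
  qed (use zZ that in auto)
  have phiZ: "\<phi> y \<in> Z" if "y \<in> Z" for y
  proof -
    obtain i a b where y: "y = z i a b" "i < m" "a < n" "b < n" using \<open>y \<in> Z\<close> by (auto simp: Z_def)
    then show ?thesis using z_Suc[of i a b] by (simp add: z_def)
  qed
  have FiF: "(\<phi> ^^ i) c \<in> F" if "c \<in> F" for i c
    using that by (induction i) (auto simp: F(3))
  have \<beta>F: "\<beta> \<in> mat_in n F" using \<beta>(1) F(2) by (auto simp: mat_in_def)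
  define \<gamma> where "\<gamma> = inv_m \<beta>"
  have \<gamma>F: "\<gamma> \<in> mat_in n F"
    unfolding \<gamma>_def by (intro mat_in_inv sF \<beta>F subfield_ofD(2)[OF F(1)] mat_in_det[OF sF \<beta>F])
  have Fc: "frobp p w \<in> carrier_mat n n" using mat_inD(1)[OF w(1)] by (simp add: frobp_def)
  have inv\<beta>: "\<gamma> * \<beta> = 1\<^sub>m n" unfolding \<gamma>_def by (rule inv_m_mult(1)[OF mat_inD(1)[OF \<beta>F] \<beta>(2)])
  \<comment> \<open>The equation is solved for the p-th powers: they become linear in the entries of
    the next conjugate, with coefficients in \<open>F\<close>.\<close>
  have fr: "frobp p w = \<gamma> * map_mat \<phi> w"
    unfolding w(2) using Fc inv\<beta> 
    by (simp add: assoc_mult_mat[OF mat_inD(1)[OF \<gamma>F] mat_inD(1)[OF \<beta>F] Fc, symmetric])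
  have red: "y ^ p \<in> lin_span F Z" if "y \<in> Z" for y
  proof -
    obtain i a b where y: "y = z i a b" "i < m" "a < n" "b < n" using \<open>y \<in> Z\<close> by (auto simp: Z_def)
    interpret pi: field_hom "\<phi> ^^ i" by (rule field_hom_funpow[OF field_hom_axioms])
    have "w $$ (a, b) ^ p = (\<Sum>c<n. \<gamma> $$ (a, c) * map_mat \<phi> w $$ (c, b))"
      using arg_cong[OF fr, of "\<lambda>A. A $$ (a, b)"] y(3,4) mat_inD(1-3)[OF w(1)]
      by (subst (asm) index_mult_mat_sum[OF mat_inD(1)[OF \<gamma>F]]) (auto simp: frobp_def)
    also have "\<dots> = (\<Sum>c<n. \<gamma> $$ (a, c) * \<phi> (w $$ (c, b)))"
      using y(4) mat_inD(2,3)[OF w(1)] by simp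
    finally have "y ^ p = (\<Sum>c<n. (\<phi> ^^ i) (\<gamma> $$ (a, c)) * z (Suc i) c b)"
      unfolding y(1) z_def by (simp add: pi.hom_power[symmetric] pi.hom_sum pi.hom_mult funpow_swap1)
    also have "\<dots> \<in> lin_span F Z"
      using y by (intro lin_span_sum lin_span_scale lin_span_base sF finZ FiF mat_inD(4)[OF \<gamma>F] z_Suc) auto
    finally show ?thesis .
  qed
  have "finitely_spanned F (alg_gen F Z)"
    using alg_gen_finite_span[OF sF finZ prime_ge_2_nat[OF prime_p] red] .
  moreover have "w \<in> mat_in n Z"
    using zZ[of 0] m(1) mat_inD(1)[OF w(1)] by (intro mat_inI) (auto simp: z_def)
  ultimately show ?thesis using that phiZ by blast
qed

lemma one_plus_pi_det:
  assumes "\<alpha> \<in> mat_in n R" shows "det (1\<^sub>m n + \<pi> \<cdot>\<^sub>m \<alpha>) \<noteq> 0"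
  using unit_cong(1)[of 1 "det (1\<^sub>m n + \<pi> \<cdot>\<^sub>m \<alpha>)"] mcong_det[OF one_plus_pi(2)[OF assms]] R_1 by simp

theorem GL_solution_finite:
  assumes V: "valuation_subring R V" "delta_subring R p \<phi> V" "finite_residue_field V"
    and u0: "u0 \<in> mat_in n V" and \<alpha>: "\<alpha> \<in> mat_in n V"
    and u: "u \<in> GLm n R" "map_mat \<phi> u = (1\<^sub>m n + \<pi> \<cdot>\<^sub>m \<alpha>) * frobp p u" "mcong n 1 u u0"
  shows "\<exists>V'. delta_subring R p \<phi> V' \<and> generically_finite V V' \<and> u \<in> mat_in n V'"
proof -
  obtain F where F: "subfield_of F" "V = R \<inter> F" using V(1) by (auto simp: valuation_subring_def)
  note VD = valuation_subringD[OF V(1)] and phiF = delta_subring_phi_subfield[OF F V(2)]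
  obtain m where m: "m \<ge> 1" "\<And>a. a \<in> V \<Longrightarrow> a ^ (p ^ m) - a \<in> P 1"
    using finite_residue_field_period[OF V(1,3)] by blast
  let ?\<beta> = "1\<^sub>m n + \<pi> \<cdot>\<^sub>m \<alpha>"
  have \<beta>: "?\<beta> \<in> mat_in n V"
    by (intro mat_in_add mat_in_one mat_in_smult subring_of_of_nat VD(2) \<alpha>)
  have d: "det ?\<beta> \<noteq> 0" by (rule one_plus_pi_det[OF mat_in_mono[OF VD(1) \<alpha>]])
  note per = frobp_solution_period[OF V(1) m \<beta> u(1,2) u0 u(3)]
  obtain Z where Z: "finitely_spanned F (alg_gen F Z)" "\<And>z. z \<in> Z \<Longrightarrow> \<phi> z \<in> Z" "u \<in> mat_in n Z"
    using frobp_solution_finite[OF F phiF m(1) per \<beta> d GLmD(1)[OF u(1)] u(2)] by blast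
  have "u \<in> mat_in n (R \<inter> alg_gen F Z)"
    using Z(3) GLmD(1)[OF u(1)] by (auto simp: mat_in_def intro: alg_gen.intros)
  then show ?thesis using finite_delta_extension[OF F phiF Z(1,2)] by blast
qed

text \<open>Rescaling: choose \<open>\<mu> \<equiv> 1\<close> with \<open>\<phi> \<mu> = \<lambda>\<^sup>-\<^sup>1 \<mu>\<^sup>p\<close>. Then \<open>w = \<mu> u\<close> solves the equation of type \<open>GL\<close>, and
  \<open>\<mu>\<^sup>n = det w\<close> is algebraic over the ring generated by the conjugates of \<open>w\<close>.\<close>
theorem SL_solution_finite:
  assumes V: "valuation_subring R V" "delta_subring R p \<phi> V" "finite_residue_field V"
    and u0: "u0 \<in> mat_in n V" and \<alpha>: "\<alpha> \<in> mat_in n V" and n: "n \<ge> 1" "\<not> p dvd n"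
    and l: "l \<in> R" "l - 1 \<in> P 1"
    and u: "u \<in> GLm n R" "map_mat \<phi> u = (1\<^sub>m n + \<pi> \<cdot>\<^sub>m \<alpha>) * (l \<cdot>\<^sub>m frobp p u)" "mcong n 1 u u0" "det u = 1"
  shows "\<exists>V'. delta_subring R p \<phi> V' \<and> generically_finite V V' \<and> u \<in> mat_in n V'"
proof -
  obtain F where F: "subfield_of F" "V = R \<inter> F" using V(1) by (auto simp: valuation_subring_def)
  note VD = valuation_subringD[OF V(1)] and phiF = delta_subring_phi_subfield[OF F V(2)]
  note sF = subfield_ofD(1)[OF F(1)] and uD = GLmD[OF u(1)]
  obtain m where m: "m \<ge> 1" "\<And>a. a \<in> V \<Longrightarrow> a ^ (p ^ m) - a \<in> P 1"
    using finite_residue_field_period[OF V(1,3)] by blast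
  let ?\<beta> = "1\<^sub>m n + \<pi> \<cdot>\<^sub>m \<alpha>"
  have \<beta>: "?\<beta> \<in> mat_in n V"
    by (intro mat_in_add mat_in_one mat_in_smult subring_of_of_nat VD(2) \<alpha>)
  have d: "det ?\<beta> \<noteq> 0" by (rule one_plus_pi_det[OF mat_in_mono[OF VD(1) \<alpha>]])
  have lu: "l \<noteq> 0" "inverse l \<in> R" using unit_cong[of 1 l] l R_1 by auto
  have "inverse l - 1 \<in> P 1" using inverse_cong[of l 1 1] l lu R_1 by simp
  then obtain \<mu> where \<mu>: "\<mu> \<in> R" "\<mu> - 1 \<in> P 1" "\<phi> \<mu> = inverse l * \<mu> ^ p"
    using scalar_solution_exists[OF lu(2)] by blast
  have \<mu>nz: "\<mu> \<noteq> 0" using unit_cong(1)[of 1 \<mu>] \<mu>(2) R_1 by auto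
  define w where "w = \<mu> \<cdot>\<^sub>m u"
  have Fc: "frobp p u \<in> carrier_mat n n" using mat_inD(1)[OF uD(1)] by (simp add: frobp_def)
  have wR: "w \<in> mat_in n R" unfolding w_def by (intro mat_in_smult subring_R \<mu>(1) uD(1))
  have wu: "mcong n 1 w u"
    unfolding mcong_def
  proof (intro conjI allI impI wR uD(1))
    fix i j assume ij: "i < n" "j < n"
    have "w $$ (i, j) - u $$ (i, j) = (\<mu> - 1) * u $$ (i, j)"
      using ij mat_inD(2,3)[OF uD(1)] by (simp add: w_def algebra_simps)
    then show "w $$ (i, j) - u $$ (i, j) \<in> P 1" using P_multR[OF \<mu>(2) mat_inD(4)[OF uD(1) ij]] by simp
  qed
  have wG: "w \<in> GLm n R" by (rule GLm_cong[OF u(1) wu])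
  have "map_mat \<phi> w = (inverse l * \<mu> ^ p) \<cdot>\<^sub>m map_mat \<phi> u"
    by (intro eq_matI) (auto simp: w_def hom_mult \<mu>(3))
  also have "\<dots> = ?\<beta> * ((inverse l * \<mu> ^ p) \<cdot>\<^sub>m (l \<cdot>\<^sub>m frobp p u))"
    unfolding u(2) using mult_smult_distrib[OF mat_inD(1)[OF \<beta>], of "l \<cdot>\<^sub>m frobp p u" n "inverse l * \<mu> ^ p"] Fc by simp
  also have "(inverse l * \<mu> ^ p) \<cdot>\<^sub>m (l \<cdot>\<^sub>m frobp p u) = frobp p w"
    using lu(1) by (intro eq_matI) (auto simp: w_def frobp_def power_mult_distrib)
  finally have phiw: "map_mat \<phi> w = ?\<beta> * frobp p w" .
  note per = frobp_solution_period[OF V(1) m \<beta> wG phiw u0 mcong_trans[OF wu u(3)]]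
  interpret pm: field_hom "\<phi> ^^ m" by (rule field_hom_funpow[OF field_hom_axioms])
  have \<mu>n: "\<mu> ^ n = det w" using u(4) mat_inD(3)[OF uD(1)] by (simp add: w_def)
  \<comment> \<open>Only the n-th power of \<mu> is visibly fixed by \<open>\<phi> ^^ m\<close>. The
    ambiguity by roots of unity disappears because both roots are congruent to 1. Hence \<mu> has
    finitely many conjugates to adjoin.\<close>
  have \<mu>per: "(\<phi> ^^ m) \<mu> = \<mu>"
  proof (rule nth_root_unique[OF n(2) phi_funpow_R[OF \<mu>(1)] _ \<mu>(1,2)])
    show "(\<phi> ^^ m) \<mu> - 1 \<in> P 1" using phi_funpow_P[OF \<mu>(2), of m] by (simp add: pm.hom_minus)
    show "(\<phi> ^^ m) \<mu> ^ n = \<mu> ^ n"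
      using arg_cong[OF per, of det] by (simp add: \<mu>n flip: pm.hom_power)
  qed
  obtain Z where Z: "finitely_spanned F (alg_gen F Z)" "\<And>z. z \<in> Z \<Longrightarrow> \<phi> z \<in> Z" "w \<in> mat_in n Z"
    using frobp_solution_finite[OF F phiF m(1) per \<beta> d wR phiw] by blast
  define Y where "Y = (\<lambda>i. (\<phi> ^^ i) \<mu>) ` {..<m}"
  have \<mu>Y: "\<mu> \<in> Y" unfolding Y_def using m(1) by (intro image_eqI[of _ _ 0]) auto
  have Y\<phi>: "\<phi> y \<in> Y" if "y \<in> Y" for y
  proof -
    obtain i where i: "i < m" "y = (\<phi> ^^ i) \<mu>" using \<open>y \<in> Y\<close> by (auto simp: Y_def)
    show ?thesis
    proof (cases "Suc i = m")
      case True
      then have "\<phi> y = \<mu>" using \<mu>per i(2) by auto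
      then show ?thesis using \<mu>Y by simp
    next
      case False
      then show ?thesis unfolding Y_def i(2) using i(1) by (intro image_eqI[of _ _ "Suc i"]) auto
    qed
  qed
  have sE: "subring_of (alg_gen F Z)" by (rule subring_alg_gen[OF sF])
  have roots: "y ^ n \<in> alg_gen F Z" if "y \<in> Y" for y
  proof -
    obtain i where i: "y = (\<phi> ^^ i) \<mu>" using \<open>y \<in> Y\<close> by (auto simp: Y_def)
    interpret pi: field_hom "\<phi> ^^ i" by (rule field_hom_funpow[OF field_hom_axioms])
    have "w \<in> mat_in n (alg_gen F Z)" using Z(3) by (auto simp: mat_in_def intro: alg_gen.intros)
    then have "det w \<in> alg_gen F Z" by (rule mat_in_det[OF sE])
    then have "(\<phi> ^^ i) (det w) \<in> alg_gen F Z"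
      by (induction i) (auto intro: alg_gen_phi[OF phiF Z(2)])
    then show ?thesis unfolding i by (simp add: \<mu>n flip: pi.hom_power)
  qed
  define G where "G = Y \<union> Z"
  have fin: "finitely_spanned F (alg_gen F G)"
    unfolding G_def using alg_gen_union_roots[OF sF Z(1) _ roots n(1)] by (simp add: Y_def)
  have G: "\<phi> z \<in> G" if "z \<in> G" for z using that Y\<phi> Z(2) by (auto simp: G_def)
  have sG: "subring_of (alg_gen F G)" by (rule subring_alg_gen[OF sF])
  have "F \<subseteq> alg_gen F G" by (auto intro: alg_gen.intros)
  moreover have "\<mu> \<in> alg_gen F G" using \<mu>Y by (auto simp: G_def intro: alg_gen.intros)
  ultimately have inv: "inverse \<mu> \<in> alg_gen F G" using inverse_in_finite_span[OF sG F(1) _ fin _ \<mu>nz] by blast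
  have "u \<in> mat_in n (R \<inter> alg_gen F G)"
  proof (rule mat_inI)
    fix i j assume ij: "i < n" "j < n"
    have "u $$ (i, j) = inverse \<mu> * w $$ (i, j)"
      using ij \<mu>nz mat_inD(2,3)[OF uD(1)] by (simp add: w_def)
    moreover have "w $$ (i, j) \<in> alg_gen F G"
      using mat_inD(4)[OF Z(3) ij] by (auto simp: G_def intro: alg_gen.intros)
    ultimately show "u $$ (i, j) \<in> R \<inter> alg_gen F G"
      using mat_inD(4)[OF uD(1) ij] subring_ofD(4)[OF sG inv] by auto
  qed (rule mat_inD(1)[OF uD(1)])
  then show ?thesis using finite_delta_extension[OF F phiF fin G] by blast
qed

end

section \<open>The main theorem\<close>

text \<open>Values of \<open>h\<close> outside \<open>R\<close> are arbitrary. Since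
  \<open>h\<close> fixes \<open>p\<close>, its extension is forced by clearing a power of
  \<open>p\<close>, and the result does not depend on the power chosen.\<close>

lemma (in witt_ring) frob_lift_extends:
  assumes "frob_lift R p h"
  obtains f where "\<And>a. a \<in> R \<Longrightarrow> f a = h a" "witt_frobenius R p f"
proof -
  have h_R: "a \<in> R \<Longrightarrow> h a \<in> R" and h_1: "h 1 = 1"
    and h_add: "a \<in> R \<Longrightarrow> b \<in> R \<Longrightarrow> h (a + b) = h a + h b"
    and h_mult: "a \<in> R \<Longrightarrow> b \<in> R \<Longrightarrow> h (a * b) = h a * h b"
    and h_cong: "a \<in> R \<Longrightarrow> h a - a ^ p \<in> P 1" for a b
    using assms by (auto simp: frob_lift_def)
  have h_0: "h 0 = 0" using h_add[of 0 0] R_0 by simp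
  have h_of_nat: "h (of_nat m) = of_nat m" for m
    by (induction m) (auto simp: h_0 h_1 h_add R_1 R_of_nat)
  have h_pi: "h (\<pi> ^ k * a) = \<pi> ^ k * h a" if "a \<in> R" for k a
    using h_mult[OF R_of_nat that, of "p ^ k"] h_of_nat[of "p ^ k"] by simp
  define \<kappa> where "\<kappa> x = (SOME k. \<pi> ^ k * x \<in> R)" for x
  define f where "f x = h (\<pi> ^ \<kappa> x * x) / \<pi> ^ \<kappa> x" for x
  have f_eq: "f x = h (\<pi> ^ k * x) / \<pi> ^ k" if k: "\<pi> ^ k * x \<in> R" for k x
  proof -
    have "\<pi> ^ \<kappa> x * x \<in> R" unfolding \<kappa>_def by (rule someI_ex[OF ex_pi_power_mult])
    then have "\<pi> ^ k * h (\<pi> ^ \<kappa> x * x) = \<pi> ^ \<kappa> x * h (\<pi> ^ k * x)"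
      using h_pi[OF k, of "\<kappa> x"] by (simp add: h_pi[symmetric] mult_ac)
    then show ?thesis by (simp add: f_def field_simps)
  qed
  have f_R: "f a = h a" if "a \<in> R" for a using f_eq[of 0 a] that by simp
  have f_add: "f (x + y) = f x + f y" and f_mult: "f (x * y) = f x * f y" for x y
  proof -
    obtain i j where i: "\<pi> ^ i * x \<in> R" and j: "\<pi> ^ j * y \<in> R" using ex_pi_power_mult by metis
    have x: "\<pi> ^ (i + j) * x \<in> R" using R_mult[OF R_power[OF R_of_nat] i, of p j] by (simp add: power_add mult_ac)
    have y: "\<pi> ^ (i + j) * y \<in> R" using R_mult[OF R_power[OF R_of_nat] j, of p i] by (simp add: power_add mult_ac)
    show "f (x + y) = f x + f y"
      using f_eq[OF x] f_eq[OF y] f_eq[of "i + j" "x + y"] R_add[OF x y] h_add[OF x y]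
      by (simp add: distrib_left add_divide_distrib)
    have e: "\<pi> ^ (i + j) * (x * y) = (\<pi> ^ i * x) * (\<pi> ^ j * y)" by (simp add: power_add mult_ac)
    have "f (x * y) = h (\<pi> ^ i * x) * h (\<pi> ^ j * y) / \<pi> ^ (i + j)"
      using f_eq[of "i + j" "x * y", unfolded e, OF R_mult[OF i j]] unfolding h_mult[OF i j] .
    then show "f (x * y) = f x * f y" using f_eq[OF i] f_eq[OF j] by (simp add: power_add)
  qed
  have "witt_frobenius R p f"
  proof unfold_locales
    show "f 0 = 0" "f 1 = 1" using f_R R_0 R_1 h_0 h_1 by auto
  qed (auto simp: f_add f_mult f_R h_R intro: h_cong[simplified])
  then show ?thesis using that f_R by blast
qed

context witt_frobenius
begin

text \<open>Multiplication by \<open>p\<close> and addition of \<open>frobp p u\<close> turn the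
  equation for \<delta> into one for \<phi>; the step is reversible because \<open>p\<close> is
  invertible in the field.\<close>

lemma is_solution_iff:
  assumes h: "\<And>a. a \<in> R \<Longrightarrow> h a = \<phi> a" and \<alpha>: "\<alpha> \<in> mat_in n R" and u0: "u0 \<in> mat_in n R"
  shows "is_solution R p h n D \<alpha> u0 u \<longleftrightarrow>
    u \<in> GLm n R \<and> map_mat \<phi> u = (1\<^sub>m n + \<pi> \<cdot>\<^sub>m \<alpha>) * PhiD p n D u \<and> mcong n 1 u u0"
proof (cases "u \<in> GLm n R")
  case True
  note uD = mat_inD[OF GLmD(1)[OF True]] and \<alpha>c = mat_inD(1)[OF \<alpha>]
  let ?\<Phi> = "PhiD p n D u"
  have \<Phi>: "?\<Phi> \<in> carrier_mat n n" by (auto simp: PhiD_def Dmat_def)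
  have "(1\<^sub>m n + \<pi> \<cdot>\<^sub>m \<alpha>) * ?\<Phi> = ?\<Phi> + \<pi> \<cdot>\<^sub>m (\<alpha> * ?\<Phi>)"
    using add_mult_distrib_mat[of "1\<^sub>m n" n n "\<pi> \<cdot>\<^sub>m \<alpha>" ?\<Phi> n] \<Phi> \<alpha>c
    by (simp add: mult_smult_assoc_mat[OF \<alpha>c \<Phi>])
  moreover have "map_mat (pdelta p h) u = DeltaAlpha p n D \<alpha> u \<longleftrightarrow> map_mat \<phi> u = ?\<Phi> + \<pi> \<cdot>\<^sub>m (\<alpha> * ?\<Phi>)"
  proof -
    have "pdelta p h (u $$ (i, j)) = (\<alpha> * ?\<Phi>) $$ (i, j) + D i j u \<longleftrightarrow>
        \<phi> (u $$ (i, j)) = ?\<Phi> $$ (i, j) + \<pi> * (\<alpha> * ?\<Phi>) $$ (i, j)" if "i < n" "j < n" for i j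
    proof -
      have "?\<Phi> $$ (i, j) = (u $$ (i, j)) ^ p + \<pi> * D i j u"
        using that uD by (simp add: PhiD_def Dmat_def frobp_def)
      then show ?thesis using h[OF uD(4)[OF that]] by (auto simp: pdelta_def field_simps simp del: index_mult_mat(1))
    qed
    moreover have "\<alpha> * ?\<Phi> \<in> carrier_mat n n" using \<alpha>c \<Phi> by (rule mult_carrier_mat)
    ultimately show ?thesis
      using uD(2,3) \<Phi> by (auto simp: mat_eq_iff DeltaAlpha_def Dmat_def simp del: index_mult_mat)
  qed
  moreover have "mat_cong_p R p n u u0 \<longleftrightarrow> mcong n 1 u u0"
    using GLmD(1)[OF True] u0 by (simp add: mat_cong_p_def mcong_def)
  ultimately show ?thesis using True by (simp add: is_solution_def)
qed (simp add: is_solution_def)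

lemma delta_subring_cong:
  assumes "\<And>a. a \<in> R \<Longrightarrow> h a = \<phi> a" shows "delta_subring R p h V \<longleftrightarrow> delta_subring R p \<phi> V"
  using assms by (auto simp: delta_subring_def pdelta_def subset_iff)

end

theorem theorem1p4:
  fixes R :: "'k::field_char_0 set" and p n :: nat and \<phi> :: "'k \<Rightarrow> 'k"
    and u0 \<alpha> :: "'k mat" and D :: "nat \<Rightarrow> nat \<Rightarrow> 'k mat \<Rightarrow> 'k"
  assumes p: "prime p" "odd p"
    and R: "witt_ring_alg_closure R p"
    and phi: "frob_lift R p \<phi>"
    and n: "n \<ge> 1"
    and u0: "u0 \<in> GLm n R"
    and alpha: "\<alpha> \<in> mat_in n R"
    and D: "\<forall>i<n. \<forall>j<n. D i j \<in> Acompl R p n R"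
  shows "(\<exists>!u. is_solution R p \<phi> n D \<alpha> u0 u) \<and>
    (\<forall>u. is_solution R p \<phi> n D \<alpha> u0 u \<longrightarrow>
      (\<forall>Ov. valuation_subring R Ov \<and> padic_complete R p Ov \<and>
           (\<forall>i<n. \<forall>j<n. D i j \<in> Acompl R p n Ov) \<and> u0 \<in> GLm n Ov \<and> \<alpha> \<in> mat_in n Ov
           \<longrightarrow> u \<in> mat_in n Ov) \<and>
      (u0 \<in> SLm n R \<and> \<alpha> \<in> sl_delta R p n \<and> type_SL R p n D \<longrightarrow> u \<in> SLm n R) \<and>
      (\<forall>q. u0 \<in> SOq n R q \<and> \<alpha> \<in> so_delta R p n q \<and> type_SO R p n q D
           \<longrightarrow> u \<in> SOq n R q) \<and>
      (\<forall>Ov. valuation_subring R Ov \<and> delta_subring R p \<phi> Ov \<and> finite_residue_field Ov \<and>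
           u0 \<in> mat_in n Ov \<and> \<alpha> \<in> mat_in n Ov \<and>
           ((\<forall>i<n. \<forall>j<n. \<forall>x\<in>GLm n R. D i j x = 0) \<or> (type_SL R p n D \<and> u \<in> SLm n R))
           \<longrightarrow> (\<exists>Ov'. delta_subring R p \<phi> Ov' \<and> generically_finite Ov Ov' \<and> u \<in> mat_in n Ov')))"
proof -
  interpret witt_ring R p by unfold_locales (fact p(1) R)+
  obtain f where f: "\<And>a. a \<in> R \<Longrightarrow> f a = \<phi> a" "witt_frobenius R p f"
    by (rule frob_lift_extends[OF phi], rule that)
  interpret witt_frobenius R p f by (rule f(2))
  note u0R = GLmD(1)[OF u0]
  have sol: "is_solution R p \<phi> n D \<alpha> u0 u \<longleftrightarrow>
      u \<in> GLm n R \<and> map_mat f u = (1\<^sub>m n + of_nat p \<cdot>\<^sub>m \<alpha>) * PhiD p n D u \<and> mcong n 1 u u0" for u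
    by (rule is_solution_iff[OF _ alpha u0R]) (simp add: f(1))
  have dsub: "delta_subring R p \<phi> V \<longleftrightarrow> delta_subring R p f V" for V
    by (rule delta_subring_cong) (simp add: f(1))
  let ?\<beta> = "1\<^sub>m n + of_nat p \<cdot>\<^sub>m \<alpha>"
  have \<beta>: "?\<beta> \<in> mat_in n R" by (rule one_plus_pi(1)[OF alpha])
  have unique: "u = v" if "is_solution R p \<phi> n D \<alpha> u0 u" "is_solution R p \<phi> n D \<alpha> u0 v" for u v
  proof -
    note u = that(1)[unfolded sol] and v = that(2)[unfolded sol]
    have "mcong n 1 u u0" "mcong n 1 v u0" using u v by auto
    then have "mcong n 1 u v" by (rule mcong_trans[OF _ mcong_sym])
    then show ?thesis by (rule solution_unique[OF D \<beta>, rotated 4]) (use u v in auto)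
  qed
  have part1: "\<exists>!u. is_solution R p \<phi> n D \<alpha> u0 u"
  proof -
    obtain u where "is_solution R p \<phi> n D \<alpha> u0 u"
      using solution_exists[OF valuation_subring_self R_complete D u0 alpha] unfolding sol by auto
    then show ?thesis using unique by (intro ex1I[of _ u])
  qed
  have part2: "u \<in> mat_in n Ov"
    if u: "is_solution R p \<phi> n D \<alpha> u0 u" and Ov: "valuation_subring R Ov" "padic_complete R p Ov"
      "\<forall>i<n. \<forall>j<n. D i j \<in> Acompl R p n Ov" "u0 \<in> GLm n Ov" "\<alpha> \<in> mat_in n Ov" for u Ov
  proof -
    obtain v where v: "v \<in> mat_in n Ov" "is_solution R p \<phi> n D \<alpha> u0 v"
      using solution_exists[OF Ov] unfolding sol by auto
    show ?thesis using v(1) unfolding unique[OF u v(2)] .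
  qed
  have part3: "u \<in> SLm n R"
    if u: "is_solution R p \<phi> n D \<alpha> u0 u" and SL: "u0 \<in> SLm n R" "\<alpha> \<in> sl_delta R p n" "type_SL R p n D" for u
  proof -
    have "det u = 1"
      by (rule SL_solution[OF SL(3) \<beta>]) (use u SL in \<open>auto simp: sol sl_delta_def SLm_def\<close>)
    then show ?thesis using u unfolding sol by (auto simp: SLm_def GLm_def)
  qed
  have part4: "u \<in> SOq n R q"
    if u: "is_solution R p \<phi> n D \<alpha> u0 u" and SO: "u0 \<in> SOq n R q" "\<alpha> \<in> so_delta R p n q" "type_SO R p n q D" for u q
    by (rule SO_solution[OF p(2) SO(3) \<beta> _ _ _ _ SO(1)]) (use u SO in \<open>auto simp: sol so_delta_def SOq_def\<close>)
  have part5: "\<exists>Ov'. delta_subring R p \<phi> Ov' \<and> generically_finite Ov Ov' \<and> u \<in> mat_in n Ov'"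
    if u: "is_solution R p \<phi> n D \<alpha> u0 u"
      and Ov: "valuation_subring R Ov" "delta_subring R p \<phi> Ov" "finite_residue_field Ov"
        "u0 \<in> mat_in n Ov" "\<alpha> \<in> mat_in n Ov"
      and type: "(\<forall>i<n. \<forall>j<n. \<forall>x\<in>GLm n R. D i j x = 0) \<or> (type_SL R p n D \<and> u \<in> SLm n R)" for u Ov
    using type
  proof
    note uD = u[unfolded sol]
    assume D0: "\<forall>i<n. \<forall>j<n. \<forall>x\<in>GLm n R. D i j x = 0"
    have "PhiD p n D u = frobp p u"
      using D0 uD mat_inD(1)[OF GLmD(1)] by (intro PhiD_zero) auto
    then show ?thesis
      using GL_solution_finite[OF Ov(1) _ Ov(3-5), of u] Ov(2) uD unfolding dsub by auto
  next
    note uD = u[unfolded sol]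
    assume SL: "type_SL R p n D \<and> u \<in> SLm n R"
    then have pn: "\<not> p dvd n" and du: "det u = 1" by (auto simp: type_SL_def SLm_def)
    \<comment> \<open>At the given solution \<lambda> is a single scalar congruent to 1;
      \<open>SL_solution_finite\<close> uses only this and not its dependence on
      \<open>u\<close>.\<close>
    have "PhiD p n D u = lambda_SL R p n u \<cdot>\<^sub>m frobp p u"
      using SL uD by (intro PhiD_SL) auto
    then show ?thesis
      using SL_solution_finite[OF Ov(1) _ Ov(3-5) n pn lambda_SL(1,2)[OF pn], of u u] Ov(2) uD du unfolding dsub by auto
  qed
  show ?thesis
    by (intro conjI allI impI part1; elim conjE;
        ((rule part2; assumption) | (rule part3; assumption) | (rule part4; assumption) | (rule part5; assumption)))
qed

end
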